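(* Let $C>1$ and $\varepsilon=\min\{C-1,1/3\}$. There are constants $\Delta_0=\Delta_0(\varepsilon)$ and $\ell=\ell(\varepsilon)$, depending only on $\varepsilon$, such that for all integers $\Delta>\Delta_0$, every integer $k>C\Delta/\ln\Delta$, and all $n$, the entropy constant of the block dynamics $\mathcal{M}_\ell$ on $T_n$ satisfies $$\alpha_{\mathrm{E}}\ge\frac{1}{4N},$$ where $N=|T_n|$ is the number of vertices of $T_n$, and consequently the mixing time of $\mathcal{M}_\ell$, as a function of $N$, satisfies $$T_{\mathrm{mix}}=O(N\log N).$$
   Context: $T_n$ denotes the complete rooted tree of depth $n$ in which every non-leaf vertex has exactly $\Delta$ children. A (proper) $k$-coloring of $T_n$ is a map from its vertices to $[k]=\{1,\dots,k\}$ giving different colors to adjacent vertices; $\Omega$ is the set of all proper $k$-colorings of $T_n$, and $\pi$ is the uniform distribution on $\Omega$. For a vertex $v$ of $T_n$ and $\ell\ge0$, the block $B_{v,\ell}$ is the set of all descendants of $v$ in $T_n$ (including $v$ itself) whose distance from $v$ is at most $\ell$. The dynamics $\mathcal{M}_\ell$ is the Markov chain on $\Omega$ whose transition $X_t\to X_{t+1}$ is: choose a vertex $v$ of $T_n$ uniformly at random; set $X_{t+1}(w)=X_t(w)$ for all $w\notin B_{v,\ell}$; choose $X_{t+1}(B_{v,\ell})$ uniformly at random from the $k$-colorings of $B_{v,\ell}$ consistent with $X_{t+1}(T_n\setminus B_{v,\ell})$. Its transition matrix is $P$, acting on functions $f:\Omega\to\mathbb{R}$ by $Pf(\sigma)=\sum_{\sigma'}P(\sigma,\sigma')f(\sigma')$.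 For $f:\Omega\to[0,\infty)$ the entropy is $\mathbf{Ent}(f)=\mathbf{E}_\pi[f\ln f]-\mathbf{E}_\pi[f]\ln\mathbf{E}_\pi[f]$ (with $0\ln0=0$). The entropy constant is $$\alpha_{\mathrm{E}}=\inf_{f\ge0}\frac{\mathbf{Ent}(f)-\mathbf{Ent}(Pf)}{\mathbf{Ent}(f)},$$ the infimum being over non-constant functions $f\geq 0$ on $\Omega$. The mixing time is $T_{\mathrm{mix}}=\max_{X_0\in\Omega}\min\{t:\|P^t(X_0,\cdot)-\pi\|\le 1/(2e)\}$, where $\|\cdot\|$ is total variation distance and $P^t(X_0,\cdot)$ is the distribution after $t$ steps started from $X_0$. *)

theory Defs
  imports "HOL-Probability.Probability" "HOL-Library.Landau_Symbols" "HOL-Library.Extended_Nat"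
begin

text \<open>
  A vertex of the tree is the list of child indices on the path leading to it from the root, so the
  root is the empty list and the children of v are the lists v @ [i].
\<close>

type_synonym vertex = "nat list"
type_synonym coloring = "vertex \<Rightarrow> nat"

definition tree_verts :: "nat \<Rightarrow> nat \<Rightarrow> vertex set" where
  "tree_verts \<Delta> n = {v. set v \<subseteq> {..<\<Delta>} \<and> length v \<le> n}"

definition tree_adj :: "vertex \<Rightarrow> vertex \<Rightarrow> bool" where
  "tree_adj v w \<longleftrightarrow> (\<exists>i. w = v @ [i]) \<or> (\<exists>i. v = w @ [i])"

text \<open>Colorings are extensional, i.e. they take a fixed dummy value off the tree.\<close>

definition colorings :: "nat \<Rightarrow> nat \<Rightarrow> nat \<Rightarrow> coloring set" where
  "colorings \<Delta> k n =
     {\<sigma> \<in> tree_verts \<Delta> n \<rightarrow>\<^sub>E {1..k}.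
        \<forall>v \<in> tree_verts \<Delta> n. \<forall>w \<in> tree_verts \<Delta> n. tree_adj v w \<longrightarrow> \<sigma> v \<noteq> \<sigma> w}"

text \<open>In v @ u, the list u is the downward path from v, so its length is the distance from v.\<close>

definition block :: "nat \<Rightarrow> nat \<Rightarrow> nat \<Rightarrow> vertex \<Rightarrow> vertex set" where
  "block \<Delta> n l v = {v @ u | u. v @ u \<in> tree_verts \<Delta> n \<and> length u \<le> l}"

definition block_dynamics ::
  "nat \<Rightarrow> nat \<Rightarrow> nat \<Rightarrow> nat \<Rightarrow> coloring \<Rightarrow> coloring pmf" where
  "block_dynamics \<Delta> k n l \<sigma> =
     bind_pmf (pmf_of_set (tree_verts \<Delta> n))
       (\<lambda>v. pmf_of_set
          {\<tau> \<in> colorings \<Delta> k n. \<forall>w \<in> tree_verts \<Delta> n - block \<Delta> n l v. \<tau> w = \<sigma> w})"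

text \<open>
  The remaining notions concern a transition kernel K on a finite nonempty state space S, with
  the uniform distribution on S in the role of the stationary distribution.
\<close>

definition transition_op :: "'s set \<Rightarrow> ('s \<Rightarrow> 's pmf) \<Rightarrow> ('s \<Rightarrow> real) \<Rightarrow> 's \<Rightarrow> real" where
  "transition_op S K f s = (\<Sum>s'\<in>S. pmf (K s) s' * f s')"

text \<open>The convention 0 ln 0 = 0 holds automatically.\<close>

definition Ent :: "'s set \<Rightarrow> ('s \<Rightarrow> real) \<Rightarrow> real" where
  "Ent S f =
     measure_pmf.expectation (pmf_of_set S) (\<lambda>s. f s * ln (f s))
     - measure_pmf.expectation (pmf_of_set S) f * ln (measure_pmf.expectation (pmf_of_set S) f)"

text \<open>
  This is an infimum of reals; it is meaningful when S has at least two elements (the set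
  is then nonempty) and the uniform distribution is stationary for K (it is then bounded below by 0).
\<close>

definition entropy_constant :: "'s set \<Rightarrow> ('s \<Rightarrow> 's pmf) \<Rightarrow> real" where
  "entropy_constant S K =
     Inf {(Ent S f - Ent S (transition_op S K f)) / Ent S f | f.
            (\<forall>s\<in>S. f s \<ge> 0) \<and> \<not> f constant_on S}"

definition chain_dist :: "('s \<Rightarrow> 's pmf) \<Rightarrow> nat \<Rightarrow> 's \<Rightarrow> 's pmf" where
  "chain_dist K t s = ((\<lambda>\<mu>. bind_pmf \<mu> K) ^^ t) (return_pmf s)"

definition tv_dist :: "'s set \<Rightarrow> 's pmf \<Rightarrow> 's pmf \<Rightarrow> real" where
  "tv_dist S \<mu> \<nu> = (\<Sum>s\<in>S. \<bar>pmf \<mu> s - pmf \<nu> s\<bar>) / 2"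

text \<open>
  The value is infinite if, from some starting state, the threshold is never reached
  (the infimum of the empty set of extended naturals is infinity).
\<close>

definition mixing_time :: "'s set \<Rightarrow> ('s \<Rightarrow> 's pmf) \<Rightarrow> enat" where
  "mixing_time S K =
     (SUP s\<in>S. Inf {enat t | t. tv_dist S (chain_dist K t s) (pmf_of_set S) \<le> 1 / (2 * exp 1)})"

end

(*
  Entropy is tensorised over the tree: Ent f is at most the sum over the vertices x of the mean
  entropy V x of f averaged over everything strictly below x. Let X be the color of x and Y the colors
  four levels below x. With nu the law of density f, comparing the law of X under nu with the law
  obtained by passing the law of Y under nu through the stationary kernel from Y to X gives

    V x <= 2 * (entropy of the block of x) + (chi-square distance of the latter law from that of X),

  and the last term is at most a tenth of Ent (Y), hence a tenth of the sum of the V y for y within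
  distance four below x. Summing over x, each y is counted at most five times, so the V y on the right
  are absorbed, and the block entropies control Ent f up to the factor 4.

  The chi-square estimate follows from the duality between entropy and exponential moments once the
  posterior of X given Y is uniform up to an error with small exponential moments. The weight of color s
  in the posterior is proportional to the product over the children of (1 - the child's posterior
  weight of s). If few children have a heavy color, Jensen's inequality bounds the normalising sum from
  below by a power of the branching number as soon as k > C Delta / ln Delta, C > 1, so that a vertex
  with a heavy color must have many such children: the probability of this drops to
  exp (-43 k) within three levels, the start being the coupon collector estimate for revealed children.
  Outside this event the exponent of the weight is a sum of independent bounded variables.
*)

theory Submission
  imports Defs "HOL-Real_Asymp.Real_Asymp"
begin

section \<open>Conditional expectations on a finite set\<close>

text \<open>Why four levels: entropy is dual to exponential moments, and \<open>k\<close> times a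
  posterior probability can be as large as \<open>k\<close>, so the exceptional event carries the
  weight \<open>k * exp (41 * k)\<close> and needs probability \<open>exp (- 43 * k)\<close>. One
  level above revealed colors, Chebyshev's inequality gives only \<open>4 / \<mu>\<close>. A second
  level gives \<open>exp (- b / 2)\<close> with b = \<beta>^2 k, still too large since b is at most
  k/16; but Chernoff's bound started from there has an exponent of order b^2, which does exceed 43
  k. The third level also sharpens the second moment of a posterior probability from about \<beta>/k
  to 2/k^2. Without this the Gaussian tail used at the fourth level would not offset exp(42 U),
  where U bounds k times a posterior probability off the exceptional event. A block of depth 3 ends
  just above the colors observed at distance four.

  Only a lower bound on \<open>k\<close> is given, so all estimates have to be uniform in
  \<open>k\<close>, including \<open>k\<close> far larger than \<Delta>.\<close>

definition avg :: "'s set \<Rightarrow> ('s \<Rightarrow> real) \<Rightarrow> real" where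
  "avg S f = (\<Sum>s\<in>S. f s) / card S"

text \<open>Conditional expectation under the uniform law on \<open>S\<close>. A sub-sigma-algebra
  is encoded by a function \<open>\<kappa>\<close> whose level sets are its atoms.\<close>

definition cexp :: "'s set \<Rightarrow> ('s \<Rightarrow> 'b) \<Rightarrow> ('s \<Rightarrow> real) \<Rightarrow> 's \<Rightarrow> real" where
  "cexp S \<kappa> f s = avg {t\<in>S. \<kappa> t = \<kappa> s} f"

lemma avg_mono: "(\<And>s. s \<in> S \<Longrightarrow> f s \<le> g s) \<Longrightarrow> avg S f \<le> avg S g"
  unfolding avg_def by (intro divide_right_mono sum_mono) auto

lemma avg_nonneg: "\<forall>s\<in>S. 0 \<le> f s \<Longrightarrow> 0 \<le> avg S f"
  unfolding avg_def by (intro divide_nonneg_nonneg sum_nonneg) auto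

lemma avg_add: "avg S (\<lambda>s. f s + g s) = avg S f + avg S g"
  by (simp add: avg_def sum.distrib add_divide_distrib)

lemma avg_diff: "avg S (\<lambda>s. f s - g s) = avg S f - avg S g"
  by (simp add: avg_def sum_subtractf diff_divide_distrib)

lemma avg_cmult: "avg S (\<lambda>s. c * f s) = c * avg S f"
  by (simp add: avg_def sum_distrib_left)

lemma avg_const: "finite S \<Longrightarrow> S \<noteq> {} \<Longrightarrow> avg S (\<lambda>s. c) = c"
  by (simp add: avg_def)

lemma avg_cong: "(\<And>s. s \<in> S \<Longrightarrow> f s = g s) \<Longrightarrow> avg S f = avg S g"
  by (simp add: avg_def)

lemma avg_bij_betw: "bij_betw h A B \<Longrightarrow> avg B f = avg A (\<lambda>a. f (h a))"
  unfolding avg_def using sum.reindex_bij_betw[of h A B f] bij_betw_same_card[of h A B] by simp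

lemma cexp_key: "\<kappa> s = \<kappa> t \<Longrightarrow> cexp S \<kappa> f s = cexp S \<kappa> f t"
  by (simp add: cexp_def)

lemma cexp_nonneg: "\<forall>s\<in>S. 0 \<le> f s \<Longrightarrow> 0 \<le> cexp S \<kappa> f s"
  by (auto simp: cexp_def intro!: avg_nonneg)

lemma cexp_mono: "(\<And>s. s \<in> S \<Longrightarrow> f s \<le> g s) \<Longrightarrow> cexp S \<kappa> f s \<le> cexp S \<kappa> g s"
  by (auto simp: cexp_def intro!: avg_mono)

lemma cexp_eq_self:
  assumes "finite S" "s \<in> S" "\<And>t. t \<in> S \<Longrightarrow> \<kappa> t = \<kappa> s \<Longrightarrow> f t = f s"
  shows "cexp S \<kappa> f s = f s"
proof -
  have "cexp S \<kappa> f s = avg {t\<in>S. \<kappa> t = \<kappa> s} (\<lambda>t. f s)"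
    unfolding cexp_def using assms(3) by (intro avg_cong) auto
  also have "\<dots> = f s"
    using assms by (intro avg_const) auto
  finally show ?thesis .
qed

text \<open>Conditional expectation is the orthogonal projection onto functions of
  \<open>\<kappa>\<close>, so it may be dropped against any such factor. Preservation of means, the
  tower rule and the later size-bias identities are instances.\<close>

lemma sum_cexp_mult:
  assumes S: "finite S" and h: "\<And>s t. s \<in> S \<Longrightarrow> t \<in> S \<Longrightarrow> \<kappa> s = \<kappa> t \<Longrightarrow> h s = h t"
  shows "(\<Sum>s\<in>S. cexp S \<kappa> f s * h s) = (\<Sum>s\<in>S. f s * h s)"
proof -
  have "(\<Sum>s\<in>{s\<in>S. \<kappa> s = y}. cexp S \<kappa> f s * h s) = (\<Sum>s\<in>{s\<in>S. \<kappa> s = y}. f s * h s)"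
    if "y \<in> \<kappa> ` S" for y
  proof -
    from that obtain s0 where s0: "s0 \<in> S" "\<kappa> s0 = y" by auto
    define F where "F = {s\<in>S. \<kappa> s = y}"
    have F: "card F \<noteq> 0" using S s0 by (auto simp: F_def)
    have hF: "h s = h s0" if "s \<in> F" for s
      using h[OF _ s0(1)] s0(2) that by (simp add: F_def)
    have "(\<Sum>s\<in>F. cexp S \<kappa> f s * h s) = (\<Sum>s\<in>F. avg F f * h s0)"
      using hF by (intro sum.cong) (simp_all add: cexp_def F_def)
    also have "\<dots> = (\<Sum>s\<in>F. f s) * h s0"
      using F by (simp add: avg_def)
    also have "\<dots> = (\<Sum>s\<in>F. f s * h s)"
      unfolding sum_distrib_right using hF by (intro sum.cong) simp_all
    finally show ?thesis unfolding F_def .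
  qed
  then show ?thesis
    unfolding sum.image_gen[OF S, of "\<lambda>s. cexp S \<kappa> f s * h s" \<kappa>]
      sum.image_gen[OF S, of "\<lambda>s. f s * h s" \<kappa>]
    by (rule sum.cong[OF refl])
qed

lemma sum_cexp: "finite S \<Longrightarrow> (\<Sum>s\<in>S. cexp S \<kappa> f s) = (\<Sum>s\<in>S. f s)"
  using sum_cexp_mult[of S \<kappa> "\<lambda>_. 1" f] by simp

lemma avg_cexp: "finite S \<Longrightarrow> avg S (cexp S \<kappa> f) = avg S f"
  by (simp add: avg_def sum_cexp)

lemma cexp_tower:
  assumes S: "finite S" and fine: "\<And>s t. s \<in> S \<Longrightarrow> t \<in> S \<Longrightarrow> \<kappa>' s = \<kappa>' t \<Longrightarrow> \<kappa> s = \<kappa> t"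
  shows "cexp S \<kappa> (cexp S \<kappa>' f) s = cexp S \<kappa> f s"
proof -
  have "(\<Sum>t\<in>S. cexp S \<kappa>' f t * of_bool (\<kappa> t = \<kappa> s)) = (\<Sum>t\<in>S. f t * of_bool (\<kappa> t = \<kappa> s))"
    by (rule sum_cexp_mult[OF S]) (metis fine)
  moreover have "(\<Sum>t\<in>{t\<in>S. \<kappa> t = \<kappa> s}. F t) = (\<Sum>t\<in>S. F t * of_bool (\<kappa> t = \<kappa> s))" for F :: "'a \<Rightarrow> real"
    by (subst sum.inter_filter[OF S]) (auto intro!: sum.cong)
  ultimately have "(\<Sum>t\<in>{t\<in>S. \<kappa> t = \<kappa> s}. cexp S \<kappa>' f t) = (\<Sum>t\<in>{t\<in>S. \<kappa> t = \<kappa> s}. f t)"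
    by simp
  then show ?thesis
    by (simp add: cexp_def[of S \<kappa>] avg_def)
qed

text \<open>A nonnegative function with zero mean on an atom vanishes there. This supplies the
  absolute continuity that the logarithms require.\<close>

lemma cexp_eq_0:
  assumes "finite S" "\<forall>s\<in>S. 0 \<le> f s" "s \<in> S" "cexp S \<kappa> f s = 0"
  shows "f s = 0"
proof -
  have "(\<Sum>t\<in>{t\<in>S. \<kappa> t = \<kappa> s}. f t) = 0"
    using assms by (auto simp: cexp_def avg_def)
  then show ?thesis
    using assms by (subst (asm) sum_nonneg_eq_0_iff) auto
qed

section \<open>Relative entropy\<close>

definition xent :: "'s set \<Rightarrow> ('s \<Rightarrow> real) \<Rightarrow> real" where
  "xent S f = (\<Sum>s\<in>S. f s * ln (f s))"

text \<open>An unnormalised relative entropy. A point with \<open>g s = 0\<close> contributes no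
  infinity, so absolute continuity is a separate hypothesis wherever it matters.\<close>

definition rent :: "'s set \<Rightarrow> ('s \<Rightarrow> real) \<Rightarrow> ('s \<Rightarrow> real) \<Rightarrow> real" where
  "rent S f g = (\<Sum>s\<in>S. f s * ln (f s / g s))"

text \<open>This is ln z \<le> z - 1 at z = y/x. Between functions of equal total mass the left side
  sums to zero, so the entropy inequalities below come down to a suitable choice of \<open>x\<close>
  and \<open>y\<close>.\<close>

lemma diff_le_mult_ln:
  fixes x y :: real
  assumes "0 \<le> x" "0 \<le> y" "y = 0 \<Longrightarrow> x = 0"
  shows "x - y \<le> x * ln (x / y)"
proof (cases "x = 0")
  case False
  then have xy: "x > 0" "y > 0" using assms by force+
  have "ln (y / x) \<le> y / x - 1" using xy by (intro ln_le_minus_one) auto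
  then have "x * ln (y / x) \<le> x * (y / x - 1)"
    using xy by (intro mult_left_mono) auto
  also have "x * (y / x - 1) = y - x" using xy by (simp add: field_simps)
  also have "ln (y / x) = - ln (x / y)" using xy by (simp add: ln_div)
  finally show ?thesis by simp
qed (use assms in auto)

lemma diff_less_mult_ln:
  fixes x y :: real
  assumes "0 \<le> x" "0 < y" "x \<noteq> y"
  shows "x - y < x * ln (x / y)"
proof (cases "x = 0")
  case False
  then have xy: "x > 0" using assms by force+
  have "ln (y / x) \<noteq> y / x - 1"
    using ln_eq_minus_one[of "y / x"] xy assms by (auto simp: field_simps)
  then have "ln (y / x) < y / x - 1"
    using ln_le_minus_one[of "y / x"] xy assms by auto
  then have "x * ln (y / x) < x * (y / x - 1)"
    using xy by (intro mult_strict_left_mono) auto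
  also have "x * (y / x - 1) = y - x" using xy by (simp add: field_simps)
  also have "ln (y / x) = - ln (x / y)" using xy assms by (simp add: ln_div)
  finally show ?thesis by simp
qed (use assms in auto)

text \<open>The data processing inequality. The tangent-line inequality is used with x = f and y = g
  F/G, where F and G are the conditional means. As F/G depends on the key only, g F/G has the same
  total as G F/G, hence the same total as f.\<close>

lemma rent_cexp_le:
  assumes S: "finite S" and f: "\<forall>s\<in>S. 0 \<le> f s" and g: "\<forall>s\<in>S. 0 \<le> g s"
    and ac: "\<forall>s\<in>S. g s = 0 \<longrightarrow> f s = 0"
  shows "rent S (cexp S \<kappa> f) (cexp S \<kappa> g) \<le> rent S f g"
proof -
  define F where "F = cexp S \<kappa> f"
  define G where "G = cexp S \<kappa> g"
  have FG: "0 \<le> F s" "0 \<le> G s" for s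
    using f g by (auto simp: F_def G_def intro: cexp_nonneg)
  have F0: "f s = 0" if "s \<in> S" "F s = 0" for s
    using cexp_eq_0[OF S f that(1), of \<kappa>] that by (simp add: F_def)
  have G0: "F s = 0" if "s \<in> S" "G s = 0" for s
  proof -
    have "g t = 0" if "t \<in> S" "\<kappa> t = \<kappa> s" for t
      using cexp_eq_0[OF S g that(1), where \<kappa> = \<kappa>] \<open>G s = 0\<close> cexp_key[where \<kappa> = \<kappa> and s = t and t = s and S = S and f = g] that(2) by (simp add: G_def)
    then have "(\<Sum>t\<in>{t\<in>S. \<kappa> t = \<kappa> s}. f t) = 0"
      using ac by (intro sum.neutral) auto
    then show ?thesis by (simp add: F_def cexp_def avg_def)
  qed
  have key: "F s * ln (F s / G s) = F t * ln (F t / G t)" "ln (F s / G s) = ln (F t / G t)"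
      "F s / G s = F t / G t" if "\<kappa> s = \<kappa> t" for s t
    using cexp_key[where \<kappa> = \<kappa>, OF that, of S f] cexp_key[where \<kappa> = \<kappa>, OF that, of S g]
    by (simp_all add: F_def G_def)
  have pw: "f s * ln (F s / G s) + f s - g s * (F s / G s) \<le> f s * ln (f s / g s)" if s: "s \<in> S" for s
  proof (cases "f s = 0")
    case True
    then show ?thesis using FG g[rule_format, OF s] by simp
  next
    case False
    then have pos: "f s > 0" "g s > 0" "F s > 0" "G s > 0"
      using f[rule_format, OF s] g[rule_format, OF s] ac[rule_format, OF s] F0[OF s] G0[OF s] FG[of s] by force+
    have "f s - g s * (F s / G s) \<le> f s * ln (f s / (g s * (F s / G s)))"
      using pos by (intro diff_le_mult_ln) auto
    also have "\<dots> = f s * ln (f s / g s) - f s * ln (F s / G s)"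
      using pos by (simp add: ln_div ln_mult algebra_simps)
    finally show ?thesis by simp
  qed
  have "(\<Sum>s\<in>S. g s * (F s / G s)) = (\<Sum>s\<in>S. G s * (F s / G s))"
    using sum_cexp_mult[where \<kappa> = \<kappa> and h = "\<lambda>s. F s / G s" and f = g, OF S key(3)]
    by (fold G_def) simp
  also have "\<dots> = (\<Sum>s\<in>S. F s)"
    using G0 by (intro sum.cong) auto
  also have "\<dots> = (\<Sum>s\<in>S. f s)"
    unfolding F_def using S by (rule sum_cexp)
  finally have 1: "(\<Sum>s\<in>S. g s * (F s / G s)) = (\<Sum>s\<in>S. f s)" .
  have "rent S F G = (\<Sum>s\<in>S. f s * ln (F s / G s))"
    unfolding rent_def
    using sum_cexp_mult[where \<kappa> = \<kappa> and h = "\<lambda>s. ln (F s / G s)" and f = f, OF S key(2)]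
    by (fold F_def)
  also have "\<dots> = (\<Sum>s\<in>S. f s * ln (F s / G s) + f s - g s * (F s / G s))"
    using 1 by (simp add: sum_subtractf sum.distrib)
  also have "\<dots> \<le> rent S f g"
    unfolding rent_def by (intro sum_mono pw)
  finally show ?thesis by (simp add: F_def G_def)
qed

text \<open>The chain rule for entropy: in the cross term the logarithm depends on the key only, so
  \<open>f\<close> may be replaced by its conditional mean.\<close>

lemma rent_cexp_eq:
  assumes S: "finite S" and f: "\<forall>s\<in>S. 0 \<le> f s"
  shows "rent S f (cexp S \<kappa> f) = xent S f - xent S (cexp S \<kappa> f)"
proof -
  have "f s * ln (f s / cexp S \<kappa> f s) = f s * ln (f s) - f s * ln (cexp S \<kappa> f s)" if "s \<in> S" for s
  proof (cases "f s = 0")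
    case False
    then have "f s > 0" using f[rule_format, OF that] by simp
    moreover have "cexp S \<kappa> f s \<noteq> 0"
      using False cexp_eq_0[where \<kappa> = \<kappa>, OF S f that] by blast
    moreover have "cexp S \<kappa> f s \<ge> 0" using f by (rule cexp_nonneg)
    ultimately show ?thesis by (simp add: ln_div algebra_simps)
  qed auto
  then have "rent S f (cexp S \<kappa> f) = xent S f - (\<Sum>s\<in>S. f s * ln (cexp S \<kappa> f s))"
    by (simp add: rent_def xent_def sum_subtractf)
  also have "(\<Sum>s\<in>S. f s * ln (cexp S \<kappa> f s)) = xent S (cexp S \<kappa> f)"
    unfolding xent_def 
    by (rule sum_cexp_mult[symmetric, OF S]) (metis cexp_key)
  finally show ?thesis .
qed

lemma rent_nonneg:
  assumes S: "finite S" and f: "\<forall>s\<in>S. 0 \<le> f s" and g: "\<forall>s\<in>S. 0 \<le> g s"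
    and ac: "\<forall>s\<in>S. g s = 0 \<longrightarrow> f s = 0" and eq: "(\<Sum>s\<in>S. g s) \<le> (\<Sum>s\<in>S. f s)"
  shows "0 \<le> rent S f g"
proof -
  have "0 \<le> (\<Sum>s\<in>S. f s - g s)" using eq by (simp add: sum_subtractf)
  also have "\<dots> \<le> rent S f g" unfolding rent_def
    using f g ac by (intro sum_mono diff_le_mult_ln) auto
  finally show ?thesis .
qed

lemma xent_cexp_le:
  assumes S: "finite S" and f: "\<forall>s\<in>S. 0 \<le> f s"
  shows "xent S (cexp S \<kappa> f) \<le> xent S f"
proof -
  have "0 \<le> rent S f (cexp S \<kappa> f)"
    using S f cexp_nonneg[OF f, of \<kappa>] cexp_eq_0[OF S f, of _ \<kappa>]
    by (intro rent_nonneg) (simp_all add: sum_cexp)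
  then show ?thesis using rent_cexp_eq[OF S f, where \<kappa> = \<kappa>] by simp
qed

lemma rent_cexp_cexp:
  assumes S: "finite S" and f: "\<forall>s\<in>S. 0 \<le> f s"
    and fine: "\<And>s t. s \<in> S \<Longrightarrow> t \<in> S \<Longrightarrow> \<kappa>' s = \<kappa>' t \<Longrightarrow> \<kappa> s = \<kappa> t"
  shows "rent S (cexp S \<kappa>' f) (cexp S \<kappa> f) = xent S (cexp S \<kappa>' f) - xent S (cexp S \<kappa> f)"
proof -
  have "cexp S \<kappa> (cexp S \<kappa>' f) = cexp S \<kappa> f"
    by (intro ext cexp_tower[OF S]) (rule fine)
  then show ?thesis
    using rent_cexp_eq[OF S, of "cexp S \<kappa>' f" \<kappa>] cexp_nonneg[OF f, of \<kappa>'] by simp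
qed

text \<open>Replaces the missing triangle inequality for relative entropy.\<close>

lemma rent_triangle:
  assumes S: "finite S" and a: "\<forall>s\<in>S. 0 \<le> a s" and a': "\<forall>s\<in>S. 0 \<le> a' s"
    and m: "\<forall>s\<in>S. 0 \<le> m s"
    and ac: "\<forall>s\<in>S. a' s = 0 \<longrightarrow> a s = 0" "\<forall>s\<in>S. m s = 0 \<longrightarrow> a' s = 0"
    and eq: "(\<Sum>s\<in>S. a s) = (\<Sum>s\<in>S. m s)" "(\<Sum>s\<in>S. a' s) = (\<Sum>s\<in>S. m s)"
  shows "rent S a m \<le> 2 * rent S a a' + (\<Sum>s\<in>S. (a' s - m s)\<^sup>2 / m s)"
proof -
  have "a s * ln (a s / m s) \<le> 2 * (a s * ln (a s / a' s)) + (a' s - m s)\<^sup>2 / m s + (2 * a' s - m s - a s)"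
    if s: "s \<in> S" for s
  proof (cases "m s = 0")
    case True
    then show ?thesis using ac s by simp
  next
    case False
    then have m0: "m s > 0" using m s by force
    have sq: "(a' s - m s)\<^sup>2 / m s + 2 * a' s - m s = (a' s)\<^sup>2 / m s"
      using m0 by (simp add: field_simps power2_eq_square)
    show ?thesis
    proof (cases "a s = 0")
      case True
      have "0 \<le> (a' s)\<^sup>2 / m s" using m0 by simp
      then show ?thesis using sq True by simp
    next
      case False
      then have pos: "a s > 0" "a' s > 0" using a[rule_format, OF s] a'[rule_format, OF s] ac(1)[rule_format, OF s] by force+
      \<comment> \<open>The choice y = a'^2/m splits the logarithm into twice the one of a/a' minus
        the one of a/m. The linear remainder 2a' - m - a sums to zero because the three masses
        agree.\<close>
      have "a s - (a' s)\<^sup>2 / m s \<le> a s * ln (a s / ((a' s)\<^sup>2 / m s))"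
        using pos m0 by (intro diff_le_mult_ln) auto
      also have "\<dots> = 2 * (a s * ln (a s / a' s)) - a s * ln (a s / m s)"
        using pos m0 by (simp add: ln_div ln_mult ln_realpow algebra_simps)
      finally show ?thesis using sq by linarith
    qed
  qed
  then have "rent S a m \<le> (\<Sum>s\<in>S. 2 * (a s * ln (a s / a' s)) + (a' s - m s)\<^sup>2 / m s + (2 * a' s - m s - a s))"
    unfolding rent_def by (intro sum_mono)
  also have "\<dots> = 2 * rent S a a' + (\<Sum>s\<in>S. (a' s - m s)\<^sup>2 / m s)"
    using eq by (simp add: rent_def sum.distrib sum_subtractf flip: sum_distrib_left)
  finally show ?thesis .
qed

section \<open>Entropy contraction for a weakly informative observation\<close>

lemma exp_le_quadratic: "exp z \<le> 1 + z + z\<^sup>2 / 2 * exp \<bar>z\<bar>" for z :: real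
proof -
  obtain t where t: "\<bar>t\<bar> \<le> \<bar>z\<bar>" "exp z = (\<Sum>m<2. z ^ m / fact m) + exp t / fact 2 * z ^ 2"
    using Maclaurin_exp_le[of z 2] by blast
  then have "exp z = 1 + z + z\<^sup>2 / 2 * exp t"
    by (simp add: numeral_2_eq_2)
  also have "\<dots> \<le> 1 + z + z\<^sup>2 / 2 * exp \<bar>z\<bar>"
    using t(1) by (intro add_left_mono mult_left_mono) auto
  finally show ?thesis .
qed

lemma exp_minus_le_quadratic:
  fixes x :: real
  assumes "0 \<le> x"
  shows "exp (- x) \<le> 1 - x + x\<^sup>2 / 2"
proof -
  obtain t where t: "exp (- x) = (\<Sum>m<3. (- x) ^ m / fact m) + exp t / fact 3 * (- x) ^ 3"
    using Maclaurin_exp_le[of "- x" 3] by blast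
  have "(- x) ^ 3 \<le> 0" using assms by (simp add: power3_eq_cube)
  then have "exp t / fact 3 * (- x) ^ 3 \<le> 0"
    by (intro mult_nonneg_nonpos) auto
  then show ?thesis using t by (simp add: numeral_3_eq_3 numeral_2_eq_2)
qed

text \<open>Young's inequality for the pair of convex conjugates x ln x - x and exp, scaled by
  \<open>m\<close>.\<close>

lemma entropy_young:
  fixes x y m :: real
  assumes "0 \<le> x" "0 < m"
  shows "x * y \<le> x * ln (x / m) - x + m * exp y"
proof (cases "x = 0")
  case False
  then have x: "x > 0" using assms by simp
  have "x - m * exp y \<le> x * ln (x / (m * exp y))"
    using assms x by (intro diff_le_mult_ln) auto
  also have "\<dots> = x * ln (x / m) - x * y"
    using assms x by (simp add: ln_div ln_mult algebra_simps)
  finally show ?thesis by simp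
qed (use assms in auto)

text \<open>The variational principle for entropy with test function \<open>t * \<phi>\<close>.
  Since \<open>\<phi>\<close> is centred, the linear term of the exponential drops out and
  \<open>t\<^sup>2 * v / 2\<close> remains; the weight \<open>exp (M * \<bar>\<phi> s\<bar>)\<close>
  serves all \<open>t \<le> M\<close> at once.\<close>

lemma entropy_duality:
  assumes S: "finite S" "S \<noteq> {}" and g: "\<forall>s\<in>S. 0 \<le> g s" and m: "avg S g = m" "0 < m"
    and \<phi>: "avg S \<phi> = 0" "avg S (\<lambda>s. (\<phi> s)\<^sup>2 * exp (M * \<bar>\<phi> s\<bar>)) \<le> v" and t: "0 < t" "t \<le> M"
  shows "t * avg S (\<lambda>s. g s * \<phi> s) \<le> avg S (\<lambda>s. g s * ln (g s / m)) + m * (t\<^sup>2 * v / 2)"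
proof -
  have e: "exp (t * \<phi> s) \<le> 1 + t * \<phi> s + t\<^sup>2 / 2 * ((\<phi> s)\<^sup>2 * exp (M * \<bar>\<phi> s\<bar>))" for s
  proof -
    have "exp (t * \<phi> s) \<le> 1 + t * \<phi> s + (t * \<phi> s)\<^sup>2 / 2 * exp \<bar>t * \<phi> s\<bar>"
      by (rule exp_le_quadratic)
    also have "\<dots> \<le> 1 + t * \<phi> s + (t * \<phi> s)\<^sup>2 / 2 * exp (M * \<bar>\<phi> s\<bar>)"
      using t by (intro add_left_mono mult_left_mono) (auto simp: abs_mult mult_right_mono)
    finally show ?thesis
      by (simp add: power_mult_distrib algebra_simps)
  qed
  have "t * avg S (\<lambda>s. g s * \<phi> s) = avg S (\<lambda>s. g s * (t * \<phi> s))"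
    by (subst avg_cmult[symmetric]) (simp add: algebra_simps)
  also have "\<dots> \<le> avg S (\<lambda>s. g s * ln (g s / m) - g s
      + m * (1 + t * \<phi> s + t\<^sup>2 / 2 * ((\<phi> s)\<^sup>2 * exp (M * \<bar>\<phi> s\<bar>))))"
  proof (rule avg_mono)
    fix s assume s: "s \<in> S"
    have "g s * (t * \<phi> s) \<le> g s * ln (g s / m) - g s + m * exp (t * \<phi> s)"
      using g s m by (intro entropy_young) auto
    also have "\<dots> \<le> g s * ln (g s / m) - g s
      + m * (1 + t * \<phi> s + t\<^sup>2 / 2 * ((\<phi> s)\<^sup>2 * exp (M * \<bar>\<phi> s\<bar>)))"
      using e[of s] m by (intro add_left_mono mult_left_mono) auto
    finally show "g s * (t * \<phi> s) \<le> \<dots>" .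
  qed
  also have "\<dots> = avg S (\<lambda>s. g s * ln (g s / m)) - m
      + m * (1 + t * avg S \<phi> + t\<^sup>2 / 2 * avg S (\<lambda>s. (\<phi> s)\<^sup>2 * exp (M * \<bar>\<phi> s\<bar>)))"
    unfolding avg_add avg_diff avg_cmult using S m by (simp add: avg_const)
  also have "\<dots> \<le> avg S (\<lambda>s. g s * ln (g s / m)) - m + m * (1 + t * 0 + t\<^sup>2 / 2 * v)"
    unfolding \<phi>(1) using \<phi>(2) m by (intro add_left_mono mult_left_mono) auto
  finally show ?thesis by (simp add: algebra_simps)
qed

text \<open>The optimal parameter is t = sqrt(40 K), which lies in the permitted range exactly when
  K is at most 40. It turns the linear bound into d \<le> 2K/t. For K = 0 one lets t tend to 0
  instead.\<close>

lemma square_le_of_duality: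
  fixes d K :: real
  assumes d: "0 \<le> d" and K: "0 \<le> K" "K \<le> 40"
    and *: "\<And>t. 0 < t \<Longrightarrow> t \<le> 40 \<Longrightarrow> t * d \<le> K + t\<^sup>2 / 40"
  shows "d\<^sup>2 \<le> K / 10"
proof (cases "K = 0")
  case True
  have "d \<le> 0 + e" if "e > 0" for e
  proof -
    let ?t = "min (40 * e) 40"
    have "?t * d \<le> ?t * (?t / 40)" using *[of ?t] that True by (simp add: power2_eq_square)
    then have "d \<le> ?t / 40" using that 
      by (metis mult_le_cancel_left_pos min_less_iff_conj zero_less_mult_iff zero_less_numeral)
    then show ?thesis by simp
  qed
  then have "d \<le> 0" by (rule field_le_epsilon)
  then show ?thesis using d K by simp
next
  case False
  define t where "t = sqrt (40 * K)"
  have t2: "t * t = 40 * K" and t0: "t > 0" using K False by (auto simp: t_def)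
  have "t \<le> sqrt (40 * 40)" unfolding t_def using K by (intro real_sqrt_le_mono) auto
  then have t40: "t \<le> 40" by (simp add: real_sqrt_mult_self)
  have "t * d \<le> 2 * K" using *[OF t0 t40] t2 by (simp add: power2_eq_square)
  then have "(t * d) * (t * d) \<le> (2 * K) * (2 * K)"
    using t0 d K by (intro mult_mono[of "t * d" "2 * K" "t * d" "2 * K"]) auto
  also have "(t * d) * (t * d) = 40 * K * d\<^sup>2"
    using t2 by (simp add: power2_eq_square algebra_simps)
  finally have "K * (40 * d\<^sup>2) \<le> K * (4 * K)" by (simp add: algebra_simps)
  then show ?thesis using K False by simp
qed

text \<open>
  Since the mean is zero, the negative part, which is at most 1, is controlled by the positive one.
\<close>

lemma two_sided_exp_moment:
  assumes S: "finite S" and lower: "\<forall>s\<in>S. - 1 \<le> \<phi> s" and mean: "avg S \<phi> = 0"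
    and upper: "avg S (\<lambda>s. max 0 (\<phi> s) * exp (41 * max 0 (\<phi> s))) \<le> \<eta>"
  shows "avg S (\<lambda>s. (\<phi> s)\<^sup>2 * exp (40 * \<bar>\<phi> s\<bar>)) \<le> (1 + exp 40) * \<eta>"
proof -
  let ?p = "\<lambda>s. max 0 (\<phi> s) * exp (41 * max 0 (\<phi> s))"
  have "(\<phi> s)\<^sup>2 * exp (40 * \<bar>\<phi> s\<bar>) \<le> ?p s + exp 40 * (?p s - \<phi> s)" if s: "s \<in> S" for s
  proof (cases "\<phi> s \<ge> 0")
    case True
    \<comment> \<open>The exponent 41 of the hypothesis is 40 plus one: the extra unit pays for one
      of the two factors \<open>\<phi> s\<close>.\<close>
    have "\<phi> s \<le> exp (\<phi> s)" using exp_ge_add_one_self[of "\<phi> s"] by linarith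
    then have "\<phi> s * exp (40 * \<phi> s) \<le> exp (\<phi> s) * exp (40 * \<phi> s)"
      by (intro mult_right_mono) auto
    also have "\<dots> = exp (41 * \<phi> s)" by (simp flip: exp_add)
    finally have "\<phi> s * (\<phi> s * exp (40 * \<phi> s)) \<le> \<phi> s * exp (41 * \<phi> s)"
      using True by (intro mult_left_mono)
    moreover have "\<phi> s * 1 \<le> \<phi> s * exp (41 * \<phi> s)"
      using True by (intro mult_left_mono) auto
    ultimately show ?thesis using True by (simp add: power2_eq_square add_increasing2 mult.assoc)
  next
    case False
    then have neg: "\<phi> s < 0" "- \<phi> s \<le> 1" using lower s by force+
    have "(\<phi> s)\<^sup>2 = (- \<phi> s) * (- \<phi> s)" by (simp add: power2_eq_square)
    also have "\<dots> \<le> 1 * (- \<phi> s)" using neg by (intro mult_right_mono) auto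
    finally have "(\<phi> s)\<^sup>2 * exp (40 * \<bar>\<phi> s\<bar>) \<le> (1 * (- \<phi> s)) * exp 40"
      using neg by (intro mult_mono) auto
    then show ?thesis using neg by (simp add: max_def algebra_simps)
  qed
  then have "avg S (\<lambda>s. (\<phi> s)\<^sup>2 * exp (40 * \<bar>\<phi> s\<bar>)) \<le> avg S (\<lambda>s. ?p s + exp 40 * (?p s - \<phi> s))"
    by (rule avg_mono)
  also have "\<dots> = (1 + exp 40) * avg S ?p"
    unfolding avg_add avg_cmult avg_diff mean by (simp add: algebra_simps)
  also have "\<dots> \<le> (1 + exp 40) * \<eta>"
    using upper by (intro mult_left_mono) (auto intro: add_nonneg_nonneg)
  finally show ?thesis .
qed

text \<open>\<open>\<phi> s\<close> is the posterior density of the color \<open>s\<close> relative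
  to the uniform law, minus 1. Because \<open>g\<close> is a function of the observation, the
  deviation of its mean given X = s equals the mean of \<open>g\<close> times
  \<open>\<phi> s\<close>, a linear functional of \<open>g\<close> to which the entropy duality
  applies.\<close>

lemma chi_square_le_entropy:
  fixes X :: "'s \<Rightarrow> 'c" and \<kappa> :: "'s \<Rightarrow> 'o" and g :: "'s \<Rightarrow> real"
  assumes S: "finite S" "S \<noteq> {}" and D: "finite D" "X ` S \<subseteq> D"
    and unif: "\<And>s. s \<in> D \<Longrightarrow> card D * card {\<sigma>\<in>S. X \<sigma> = s} = card S"
    and g: "\<forall>\<sigma>\<in>S. 0 \<le> g \<sigma>" and m: "avg S g = m" "0 < m"
    and obs: "\<And>\<sigma> \<tau>. \<sigma> \<in> S \<Longrightarrow> \<tau> \<in> S \<Longrightarrow> \<kappa> \<sigma> = \<kappa> \<tau> \<Longrightarrow> g \<sigma> = g \<tau>"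
    and \<phi>_def: "\<And>s \<sigma>. \<phi> s \<sigma> = card D * cexp S \<kappa> (\<lambda>\<tau>. of_bool (X \<tau> = s)) \<sigma> - 1"
    and tail: "\<And>s. s \<in> D \<Longrightarrow>
      avg S (\<lambda>\<sigma>. max 0 (\<phi> s \<sigma>) * exp (41 * max 0 (\<phi> s \<sigma>))) \<le> 1 / (20 * (1 + exp 40))"
  shows "avg S (\<lambda>\<sigma>. (cexp S X g \<sigma> - m)\<^sup>2 / m) \<le> avg S (\<lambda>\<sigma>. g \<sigma> * ln (g \<sigma> / m)) / 10"
proof -
  define K where "K = avg S (\<lambda>\<sigma>. g \<sigma> * ln (g \<sigma> / m))"
  define a where "a s = avg {\<sigma>\<in>S. X \<sigma> = s} g" for s
  have cS: "card S > 0" using S by (simp add: card_gt_0_iff)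
  have "D \<noteq> {}" using D S by auto
  then have cD: "card D > 0" using D by (simp add: card_gt_0_iff)
  have part: "avg S (\<lambda>\<sigma>. F (X \<sigma>)) = avg D F" for F
  proof -
    have "(\<Sum>\<sigma>\<in>S. F (X \<sigma>)) = (\<Sum>s\<in>D. \<Sum>\<sigma>\<in>{\<sigma>\<in>S. X \<sigma> = s}. F (X \<sigma>))"
      by (rule sum.group[symmetric, OF S(1) D])
    also have "\<dots> = (\<Sum>s\<in>D. (card S / card D) * F s)"
    proof (rule sum.cong[OF refl])
      fix s assume s: "s \<in> D"
      have "real (card D) * card {\<sigma>\<in>S. X \<sigma> = s} = card S"
        using unif[OF s] by (metis of_nat_mult)
      then have "real (card {\<sigma>\<in>S. X \<sigma> = s}) = card S / card D"
        using cD by (simp add: field_simps)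
      moreover have "(\<Sum>\<sigma>\<in>{\<sigma>\<in>S. X \<sigma> = s}. F (X \<sigma>)) = card {\<sigma>\<in>S. X \<sigma> = s} * F s"
        by simp
      ultimately show "(\<Sum>\<sigma>\<in>{\<sigma>\<in>S. X \<sigma> = s}. F (X \<sigma>)) = (card S / card D) * F s" by simp
    qed
    also have "\<dots> = (card S / card D) * (\<Sum>s\<in>D. F s)" by (rule sum_distrib_left[symmetric])
    finally show ?thesis using cS cD by (simp add: avg_def)
  qed
  have a: "a s = card D * avg S (\<lambda>\<sigma>. g \<sigma> * of_bool (X \<sigma> = s))" if s: "s \<in> D" for s
  proof -
    have c: "real (card D) * card {\<sigma>\<in>S. X \<sigma> = s} = card S"
      using unif[OF s] by (metis of_nat_mult)
    have "(\<Sum>\<sigma>\<in>S. g \<sigma> * of_bool (X \<sigma> = s)) = (\<Sum>\<sigma>\<in>{\<sigma>\<in>S. X \<sigma> = s}. g \<sigma>)"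
      by (subst sum.inter_filter[OF S(1)]) (auto intro!: sum.cong)
    then show ?thesis using c cS cD unfolding a_def avg_def
      by (cases "card {\<sigma>\<in>S. X \<sigma> = s} = 0") (auto simp: field_simps)
  qed
  have d: "a s - m = avg S (\<lambda>\<sigma>. g \<sigma> * \<phi> s \<sigma>)" if s: "s \<in> D" for s
  proof -
    have "(\<Sum>\<sigma>\<in>S. g \<sigma> * of_bool (X \<sigma> = s)) = (\<Sum>\<sigma>\<in>S. g \<sigma> * cexp S \<kappa> (\<lambda>\<tau>. of_bool (X \<tau> = s)) \<sigma>)"
      unfolding mult.commute[of "g _"] by (rule sum_cexp_mult[OF S(1) obs, symmetric])
    then have "avg S (\<lambda>\<sigma>. g \<sigma> * of_bool (X \<sigma> = s)) = avg S (\<lambda>\<sigma>. g \<sigma> * cexp S \<kappa> (\<lambda>\<tau>. of_bool (X \<tau> = s)) \<sigma>)"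
      by (simp add: avg_def)
    then have "a s = avg S (\<lambda>\<sigma>. card D * (g \<sigma> * cexp S \<kappa> (\<lambda>\<tau>. of_bool (X \<tau> = s)) \<sigma>))"
      using a[OF s] by (simp only: avg_cmult)
    then have "a s - m = avg S (\<lambda>\<sigma>. card D * (g \<sigma> * cexp S \<kappa> (\<lambda>\<tau>. of_bool (X \<tau> = s)) \<sigma>) - g \<sigma>)"
      using m by (simp only: avg_diff)
    then show ?thesis unfolding \<phi>_def by (simp add: algebra_simps)
  qed
  have \<phi>: "avg S (\<phi> s) = 0" "\<forall>\<sigma>\<in>S. - 1 \<le> \<phi> s \<sigma>" if s: "s \<in> D" for s
  proof -
    have c: "real (card D) * card {\<sigma>\<in>S. X \<sigma> = s} = card S"
      using unif[OF s] by (metis of_nat_mult)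
    have "avg S (\<lambda>\<tau>. of_bool (X \<tau> = s)) = card {\<sigma>\<in>S. X \<sigma> = s} / card S"
      using S by (simp add: avg_def Int_def)
    then have "card D * avg S (\<lambda>\<tau>. of_bool (X \<tau> = s)) = (real (card D) * card {\<sigma>\<in>S. X \<sigma> = s}) / card S"
      by simp
    also have "\<dots> = 1" unfolding c using cS by simp
    finally have "card D * avg S (\<lambda>\<tau>. of_bool (X \<tau> = s)) = 1" .
    then have "avg S (\<lambda>\<sigma>. card D * cexp S \<kappa> (\<lambda>\<tau>. of_bool (X \<tau> = s)) \<sigma> - 1) = 0"
      unfolding avg_diff avg_cmult avg_cexp[OF S(1)] using S by (simp add: avg_const)
    moreover have "\<phi> s = (\<lambda>\<sigma>. card D * cexp S \<kappa> (\<lambda>\<tau>. of_bool (X \<tau> = s)) \<sigma> - 1)"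
      by (rule ext) (rule \<phi>_def)
    ultimately show "avg S (\<phi> s) = 0" by simp
    have "0 \<le> cexp S \<kappa> (\<lambda>\<tau>. of_bool (X \<tau> = s)) \<sigma>" for \<sigma>
      by (rule cexp_nonneg) simp
    then show "\<forall>\<sigma>\<in>S. - 1 \<le> \<phi> s \<sigma>" by (simp add: \<phi>_def)
  qed
  \<comment> \<open>The value 1/20 makes the quadratic term of the duality t^2/40, the form needed
    for the optimisation in \<open>t\<close>.\<close>
  have v: "avg S (\<lambda>\<sigma>. (\<phi> s \<sigma>)\<^sup>2 * exp (40 * \<bar>\<phi> s \<sigma>\<bar>)) \<le> 1 / 20" if s: "s \<in> D" for s
  proof -
    have "(1::real) + exp 40 > 0" by (intro add_pos_pos) auto
    then have "(1 + exp 40) * (1 / (20 * (1 + exp 40))) = (1 / 20 :: real)"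
      by (metis less_numeral_extra(3) mult.commute nonzero_mult_divide_mult_cancel_left mult_1_right times_divide_eq_right)
    then show ?thesis
      using two_sided_exp_moment[OF S(1) \<phi>(2,1)[OF s] tail[OF s]] by metis
  qed
  have dual: "t * \<bar>a s - m\<bar> \<le> K + m * (t\<^sup>2 / 40)" if "s \<in> D" "0 < t" "t \<le> 40" for s t
  proof -
    have 1: "t * (a s - m) \<le> K + m * (t\<^sup>2 / 40)"
      using entropy_duality[OF S g m \<phi>(1) v, OF that(1,1,2,3)] by (simp add: K_def d that)
    have "avg S (\<lambda>\<sigma>. - \<phi> s \<sigma>) = 0" using avg_cmult[of S "- 1" "\<phi> s"] \<phi>(1)[OF that(1)] by simp
    moreover have "avg S (\<lambda>\<sigma>. (- \<phi> s \<sigma>)\<^sup>2 * exp (40 * \<bar>- \<phi> s \<sigma>\<bar>)) \<le> 1 / 20"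
      using v[OF that(1)] by simp
    ultimately have "t * avg S (\<lambda>\<sigma>. g \<sigma> * - \<phi> s \<sigma>) \<le> K + m * (t\<^sup>2 * (1 / 20) / 2)"
      unfolding K_def using entropy_duality[OF S g m _ _ that(2,3)] by blast
    moreover have "avg S (\<lambda>\<sigma>. g \<sigma> * - \<phi> s \<sigma>) = - (a s - m)"
      using avg_cmult[of S "- 1" "\<lambda>\<sigma>. g \<sigma> * \<phi> s \<sigma>"] d[OF that(1)] by simp
    ultimately have 2: "t * (- (a s - m)) \<le> K + m * (t\<^sup>2 / 40)" by simp
    show ?thesis using 1 2 by (cases "a s - m \<ge> 0") (simp_all add: abs_if)
  qed
  have K0: "0 \<le> K"
  proof -
    have "avg S (\<lambda>\<sigma>. g \<sigma> - m) \<le> K"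
      unfolding K_def using g m by (intro avg_mono diff_le_mult_ln) auto
    then show ?thesis using m S by (simp add: avg_diff avg_const)
  qed
  define d' where "d' s = \<bar>a s - m\<bar> / m" for s
  have d'0: "d' s \<ge> 0" for s using m by (simp add: d'_def)
  have dual': "t * d' s \<le> K / m + t\<^sup>2 / 40" if "s \<in> D" "0 < t" "t \<le> 40" for s t
  proof -
    have "t * d' s = (t * \<bar>a s - m\<bar>) / m" by (simp add: d'_def)
    also have "\<dots> \<le> (K + m * (t\<^sup>2 / 40)) / m"
      using dual[OF that] m by (intro divide_right_mono) auto
    also have "\<dots> = K / m + t\<^sup>2 / 40" using m by (simp add: field_simps)
    finally show ?thesis .
  qed
  have sq: "(a s - m)\<^sup>2 / m = m * (d' s)\<^sup>2" for s
    using m by (simp add: d'_def power2_eq_square field_simps)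
  have main: "avg D (\<lambda>s. (d' s)\<^sup>2) \<le> K / m / 10"
  \<comment> \<open>When the relative entropy exceeds 40 the optimal \<open>t\<close> is out of
    range. Then one factor of the square is bounded by the duality at t = 40 and the other by
    \<open>a s / m + 1\<close>, which has mean 2 over the colors.\<close>
  proof (cases "K / m \<le> 40")
    case True
    have "(d' s)\<^sup>2 \<le> K / m / 10" if "s \<in> D" for s
      using d'0 True K0 m dual'[OF that] by (intro square_le_of_duality) auto
    then have "avg D (\<lambda>s. (d' s)\<^sup>2) \<le> avg D (\<lambda>s. K / m / 10)" by (rule avg_mono)
    also have "\<dots> = K / m / 10" using D \<open>D \<noteq> {}\<close> by (intro avg_const) auto
    finally show ?thesis .
  next
    case False
    have "(d' s)\<^sup>2 \<le> K / m / 20 * (a s / m + 1)" if "s \<in> D" for s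
    proof -
      have "0 \<le> a s" unfolding a_def using g by (intro avg_nonneg) auto
      then have "d' s \<le> (a s + m) / m" unfolding d'_def using m by (intro divide_right_mono) auto
      then have 1: "d' s \<le> a s / m + 1" using m by (simp add: add_divide_distrib)
      have "d' s \<le> K / m / 20" using dual'[OF that, of 40] False by simp
      then have "d' s * d' s \<le> K / m / 20 * (a s / m + 1)"
        using 1 d'0[of s] by (intro mult_mono) auto
      then show ?thesis by (simp add: power2_eq_square)
    qed
    then have "avg D (\<lambda>s. (d' s)\<^sup>2) \<le> avg D (\<lambda>s. K / m / 20 * (1 / m * a s + 1))"
      by (intro avg_mono) simp
    also have "\<dots> = K / m / 20 * (1 / m * avg D a + 1)"
      unfolding avg_cmult avg_add using D \<open>D \<noteq> {}\<close> by (subst avg_const) auto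
    also have "avg D a = avg S (\<lambda>\<sigma>. a (X \<sigma>))" by (rule part[symmetric])
    also have "\<dots> = avg S (cexp S X g)" by (simp add: a_def cexp_def[abs_def])
    also have "\<dots> = m" using S m by (simp add: avg_cexp)
    finally show ?thesis using m by simp
  qed
  have "avg S (\<lambda>\<sigma>. (cexp S X g \<sigma> - m)\<^sup>2 / m) = avg S (\<lambda>\<sigma>. (a (X \<sigma>) - m)\<^sup>2 / m)"
    by (simp add: a_def cexp_def)
  also have "\<dots> = avg D (\<lambda>s. (a s - m)\<^sup>2 / m)" by (rule part)
  also have "\<dots> = m * avg D (\<lambda>s. (d' s)\<^sup>2)" unfolding sq avg_cmult ..
  also have "\<dots> \<le> m * (K / m / 10)" using main m by (intro mult_left_mono) auto
  also have "\<dots> = K / 10" using m by simp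
  finally show ?thesis by (simp add: K_def)
qed

section \<open>One step of the broadcast recursion\<close>

lemma card_Collect_split: "finite A \<Longrightarrow> card {x\<in>A. P x} + card {x\<in>A. \<not> P x} = card A"
  by (subst card_Un_disjoint[symmetric]) (auto intro!: arg_cong[where f = card])

text \<open>
  S is the set of states of a child, with root color c and observation \<open>\<kappa>\<close>; S' is the set of states
  of a parent whose color r ranges over D and whose \<open>\<Delta>\<close> children are arbitrary states of color
  different from r. The parent's observation consists of the observations of its children.
\<close>

locale branching =
  fixes k \<Delta> :: nat and D :: "nat set"
    and S :: "'a set" and c :: "'a \<Rightarrow> nat" and \<kappa> :: "'a \<Rightarrow> 'o"
    and S' :: "'b set" and r :: "'b \<Rightarrow> nat" and sub :: "'b \<Rightarrow> nat \<Rightarrow> 'a" and \<kappa>' :: "'b \<Rightarrow> 'p"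
  assumes k: "4 \<le> k" and S: "finite S" "S \<noteq> {}" and c: "c ` S \<subseteq> {1..k}"
    and unif: "\<And>s. s \<in> {1..k} \<Longrightarrow> k * card {x\<in>S. c x = s} = card S"
    and D: "D \<subseteq> {1..k}" "k \<le> card D + 1"
    and bij: "bij_betw (\<lambda>\<sigma>. (r \<sigma>, \<lambda>i\<in>{..<\<Delta>}. sub \<sigma> i)) S'
      (SIGMA s:D. PiE {..<\<Delta>} (\<lambda>_. {x\<in>S. c x \<noteq> s}))"
    and obs: "\<And>\<sigma> \<sigma>'. \<sigma> \<in> S' \<Longrightarrow> \<sigma>' \<in> S' \<Longrightarrow>
      \<kappa>' \<sigma> = \<kappa>' \<sigma>' \<longleftrightarrow> (\<forall>i<\<Delta>. \<kappa> (sub \<sigma> i) = \<kappa> (sub \<sigma>' i))"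
begin

section \<open>Posterior weights of child and parent, and Bayes' rule\<close>

definition post :: "'a \<Rightarrow> nat \<Rightarrow> real" where
  "post x s = cexp S \<kappa> (\<lambda>y. of_bool (c y = s)) x"

definition post' :: "'b \<Rightarrow> nat \<Rightarrow> real" where
  "post' \<sigma> s = cexp S' \<kappa>' (\<lambda>\<tau>. of_bool (r \<tau> = s)) \<sigma>"

definition kids :: "'b \<Rightarrow> nat \<Rightarrow> 'a" where
  "kids \<sigma> = (\<lambda>i\<in>{..<\<Delta>}. sub \<sigma> i)"

abbreviation families :: "(nat \<Rightarrow> 'a) set" where
  "families \<equiv> PiE {..<\<Delta>} (\<lambda>_. S)"

abbreviation families_avoiding :: "nat \<Rightarrow> (nat \<Rightarrow> 'a) set" where
  "families_avoiding s \<equiv> PiE {..<\<Delta>} (\<lambda>_. {x\<in>S. c x \<noteq> s})"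

text \<open>Up to a factor not depending on \<open>q\<close>, the probability of the children's
  observations when the parent has color \<open>q\<close>. Given its observation, a child avoids
  \<open>q\<close> with probability 1 minus its posterior weight of \<open>q\<close>, and the
  children are independent.\<close>

definition lik :: "(nat \<Rightarrow> 'a) \<Rightarrow> nat \<Rightarrow> real" where
  "lik \<tau> q = (\<Prod>i<\<Delta>. 1 - post (\<tau> i) q)"

definition sumpost :: "(nat \<Rightarrow> 'a) \<Rightarrow> nat \<Rightarrow> real" where
  "sumpost \<tau> q = (\<Sum>i<\<Delta>. post (\<tau> i) q)"

text \<open>The number of all families of child states divided by the number of those avoiding one
  given color: the price of dropping the constraint imposed by the parent.\<close>

definition bias :: real where
  "bias = 1 / (1 - 1 / k) ^ \<Delta>"

lemma finD: "finite D" and cardD: "card D \<le> k" "card D \<noteq> 0"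
proof -
  show "finite D" using D by (rule_tac finite_subset) auto
  show "card D \<le> k" using card_mono[of "{1..k}" D] D by simp
  show "card D \<noteq> 0" using D k by simp
qed

lemma cardS: "real (card S) > 0"
  using S by (simp add: card_gt_0_iff)

lemma post_nonneg: "0 \<le> post x s"
  unfolding post_def by (rule cexp_nonneg) simp

lemma card_fibre: "card {x\<in>S. \<kappa> x = \<kappa> y \<and> c x = s} = card {x\<in>S. \<kappa> x = \<kappa> y} * post y s"
proof (cases "{x\<in>S. \<kappa> x = \<kappa> y} = {}")
  case False
  have "(\<Sum>x\<in>{x\<in>S. \<kappa> x = \<kappa> y}. of_bool (c x = s)) = real (card {x\<in>S. \<kappa> x = \<kappa> y \<and> c x = s})"
    using S by (simp add: Int_def conj_assoc)
  then show ?thesis using False S by (simp add: post_def cexp_def avg_def)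
next
  case True
  then have "{x\<in>S. \<kappa> x = \<kappa> y \<and> c x = s} = {}" by blast
  then show ?thesis unfolding True by (simp only: card.empty of_nat_0 mult_zero_left)
qed

lemma card_fibre_ne:
  "card {x\<in>S. \<kappa> x = \<kappa> y \<and> c x \<noteq> s} = card {x\<in>S. \<kappa> x = \<kappa> y} * (1 - post y s)"
proof -
  have "card {x\<in>S. \<kappa> x = \<kappa> y} =
      card {x\<in>S. \<kappa> x = \<kappa> y \<and> c x = s} + card {x\<in>S. \<kappa> x = \<kappa> y \<and> c x \<noteq> s}"
    using card_Collect_split[of "{x\<in>S. \<kappa> x = \<kappa> y}" "\<lambda>x. c x = s"] S by (simp add: conj_assoc)
  then show ?thesis using card_fibre[of y s] by (simp add: algebra_simps)
qed

lemma sum_post: "x \<in> S \<Longrightarrow> (\<Sum>s=1..k. post x s) = 1"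
proof -
  assume x: "x \<in> S"
  let ?F = "{y\<in>S. \<kappa> y = \<kappa> x}"
  have F: "card ?F > 0" using S x by (auto simp: card_gt_0_iff)
  have "(\<Sum>y\<in>?F. 1::nat) = (\<Sum>s=1..k. \<Sum>y\<in>{y\<in>?F. c y = s}. 1)"
    using S c by (intro sum.group[symmetric]) auto
  then have "card ?F = (\<Sum>s=1..k. card {y\<in>S. \<kappa> y = \<kappa> x \<and> c y = s})"
    by (simp add: conj_assoc)
  then have "real (card ?F) = (\<Sum>s=1..k. real (card {y\<in>S. \<kappa> y = \<kappa> x \<and> c y = s}))"
    by simp
  also have "\<dots> = card ?F * (\<Sum>s=1..k. post x s)"
    unfolding card_fibre sum_distrib_left ..
  finally show ?thesis using F by simp
qed

lemma post_le_1: "x \<in> S \<Longrightarrow> post x s \<le> 1"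
proof -
  assume x: "x \<in> S"
  have "post x s \<le> cexp S \<kappa> (\<lambda>_. 1) x" unfolding post_def by (rule cexp_mono) simp
  also have "\<dots> = 1" using S x by (intro cexp_eq_self) auto
  finally show ?thesis .
qed

lemma avg_of_bool: "finite A \<Longrightarrow> avg A (\<lambda>x. of_bool (P x)) = card {x\<in>A. P x} / card A"
  by (simp add: avg_def Int_def)

lemma avg_post: "s \<in> {1..k} \<Longrightarrow> avg S (\<lambda>x. post x s) = 1 / k"
proof -
  assume s: "s \<in> {1..k}"
  have "real k * card {x\<in>S. c x = s} = card S" using unif[OF s] by (metis of_nat_mult)
  then have "card {x\<in>S. c x = s} / card S = 1 / real k"
    using cardS k by (simp add: field_simps)
  then show ?thesis
    unfolding post_def avg_cexp[OF S(1)] avg_of_bool[OF S(1)] .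
qed

lemma card_avoiding: "s \<in> {1..k} \<Longrightarrow> card {x\<in>S. c x \<noteq> s} = (1 - 1 / k) * card S"
proof -
  assume s: "s \<in> {1..k}"
  have "real k * card {x\<in>S. c x = s} = card S" using unif[OF s] by (metis of_nat_mult)
  then have 1: "real (card {x\<in>S. c x = s}) = card S / k" using k by (simp add: field_simps)
  have "card S = card {x\<in>S. c x = s} + card {x\<in>S. c x \<noteq> s}"
    using card_Collect_split[OF S(1)] by simp
  then have "real (card {x\<in>S. c x \<noteq> s}) = card S - card S / k" using 1 by linarith
  then show ?thesis by (simp add: left_diff_distrib)
qed

lemma card_families: "card families = card S ^ \<Delta>"
  by (simp add: card_PiE)

lemma card_families_avoiding:
  "s \<in> {1..k} \<Longrightarrow> card (families_avoiding s) = ((1 - 1 / k) * card S) ^ \<Delta>"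
  using card_avoiding[of s] by (simp add: card_PiE)

lemma finite_families: "finite families" "finite (families_avoiding s)"
  using S by (auto intro!: finite_PiE)

lemma bij_kids: "s \<in> D \<Longrightarrow> bij_betw kids {\<sigma>\<in>S'. r \<sigma> = s} (families_avoiding s)"
proof -
  assume s: "s \<in> D"
  have inj: "inj_on (\<lambda>\<sigma>. (r \<sigma>, kids \<sigma>)) S'"
    and img: "(\<lambda>\<sigma>. (r \<sigma>, kids \<sigma>)) ` S' = (SIGMA s:D. families_avoiding s)"
    using bij by (simp_all add: bij_betw_def kids_def)
  show ?thesis unfolding bij_betw_def
  proof
    show "inj_on kids {\<sigma>\<in>S'. r \<sigma> = s}"
      using inj by (auto simp: inj_on_def)
    show "kids ` {\<sigma>\<in>S'. r \<sigma> = s} = families_avoiding s"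
    proof
      show "kids ` {\<sigma>\<in>S'. r \<sigma> = s} \<subseteq> families_avoiding s"
      proof
        fix \<tau> assume "\<tau> \<in> kids ` {\<sigma>\<in>S'. r \<sigma> = s}"
        then have "(s, \<tau>) \<in> (\<lambda>\<sigma>. (r \<sigma>, kids \<sigma>)) ` S'" by auto
        then show "\<tau> \<in> families_avoiding s" unfolding img by blast
      qed
      show "families_avoiding s \<subseteq> kids ` {\<sigma>\<in>S'. r \<sigma> = s}"
      proof
        fix \<tau> assume "\<tau> \<in> families_avoiding s"
        then have "(s, \<tau>) \<in> (\<lambda>\<sigma>. (r \<sigma>, kids \<sigma>)) ` S'" unfolding img using s by blast
        then show "\<tau> \<in> kids ` {\<sigma>\<in>S'. r \<sigma> = s}" by auto
      qed
    qed
  qed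
qed

lemma root_in_D: "\<sigma> \<in> S' \<Longrightarrow> r \<sigma> \<in> D"
  using bij_betwE[OF bij] by auto

lemma kids_in: "\<sigma> \<in> S' \<Longrightarrow> kids \<sigma> \<in> families"
proof -
  assume \<sigma>: "\<sigma> \<in> S'"
  then have "kids \<sigma> \<in> families_avoiding (r \<sigma>)"
    using bij_betwE[OF bij_kids[OF root_in_D[OF \<sigma>]]] by simp
  then show ?thesis by (auto simp: PiE_iff)
qed

lemma finite_S': "finite S'"
  using bij_betw_finite[OF bij] finD finite_families by (auto intro!: finite_SigmaI)

lemma sum_kids_root:
  "s \<in> D \<Longrightarrow> (\<Sum>\<sigma>\<in>{\<sigma>\<in>S'. r \<sigma> = s}. F (kids \<sigma>)) = (\<Sum>\<tau>\<in>families_avoiding s. F \<tau>)"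
  by (rule sum.reindex_bij_betw[OF bij_kids])

lemma sum_roots: "(\<Sum>\<sigma>\<in>S'. F \<sigma>) = (\<Sum>s\<in>D. \<Sum>\<sigma>\<in>{\<sigma>\<in>S'. r \<sigma> = s}. F \<sigma>)"
  using finite_S' finD root_in_D by (intro sum.group[symmetric]) auto

lemma card_root: "s \<in> D \<Longrightarrow> card {\<sigma>\<in>S'. r \<sigma> = s} = ((1 - 1 / k) * card S) ^ \<Delta>"
  using bij_betw_same_card[OF bij_kids] card_families_avoiding D by (metis subsetD)

lemma card_S': "card S' = card D * ((1 - 1 / k) * card S) ^ \<Delta>"
proof -
  have "real (card S') = (\<Sum>s\<in>D. real (card {\<sigma>\<in>S'. r \<sigma> = s}))"
    using sum_roots[of "\<lambda>_. 1::real"] by simp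
  also have "\<dots> = (\<Sum>s\<in>D. ((1 - 1 / k) * card S) ^ \<Delta>)"
    by (intro sum.cong refl card_root)
  finally show ?thesis by simp
qed

text \<open>Avoiding a color removes the fraction 1/k of the child states whichever color it is, so
  all parent colors have equally many extensions. This carries uniformity of the root color up the
  tree.\<close>

lemma unif': "s \<in> D \<Longrightarrow> card D * card {\<sigma>\<in>S'. r \<sigma> = s} = card S'"
proof -
  assume "s \<in> D"
  then have "real (card D * card {\<sigma>\<in>S'. r \<sigma> = s}) = real (card S')"
    unfolding card_S' of_nat_mult by (simp only: card_root)
  then show ?thesis by (simp only: of_nat_eq_iff)
qed

lemma base_pos: "0 < (1 - 1 / k) * card S"
  using cardS k by simp

lemma S'_nonempty: "S' \<noteq> {}"
  using card_S' cardD base_pos zero_less_power[OF base_pos, of \<Delta>] by auto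

lemma post'_nonneg: "0 \<le> post' \<sigma> s"
  unfolding post'_def by (rule cexp_nonneg) simp

lemma post'_le_1: "\<sigma> \<in> S' \<Longrightarrow> post' \<sigma> s \<le> 1"
proof -
  assume x: "\<sigma> \<in> S'"
  have "post' \<sigma> s \<le> cexp S' \<kappa>' (\<lambda>_. 1) \<sigma>" unfolding post'_def by (rule cexp_mono) simp
  also have "\<dots> = 1" using finite_S' x by (intro cexp_eq_self) auto
  finally show ?thesis .
qed

text \<open>Once the parent color is fixed, the set of states with a given observation is a product
  over the children, each factor being a fibre of the child's observation with one color
  removed.\<close>

lemma card_fibre':
  assumes \<sigma>: "\<sigma> \<in> S'" and s: "s \<in> D"
  shows "card {\<tau>\<in>S'. \<kappa>' \<tau> = \<kappa>' \<sigma> \<and> r \<tau> = s} =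
    (\<Prod>i<\<Delta>. real (card {x\<in>S. \<kappa> x = \<kappa> (kids \<sigma> i)})) * lik (kids \<sigma>) s"
proof -
  let ?T = "PiE {..<\<Delta>} (\<lambda>i. {x\<in>S. \<kappa> x = \<kappa> (kids \<sigma> i) \<and> c x \<noteq> s})"
  have iff: "kids \<tau> \<in> ?T \<longleftrightarrow> \<kappa>' \<tau> = \<kappa>' \<sigma>" if \<tau>: "\<tau> \<in> S'" "r \<tau> = s" for \<tau>
  proof -
    have "kids \<tau> \<in> families_avoiding s"
      using bij_betwE[OF bij_kids[OF s]] that by simp
    then have "kids \<tau> \<in> ?T \<longleftrightarrow> (\<forall>i<\<Delta>. \<kappa> (kids \<tau> i) = \<kappa> (kids \<sigma> i))"
      by (auto simp: PiE_iff)
    then show ?thesis using obs[OF \<tau>(1) \<sigma>] by (simp add: kids_def)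
  qed
  have sub: "?T \<subseteq> families_avoiding s" by (auto simp: PiE_iff)
  have "bij_betw kids {\<tau>\<in>S'. \<kappa>' \<tau> = \<kappa>' \<sigma> \<and> r \<tau> = s} ?T"
    unfolding bij_betw_def
  proof
    show "inj_on kids {\<tau>\<in>S'. \<kappa>' \<tau> = \<kappa>' \<sigma> \<and> r \<tau> = s}"
      using bij_kids[OF s] unfolding bij_betw_def by (auto simp: inj_on_def)
    have 1: "{\<tau>\<in>S'. \<kappa>' \<tau> = \<kappa>' \<sigma> \<and> r \<tau> = s} = {\<tau>\<in>{\<sigma>\<in>S'. r \<sigma> = s}. kids \<tau> \<in> ?T}"
      using iff by auto
    have "kids ` {\<tau>\<in>{\<sigma>\<in>S'. r \<sigma> = s}. kids \<tau> \<in> ?T} = kids ` {\<sigma>\<in>S'. r \<sigma> = s} \<inter> ?T" by blast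
    also have "\<dots> = ?T"
      unfolding bij_betw_imp_surj_on[OF bij_kids[OF s]] by (rule Int_absorb1[OF sub])
    finally show "kids ` {\<tau>\<in>S'. \<kappa>' \<tau> = \<kappa>' \<sigma> \<and> r \<tau> = s} = ?T" unfolding 1 .
  qed
  then have "card {\<tau>\<in>S'. \<kappa>' \<tau> = \<kappa>' \<sigma> \<and> r \<tau> = s} = card ?T" by (rule bij_betw_same_card)
  also have "real (card ?T) = (\<Prod>i<\<Delta>. card {x\<in>S. \<kappa> x = \<kappa> (kids \<sigma> i)} * (1 - post (kids \<sigma> i) s))"
    by (simp add: card_PiE card_fibre_ne)
  finally show ?thesis by (simp add: lik_def prod.distrib)
qed

lemma lik_nonneg: "\<tau> \<in> families \<Longrightarrow> 0 \<le> lik \<tau> q"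
  unfolding lik_def using post_le_1 by (intro prod_nonneg) (auto simp: PiE_iff)

lemma lik_le_1: "\<tau> \<in> families \<Longrightarrow> lik \<tau> q \<le> 1"
  unfolding lik_def using post_le_1 post_nonneg by (intro prod_le_1) (auto simp: PiE_iff)

lemma lik_le_exp: "\<tau> \<in> families \<Longrightarrow> lik \<tau> q \<le> exp (- sumpost \<tau> q)"
proof -
  assume \<tau>: "\<tau> \<in> families"
  have "lik \<tau> q \<le> (\<Prod>i<\<Delta>. exp (- post (\<tau> i) q))"
    unfolding lik_def
  proof (rule prod_mono)
    fix i assume "i \<in> {..<\<Delta>}"
    then have "\<tau> i \<in> S" using \<tau> by (auto simp: PiE_iff)
    then show "0 \<le> 1 - post (\<tau> i) q \<and> 1 - post (\<tau> i) q \<le> exp (- post (\<tau> i) q)"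
      using post_le_1 exp_ge_add_one_self[of "- post (\<tau> i) q"] by auto
  qed
  then show ?thesis by (simp add: sumpost_def exp_sum[symmetric] sum_negf)
qed

text \<open>Bayes' rule for the uniform prior on \<open>D\<close>. The product of the sizes of the
  children's fibres appears for every color and cancels.\<close>

lemma post'_eq:
  assumes \<sigma>: "\<sigma> \<in> S'" and s: "s \<in> D"
  shows "post' \<sigma> s * (\<Sum>q\<in>D. lik (kids \<sigma>) q) = lik (kids \<sigma>) s"
    and "0 < (\<Sum>q\<in>D. lik (kids \<sigma>) q)"
proof -
  define N where "N = (\<Prod>i<\<Delta>. real (card {x\<in>S. \<kappa> x = \<kappa> (kids \<sigma> i)}))"
  let ?F = "{\<tau>\<in>S'. \<kappa>' \<tau> = \<kappa>' \<sigma>}"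
  have F: "finite ?F" "card ?F > 0" using finite_S' \<sigma> by (auto simp: card_gt_0_iff)
  have "(\<Sum>\<tau>\<in>?F. 1::real) = (\<Sum>s\<in>D. \<Sum>\<tau>\<in>{\<tau>\<in>?F. r \<tau> = s}. 1)"
    using F finD root_in_D by (intro sum.group[symmetric]) auto
  then have "real (card ?F) = (\<Sum>s\<in>D. real (card {\<tau>\<in>S'. \<kappa>' \<tau> = \<kappa>' \<sigma> \<and> r \<tau> = s}))"
    by (simp add: conj_assoc)
  also have "\<dots> = N * (\<Sum>q\<in>D. lik (kids \<sigma>) q)"
    unfolding sum_distrib_left N_def by (intro sum.cong refl card_fibre'[OF \<sigma>])
  finally have cF: "real (card ?F) = N * (\<Sum>q\<in>D. lik (kids \<sigma>) q)" .
  have N0: "0 \<le> N" unfolding N_def by (intro prod_nonneg) auto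
  have N: "N > 0" using N0 cF F(2) by (cases "N = 0") auto
  have L0: "0 \<le> (\<Sum>q\<in>D. lik (kids \<sigma>) q)"
    using lik_nonneg[OF kids_in[OF \<sigma>]] by (intro sum_nonneg) auto
  show "0 < (\<Sum>q\<in>D. lik (kids \<sigma>) q)"
    using L0 cF F(2) by (cases "(\<Sum>q\<in>D. lik (kids \<sigma>) q) = 0") auto
  have "(\<Sum>\<tau>\<in>?F. of_bool (r \<tau> = s)) = real (card {\<tau>\<in>S'. \<kappa>' \<tau> = \<kappa>' \<sigma> \<and> r \<tau> = s})"
    using F by (simp add: Int_def conj_assoc)
  then have "post' \<sigma> s * card ?F = real (card {\<tau>\<in>S'. \<kappa>' \<tau> = \<kappa>' \<sigma> \<and> r \<tau> = s})"
    using F(2) unfolding post'_def cexp_def avg_def by (simp only: of_nat_0_less_iff nonzero_divide_eq_eq) simp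
  also have "\<dots> = N * lik (kids \<sigma>) s" unfolding N_def by (rule card_fibre'[OF \<sigma> s])
  finally have "N * (post' \<sigma> s * (\<Sum>q\<in>D. lik (kids \<sigma>) q)) = N * lik (kids \<sigma>) s"
    unfolding cF by (simp add: algebra_simps)
  then show "post' \<sigma> s * (\<Sum>q\<in>D. lik (kids \<sigma>) q) = lik (kids \<sigma>) s" using N by simp
qed

section \<open>Comparison with independent unconstrained children\<close>

lemma bias_pos: "0 < bias"
  using k by (simp add: bias_def)

lemma sum_families_avoiding_le:
  assumes "\<forall>\<tau>\<in>families. 0 \<le> F \<tau>"
  shows "(\<Sum>\<tau>\<in>families_avoiding s. F \<tau>) \<le> card families * avg families F"
proof -
  have "(\<Sum>\<tau>\<in>families_avoiding s. F \<tau>) \<le> (\<Sum>\<tau>\<in>families. F \<tau>)"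
    using assms finite_families by (intro sum_mono2) (auto simp: PiE_iff)
  also have "\<dots> = card families * avg families F"
    using cardS by (simp add: avg_def card_families)
  finally show ?thesis .
qed

lemma card_families_eq: "real (card families) = bias * ((1 - 1 / k) * card S) ^ \<Delta>"
  using base_pos k unfolding card_families bias_def by (simp add: power_mult_distrib)

text \<open>Dropping the constraint only adds nonnegative terms, and the normalisation changes by
  the factor \<open>bias\<close>. Afterwards the children are independent and uniform, so product
  functions factorise.\<close>

lemma avg_kids_le:
  assumes F: "\<forall>\<tau>\<in>families. 0 \<le> F \<tau>"
  shows "avg S' (\<lambda>\<sigma>. F (kids \<sigma>)) \<le> bias * avg families F"
proof -
  let ?M = "((1 - 1 / k) * card S) ^ \<Delta>"
  have M: "?M > 0" using zero_less_power[OF base_pos] .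
  have "(\<Sum>\<sigma>\<in>S'. F (kids \<sigma>)) = (\<Sum>s\<in>D. \<Sum>\<tau>\<in>families_avoiding s. F \<tau>)"
    unfolding sum_roots by (intro sum.cong refl sum_kids_root)
  also have "\<dots> \<le> (\<Sum>s\<in>D. card families * avg families F)"
    by (intro sum_mono sum_families_avoiding_le F)
  also have "\<dots> = card S' * (bias * avg families F)"
    unfolding card_families_eq card_S' by simp
  finally have "(\<Sum>\<sigma>\<in>S'. F (kids \<sigma>)) \<le> card S' * (bias * avg families F)" .
  moreover have "card S' > 0" using finite_S' S'_nonempty by (simp add: card_gt_0_iff)
  ultimately show ?thesis by (simp add: avg_def[of S'] field_simps)
qed

lemma sum_prod_families: "(\<Sum>\<tau>\<in>families. \<Prod>i<\<Delta>. h (\<tau> i)) = ((\<Sum>x\<in>S. h x) ^ \<Delta> :: real)"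
proof -
  have "(\<Sum>\<tau>\<in>families. \<Prod>i<\<Delta>. h (\<tau> i)) = (\<Prod>i<\<Delta>. \<Sum>x\<in>S. h x)"
    using S by (intro prod_sum_PiE[symmetric]) auto
  then show ?thesis by simp
qed

lemma sum_prod_families_avoiding:
  "(\<Sum>\<tau>\<in>families_avoiding s. \<Prod>i<\<Delta>. h (\<tau> i)) = ((\<Sum>x\<in>{x\<in>S. c x \<noteq> s}. h x) ^ \<Delta> :: real)"
proof -
  have "(\<Sum>\<tau>\<in>families_avoiding s. \<Prod>i<\<Delta>. h (\<tau> i)) = (\<Prod>i<\<Delta>. \<Sum>x\<in>{x\<in>S. c x \<noteq> s}. h x)"
    using S by (intro prod_sum_PiE[symmetric]) auto
  then show ?thesis by simp
qed

lemma avg_prod_families: "avg families (\<lambda>\<tau>. \<Prod>i<\<Delta>. h (\<tau> i)) = (avg S h) ^ \<Delta>"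
  unfolding avg_def sum_prod_families card_families by (simp add: power_divide)

end

section \<open>Posterior estimates\<close>

text \<open>A converse of 1 - m \<le> exp(-m) at the price of a factor close to 1 in the exponent;
  it bounds likelihoods of light colors from below.\<close>

lemma exp_neg_le_one_minus:
  fixes m \<beta> :: real
  assumes "0 \<le> m" "m \<le> \<beta>" "\<beta> \<le> 1 / 2"
  shows "exp (- (1 + 2 * \<beta>) * m) \<le> 1 - m"
proof -
  have "- m - 2 * m\<^sup>2 \<le> ln (1 - m)" using assms by (intro ln_one_minus_pos_lower_bound) auto
  moreover have "2 * m\<^sup>2 \<le> 2 * \<beta> * m" using assms by (simp add: power2_eq_square mult_right_mono)
  ultimately have "- (1 + 2 * \<beta>) * m \<le> ln (1 - m)" by (simp add: algebra_simps)
  then have "exp (- (1 + 2 * \<beta>) * m) \<le> exp (ln (1 - m))" by (simp only: exp_le_cancel_iff)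
  then show ?thesis using assms by simp
qed

context branching
begin

section \<open>Biased children and the bound on the parent's posterior\<close>

abbreviation load :: real where "load \<equiv> real \<Delta> / real k"

definition bad :: "real \<Rightarrow> 'a \<Rightarrow> bool" where
  "bad \<beta> x \<longleftrightarrow> (\<exists>q\<in>{1..k}. \<beta> < post x q)"

definition bad' :: "real \<Rightarrow> 'b \<Rightarrow> bool" where
  "bad' \<beta> \<sigma> \<longleftrightarrow> (\<exists>q\<in>{1..k}. \<beta> < post' \<sigma> q)"

definition nbad :: "real \<Rightarrow> (nat \<Rightarrow> 'a) \<Rightarrow> nat" where
  "nbad \<beta> \<tau> = card {i\<in>{..<\<Delta>}. bad \<beta> (\<tau> i)}"

lemma bias_le: "bias \<le> exp (\<Delta> / (real k - 1))"
proof -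
  have "1 / (1 - 1 / k) = 1 + 1 / (real k - 1)" using k by (simp add: field_simps)
  also have "\<dots> \<le> exp (1 / (real k - 1))" by (rule exp_ge_add_one_self)
  finally have "(1 / (1 - 1 / k)) ^ \<Delta> \<le> exp (1 / (real k - 1)) ^ \<Delta>"
    using k by (intro power_mono) auto
  then show ?thesis by (simp add: bias_def power_divide exp_of_nat_mult[symmetric])
qed

text \<open>Chernoff's bound for independent children. The parameter \<open>t\<close> stays free
  because it is later taken once as 1 and then as b/4.\<close>

lemma avg_nbad_le:
  assumes t: "0 \<le> t" and p: "avg S (\<lambda>x. of_bool (bad \<beta> x)) \<le> p"
  shows "avg families (\<lambda>\<tau>. of_bool (b < real (nbad \<beta> \<tau>))) \<le> exp (\<Delta> * (p * exp t) - t * b)"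
proof -
  have nb: "real (nbad \<beta> \<tau>) = (\<Sum>i<\<Delta>. of_bool (bad \<beta> (\<tau> i)))" for \<tau>
    by (simp add: nbad_def Int_def)
  have "avg families (\<lambda>\<tau>. of_bool (b < real (nbad \<beta> \<tau>)))
      \<le> avg families (\<lambda>\<tau>. exp (- t * b) * (\<Prod>i<\<Delta>. exp (t * of_bool (bad \<beta> (\<tau> i)))))"
  proof (rule avg_mono)
    fix \<tau>
    have "of_bool (b < real (nbad \<beta> \<tau>)) \<le> exp (t * (nbad \<beta> \<tau> - b))"
      using t by auto
    also have "\<dots> = exp (- t * b) * exp (t * nbad \<beta> \<tau>)" by (simp add: algebra_simps flip: exp_add)
    also have "exp (t * nbad \<beta> \<tau>) = (\<Prod>i<\<Delta>. exp (t * of_bool (bad \<beta> (\<tau> i))))"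
      unfolding nb sum_distrib_left by (rule exp_sum) simp
    finally show "of_bool (b < real (nbad \<beta> \<tau>)) \<le> exp (- t * b) * (\<Prod>i<\<Delta>. exp (t * of_bool (bad \<beta> (\<tau> i))))" .
  qed
  also have "\<dots> = exp (- t * b) * (avg S (\<lambda>x. exp (t * of_bool (bad \<beta> x)))) ^ \<Delta>"
    unfolding avg_cmult avg_prod_families[of "\<lambda>x. exp (t * of_bool (bad \<beta> x))"] ..
  also have "avg S (\<lambda>x. exp (t * of_bool (bad \<beta> x))) \<le> exp (p * exp t)"
  proof -
    have "avg S (\<lambda>x. exp (t * of_bool (bad \<beta> x))) \<le> avg S (\<lambda>x. 1 + exp t * of_bool (bad \<beta> x))"
      by (rule avg_mono) auto
    also have "\<dots> = 1 + exp t * avg S (\<lambda>x. of_bool (bad \<beta> x))"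
      unfolding avg_add avg_cmult using S by (simp add: avg_const)
    also have "\<dots> \<le> 1 + exp t * p" using p by simp
    also have "\<dots> \<le> exp (p * exp t)"
      using exp_ge_add_one_self[of "p * exp t"] by (simp add: mult.commute)
    finally show ?thesis .
  qed
  then have "exp (- t * b) * (avg S (\<lambda>x. exp (t * of_bool (bad \<beta> x)))) ^ \<Delta> \<le> exp (- t * b) * exp (p * exp t) ^ \<Delta>"
    by (intro mult_left_mono power_mono avg_nonneg) auto
  also have "\<dots> = exp (\<Delta> * (p * exp t) - t * b)"
    by (simp add: exp_of_nat_mult[symmetric] exp_diff exp_minus field_simps)
  finally show ?thesis .
qed

text \<open>The numerator in Bayes' rule is at most
  \<open>exp (- sumpost (kids \<sigma>) s)\<close>, so only the normalising sum needs a lower bound.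
  It is taken over the colors that are light for every child; for these 1 - p is comparable to
  exp(-p), and their average \<open>sumpost\<close> is at most about \<open>load\<close>.\<close>

lemma post'_le_exp:
  fixes \<beta> :: real
  assumes \<sigma>: "\<sigma> \<in> S'" and s: "s \<in> D" and \<beta>: "0 < \<beta>" "\<beta> \<le> 1 / 4" "1 \<le> \<beta> * k"
    and few: "nbad \<beta> (kids \<sigma>) \<le> \<beta>\<^sup>2 * k"
  shows "card D * post' \<sigma> s \<le> exp (10 * \<beta> * (1 + load) + load - sumpost (kids \<sigma>) s)"
proof -
  define \<tau> where "\<tau> = kids \<sigma>"
  define I where "I = {i\<in>{..<\<Delta>}. bad \<beta> (\<tau> i)}"
  define heavy where "heavy x = {q\<in>{1..k}. \<beta> < post x q}" for x
  define R where "R = D - (\<Union>i\<in>I. heavy (\<tau> i))"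
  have \<tau>: "\<tau> \<in> families" using kids_in[OF \<sigma>] by (simp add: \<tau>_def)
  have \<tau>i: "\<tau> i \<in> S" if "i < \<Delta>" for i using \<tau> that by (auto simp: PiE_iff)
  have kp: "real k > 0" using k by simp
  \<comment> \<open>Posterior weights sum to 1, so each child has at most 1/\<beta> heavy colors.
    With at most \<beta>^2 k biased children, at most \<beta> k colors are lost.\<close>
  have heavy: "\<beta> * card (heavy x) \<le> 1" if "x \<in> S" for x
  proof -
    have "\<beta> * card (heavy x) = (\<Sum>q\<in>heavy x. \<beta>)" by simp
    also have "\<dots> \<le> (\<Sum>q\<in>heavy x. post x q)" by (intro sum_mono) (auto simp: heavy_def)
    also have "\<dots> \<le> (\<Sum>q=1..k. post x q)"
      using post_nonneg by (intro sum_mono2) (auto simp: heavy_def)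
    finally show ?thesis using sum_post[OF that] by simp
  qed
  have "\<beta> * card (\<Union>i\<in>I. heavy (\<tau> i)) \<le> \<beta> * (\<Sum>i\<in>I. real (card (heavy (\<tau> i))))"
    using \<beta> card_UN_le[of I "\<lambda>i. heavy (\<tau> i)"]
    by (intro mult_left_mono) (auto simp: I_def simp flip: of_nat_sum)
  also have "\<dots> \<le> (\<Sum>i\<in>I. 1)"
    unfolding sum_distrib_left using heavy \<tau>i by (intro sum_mono) (auto simp: I_def)
  also have "\<dots> \<le> \<beta>\<^sup>2 * k" using few by (simp add: I_def nbad_def \<tau>_def)
  finally have "\<beta> * card (\<Union>i\<in>I. heavy (\<tau> i)) \<le> \<beta> * (\<beta> * k)" by (simp add: power2_eq_square mult.assoc)
  then have killed: "card (\<Union>i\<in>I. heavy (\<tau> i)) \<le> \<beta> * k" using \<beta> by simp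
  have "card D - card (\<Union>i\<in>I. heavy (\<tau> i)) \<le> card R"
    unfolding R_def by (rule diff_card_le_card_Diff) (auto simp: I_def heavy_def)
  then have "real (card D) - card (\<Union>i\<in>I. heavy (\<tau> i)) \<le> card R" by linarith
  moreover have "real k \<le> card D + 1" using D(2) by linarith
  ultimately have "real k - 1 - \<beta> * k \<le> card R" using killed by linarith
  \<comment> \<open>The color that may be missing from \<open>D\<close> costs 1, which
    \<open>1 \<le> \<beta> * k\<close> absorbs into a second \<beta> k.\<close>
  then have R: "(1 - 2 * \<beta>) * k \<le> card R" using \<beta> by (simp add: algebra_simps)
  have h: "1 / 2 \<le> 1 - 2 * \<beta>" using \<beta> by simp
  have Rpos: "real (card R) > 0"
    using R mult_pos_pos[of "1 - 2 * \<beta>" "real k"] h kp by linarith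
  have finR: "finite R" using finD by (simp add: R_def)
  have RD: "R \<subseteq> D" "R \<subseteq> {1..k}" using D by (auto simp: R_def)
  have light: "post (\<tau> i) q \<le> \<beta>" if "q \<in> R" "i < \<Delta>" for q i
  proof (rule ccontr)
    assume "\<not> post (\<tau> i) q \<le> \<beta>"
    moreover have "q \<in> {1..k}" using that RD by blast
    ultimately have "q \<in> heavy (\<tau> i)" "i \<in> I" using that by (auto simp: heavy_def I_def bad_def intro!: bexI[of _ q])
    then show False using that by (auto simp: R_def)
  qed
  have lik: "exp (- (1 + 2 * \<beta>) * sumpost \<tau> q) \<le> lik \<tau> q" if q: "q \<in> R" for q
  proof -
    have "exp (- (1 + 2 * \<beta>) * sumpost \<tau> q) = (\<Prod>i<\<Delta>. exp (- (1 + 2 * \<beta>) * post (\<tau> i) q))"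
      by (simp add: sumpost_def sum_distrib_left exp_sum)
    also have "\<dots> \<le> lik \<tau> q"
      unfolding lik_def using light[OF q] post_nonneg \<beta>
      by (intro prod_mono conjI exp_neg_le_one_minus) auto
    finally show ?thesis .
  qed
  have sumR: "(\<Sum>q\<in>R. sumpost \<tau> q) \<le> \<Delta>"
  proof -
    have "(\<Sum>q\<in>R. sumpost \<tau> q) \<le> (\<Sum>q=1..k. sumpost \<tau> q)"
      unfolding sumpost_def using RD post_nonneg by (intro sum_mono2 sum_nonneg) auto
    also have "\<dots> = (\<Sum>i<\<Delta>. \<Sum>q=1..k. post (\<tau> i) q)"
      unfolding sumpost_def by (rule sum.swap)
    also have "\<dots> = \<Delta>" using sum_post \<tau>i by simp
    finally show ?thesis .
  qed
  define C where "C = (1 + 2 * \<beta>) * \<Delta> / card R"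
  \<comment> \<open>Jensen's inequality through the tangent of exp at -C. Since C is at least the
    average of the exponents over \<open>R\<close>, the linear terms have a nonnegative sum.\<close>
  have "card R * exp (- C) \<le> (\<Sum>q\<in>R. exp (- C) * (1 + (C - (1 + 2 * \<beta>) * sumpost \<tau> q)))"
  proof -
    have "(1 + 2 * \<beta>) * (\<Sum>q\<in>R. sumpost \<tau> q) \<le> (1 + 2 * \<beta>) * \<Delta>"
      using sumR \<beta> by (intro mult_left_mono) auto
    also have "\<dots> = card R * C" using Rpos by (simp add: C_def)
    finally have "(1 + 2 * \<beta>) * (\<Sum>q\<in>R. sumpost \<tau> q) \<le> card R * C" .
    then have "real (card R) \<le> (\<Sum>q\<in>R. 1 + (C - (1 + 2 * \<beta>) * sumpost \<tau> q))"
      by (simp add: sum.distrib sum_subtractf flip: sum_distrib_left)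
    then have "exp (- C) * card R \<le> exp (- C) * (\<Sum>q\<in>R. 1 + (C - (1 + 2 * \<beta>) * sumpost \<tau> q))"
      by (intro mult_left_mono) auto
    then show ?thesis by (simp add: sum_distrib_left mult.commute)
  qed
  also have "\<dots> \<le> (\<Sum>q\<in>R. exp (- (1 + 2 * \<beta>) * sumpost \<tau> q))"
  proof (rule sum_mono)
    fix q
    have "exp (- C) * (1 + (C - (1 + 2 * \<beta>) * sumpost \<tau> q)) \<le> exp (- C) * exp (C - (1 + 2 * \<beta>) * sumpost \<tau> q)"
      by (intro mult_left_mono exp_ge_add_one_self) auto
    also have "\<dots> = exp (- (1 + 2 * \<beta>) * sumpost \<tau> q)"
      by (simp add: exp_add[symmetric] algebra_simps)
    finally show "exp (- C) * (1 + (C - (1 + 2 * \<beta>) * sumpost \<tau> q)) \<le> exp (- (1 + 2 * \<beta>) * sumpost \<tau> q)" .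
  qed
  also have "\<dots> \<le> (\<Sum>q\<in>R. lik \<tau> q)" by (intro sum_mono lik)
  also have "\<dots> \<le> (\<Sum>q\<in>D. lik \<tau> q)"
    using RD finD lik_nonneg[OF \<tau>] by (intro sum_mono2) auto
  finally have L: "card R * exp (- C) \<le> (\<Sum>q\<in>D. lik \<tau> q)" .
  have C: "C \<le> load + 8 * \<beta> * load"
  proof -
    have "C \<le> (1 + 2 * \<beta>) * \<Delta> / ((1 - 2 * \<beta>) * k)"
      unfolding C_def using R Rpos kp \<beta> by (intro divide_left_mono) auto
    also have "\<dots> = (1 + 2 * \<beta>) / (1 - 2 * \<beta>) * load" by simp
    also have "\<dots> \<le> (1 + 8 * \<beta>) * load"
    proof (rule mult_right_mono)
      have "0 \<le> \<beta> * (1 - 4 * \<beta>)" using \<beta> by (intro mult_nonneg_nonneg) auto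
      then show "(1 + 2 * \<beta>) / (1 - 2 * \<beta>) \<le> 1 + 8 * \<beta>"
        using \<beta> by (simp add: field_simps power2_eq_square)
    qed simp
    finally show ?thesis by (simp add: algebra_simps)
  qed
  have e4: "exp (- (4 * \<beta>)) \<le> 1 - 2 * \<beta>"
  proof -
    have "exp (- (1 + 2 * (2 * \<beta>)) * (2 * \<beta>)) \<le> 1 - 2 * \<beta>"
      using \<beta> by (intro exp_neg_le_one_minus) auto
    moreover have "0 \<le> \<beta> * (1 - 4 * \<beta>)" using \<beta> by (intro mult_nonneg_nonneg) auto
    then have "exp (- (4 * \<beta>)) \<le> exp (- (1 + 2 * (2 * \<beta>)) * (2 * \<beta>))" 
      by (simp add: algebra_simps)
    ultimately show ?thesis by linarith
  qed
  define E where "E = exp (- (4 * \<beta>) - (load + 8 * \<beta> * load))"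
  have "k * E = (exp (- (4 * \<beta>)) * k) * exp (- (load + 8 * \<beta> * load))"
    unfolding E_def diff_conv_add_uminus exp_add by simp
  also have "\<dots> \<le> card R * exp (- C)"
  proof (rule mult_mono)
    have "exp (- (4 * \<beta>)) * k \<le> (1 - 2 * \<beta>) * k" using e4 by (intro mult_right_mono) auto
    then show "exp (- (4 * \<beta>)) * k \<le> card R" using R by linarith
  qed (use C in auto)
  also note L
  finally have kE: "k * E \<le> (\<Sum>q\<in>D. lik \<tau> q)" .
  have p: "0 \<le> post' \<sigma> s" by (rule post'_nonneg)
  have "(card D * post' \<sigma> s) * E \<le> (k * post' \<sigma> s) * E"
    using p cardD by (intro mult_right_mono) (auto simp: E_def)
  also have "\<dots> = post' \<sigma> s * (k * E)" by simp
  also have "\<dots> \<le> post' \<sigma> s * (\<Sum>q\<in>D. lik \<tau> q)" using p kE by (intro mult_left_mono)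
  also have "\<dots> = lik \<tau> s" unfolding \<tau>_def by (rule post'_eq[OF \<sigma> s])
  also have "\<dots> \<le> exp (- sumpost \<tau> s)" by (rule lik_le_exp[OF \<tau>])
  finally have "card D * post' \<sigma> s \<le> exp (- sumpost \<tau> s) / E"
    by (simp add: E_def pos_le_divide_eq)
  also have "\<dots> = exp (4 * \<beta> + 8 * \<beta> * load + load - sumpost \<tau> s)"
    by (simp add: E_def algebra_simps flip: exp_diff)
  also have "\<dots> \<le> exp (10 * \<beta> * (1 + load) + load - sumpost \<tau> s)"
  proof -
    have "0 \<le> \<beta> * load" using \<beta> by (intro mult_nonneg_nonneg) auto
    moreover have "4 * \<beta> + 8 * z \<le> 10 * (\<beta> + z)" if "0 \<le> z" for z :: real
      using that \<beta>(1) by (simp add: distrib_left)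
    ultimately have "4 * \<beta> + 8 * (\<beta> * load) \<le> 10 * (\<beta> + \<beta> * load)" by blast
    then have "4 * \<beta> + 8 * \<beta> * load \<le> 10 * \<beta> * (1 + load)" by (simp only: distrib_left mult.assoc mult_1_right)
    then show ?thesis by simp
  qed
  finally show ?thesis by (simp add: \<tau>_def)
qed

text \<open>Even with no evidence against a color, that is with \<open>sumpost\<close> equal to 0,
  the posterior bound gives at most \<beta> by the hypothesis \<open>good\<close>. Only an excess of
  biased children can defeat it.\<close>

lemma bad'_imp_many_bad:
  fixes \<beta> :: real
  assumes \<sigma>: "\<sigma> \<in> S'" and full: "D = {1..k}" and \<beta>: "0 < \<beta>" "\<beta> \<le> 1 / 4" "1 \<le> \<beta> * k"
    and good: "exp (10 * \<beta> * (1 + load) + load) \<le> \<beta> * k" and bad: "bad' \<beta> \<sigma>"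
  shows "\<beta>\<^sup>2 * k < nbad \<beta> (kids \<sigma>)"
proof (rule ccontr)
  assume n: "\<not> ?thesis"
  obtain q where q: "q \<in> D" "\<beta> < post' \<sigma> q" using bad full by (auto simp: bad'_def)
  have "k * post' \<sigma> q \<le> exp (10 * \<beta> * (1 + load) + load - sumpost (kids \<sigma>) q)"
    using post'_le_exp[OF \<sigma> q(1) \<beta>] n full by simp
  also have "\<dots> \<le> exp (10 * \<beta> * (1 + load) + load)"
    by (simp add: sumpost_def sum_nonneg post_nonneg)
  also note good
  finally have "post' \<sigma> q \<le> \<beta>" using k by (simp add: mult.commute)
  then show False using q by simp
qed

lemma avg_bad'_le:
  fixes \<beta> :: real
  assumes full: "D = {1..k}" and \<beta>: "0 < \<beta>" "\<beta> \<le> 1 / 4" "1 \<le> \<beta> * k"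
    and good: "exp (10 * \<beta> * (1 + load) + load) \<le> \<beta> * k"
  shows "avg S' (\<lambda>\<sigma>. of_bool (bad' \<beta> \<sigma>)) \<le> bias * avg families (\<lambda>\<tau>. of_bool (\<beta>\<^sup>2 * k < nbad \<beta> \<tau>))"
proof -
  have "avg S' (\<lambda>\<sigma>. of_bool (bad' \<beta> \<sigma>)) \<le> avg S' (\<lambda>\<sigma>. of_bool (\<beta>\<^sup>2 * k < nbad \<beta> (kids \<sigma>)))"
    using bad'_imp_many_bad[OF _ full \<beta> good] by (intro avg_mono) auto
  also have "\<dots> \<le> bias * avg families (\<lambda>\<tau>. of_bool (\<beta>\<^sup>2 * k < nbad \<beta> \<tau>))"
    by (rule avg_kids_le) auto
  finally show ?thesis .
qed


text \<open>Each posterior weight has mean 1/k, so \<open>sumpost\<close> has mean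
  \<open>load\<close> and the first-order term cancels. For the lower tail the quadratic expansion
  of exp(-x) holds for all x \<ge> 0, so the second moment is the only other input.\<close>

lemma avg_exp_sumpost:
  assumes s: "s \<in> {1..k}" and e: "avg S (\<lambda>x. (post x s)\<^sup>2) \<le> e" and l: "0 \<le> l"
  shows "avg families (\<lambda>\<tau>. exp (l * (load - sumpost \<tau> s))) \<le> exp (\<Delta> * (l\<^sup>2 * e / 2))"
proof -
  have "avg S (\<lambda>x. exp (- (l * post x s))) \<le> avg S (\<lambda>x. 1 - l * post x s + l\<^sup>2 / 2 * (post x s)\<^sup>2)"
  proof (rule avg_mono)
    fix x
    have "0 \<le> l * post x s" using l post_nonneg by simp
    then show "exp (- (l * post x s)) \<le> 1 - l * post x s + l\<^sup>2 / 2 * (post x s)\<^sup>2"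
      using exp_minus_le_quadratic[of "l * post x s"] by (simp add: power_mult_distrib)
  qed
  also have "\<dots> = 1 - l * (1 / k) + l\<^sup>2 / 2 * avg S (\<lambda>x. (post x s)\<^sup>2)"
    unfolding avg_add avg_diff avg_cmult using avg_post[OF s] S by (simp add: avg_const)
  also have "\<dots> \<le> 1 + (- l / k + l\<^sup>2 * e / 2)"
    using mult_left_mono[OF e, of "l\<^sup>2 / 2"] by simp
  also have "\<dots> \<le> exp (- l / k + l\<^sup>2 * e / 2)" by (rule exp_ge_add_one_self)
  finally have 1: "avg S (\<lambda>x. exp (- (l * post x s))) \<le> exp (- l / k + l\<^sup>2 * e / 2)" .
  have "exp (l * (load - sumpost \<tau> s)) = exp (l * load) * (\<Prod>i<\<Delta>. exp (- (l * post (\<tau> i) s)))" for \<tau>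
  proof -
    have "(\<Prod>i<\<Delta>. exp (- (l * post (\<tau> i) s))) = exp (\<Sum>i<\<Delta>. - (l * post (\<tau> i) s))"
      by (rule exp_sum[symmetric]) simp
    also have "(\<Sum>i<\<Delta>. - (l * post (\<tau> i) s)) = - (l * sumpost \<tau> s)"
      by (simp add: sumpost_def sum_distrib_left sum_negf)
    finally show ?thesis by (simp add: right_diff_distrib flip: exp_add)
  qed
  then have "avg families (\<lambda>\<tau>. exp (l * (load - sumpost \<tau> s))) =
      exp (l * load) * (avg S (\<lambda>x. exp (- (l * post x s)))) ^ \<Delta>"
    using avg_prod_families[of "\<lambda>x. exp (- (l * post x s))"] by (simp add: avg_cmult)
  also have "\<dots> \<le> exp (l * load) * exp (- l / k + l\<^sup>2 * e / 2) ^ \<Delta>"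
    using 1 by (intro mult_left_mono power_mono avg_nonneg) auto
  also have "\<dots> = exp (\<Delta> * (l\<^sup>2 * e / 2))"
    by (simp add: exp_of_nat_mult[symmetric] algebra_simps flip: exp_add)
  finally show ?thesis .
qed

text \<open>
  The second moment is size biased: E post'^2 = E (post'; root = s), so one evaluates the first
  moment conditionally on the root color, where the children are again independent.
\<close>

lemma second_moment_le:
  fixes \<beta> e P :: real
  assumes full: "D = {1..k}" and s: "s \<in> {1..k}" and \<beta>: "0 < \<beta>" "\<beta> \<le> 1 / 4" "1 \<le> \<beta> * k"
    and e: "avg S (\<lambda>x. (post x s)\<^sup>2) \<le> e"
    and P: "avg families (\<lambda>\<tau>. of_bool (\<beta>\<^sup>2 * k < nbad \<beta> \<tau>)) \<le> P"
  shows "avg S' (\<lambda>\<sigma>. (post' \<sigma> s)\<^sup>2) \<le>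
    exp (10 * \<beta> * (1 + load) + \<Delta> / (real k * (real k - 1)) + 2 * \<Delta> * e) / (real k)\<^sup>2 + bias * P / k"
proof -
  define M where "M = (1 - 1 / k) * card S"
  have M: "M > 0" using base_pos by (simp add: M_def)
  have kp: "real k > 0" using k by simp
  define T where "T = 10 * \<beta> * (1 + load)"
  define F where "F \<tau> = exp (T + load) / k * exp (- sumpost \<tau> s) + of_bool (\<beta>\<^sup>2 * k < nbad \<beta> \<tau>)" for \<tau>
  have "(\<Sum>\<sigma>\<in>S'. (post' \<sigma> s)\<^sup>2) = (\<Sum>\<sigma>\<in>S'. cexp S' \<kappa>' (\<lambda>\<tau>. of_bool (r \<tau> = s)) \<sigma> * post' \<sigma> s)"
    by (simp add: post'_def power2_eq_square)
  also have "\<dots> = (\<Sum>\<sigma>\<in>S'. of_bool (r \<sigma> = s) * post' \<sigma> s)"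
    by (rule sum_cexp_mult[OF finite_S']) (unfold post'_def, rule cexp_key)
  also have "\<dots> = (\<Sum>\<sigma>\<in>{\<sigma>\<in>S'. r \<sigma> = s}. post' \<sigma> s)"
    by (subst sum.inter_filter[OF finite_S']) (auto intro!: sum.cong)
  also have "\<dots> \<le> (\<Sum>\<sigma>\<in>{\<sigma>\<in>S'. r \<sigma> = s}. F (kids \<sigma>))"
  proof (rule sum_mono)
    fix \<sigma> assume "\<sigma> \<in> {\<sigma>\<in>S'. r \<sigma> = s}"
    then have \<sigma>: "\<sigma> \<in> S'" by simp
    show "post' \<sigma> s \<le> F (kids \<sigma>)"
    proof (cases "\<beta>\<^sup>2 * k < nbad \<beta> (kids \<sigma>)")
      case True
      then show ?thesis using post'_le_1[OF \<sigma>, of s] by (simp add: F_def add_increasing)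
    next
      case False
      have "k * post' \<sigma> s \<le> exp (T + load - sumpost (kids \<sigma>) s)"
        using post'_le_exp[OF \<sigma> _ \<beta>, of s] False full s by (simp add: T_def)
      then have "post' \<sigma> s \<le> exp (T + load - sumpost (kids \<sigma>) s) / k"
        using kp by (simp add: field_simps)
      also have "\<dots> = exp (T + load) / k * exp (- sumpost (kids \<sigma>) s)"
        by (simp add: exp_diff exp_minus field_simps)
      finally show ?thesis by (simp add: F_def add_increasing2)
    qed
  qed
  also have "\<dots> = (\<Sum>\<tau>\<in>families_avoiding s. F \<tau>)" using s full by (intro sum_kids_root) simp
  also have "\<dots> = exp (T + load) / k * (\<Sum>\<tau>\<in>families_avoiding s. exp (- sumpost \<tau> s))
      + (\<Sum>\<tau>\<in>families_avoiding s. of_bool (\<beta>\<^sup>2 * k < nbad \<beta> \<tau>))"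
    unfolding F_def sum.distrib sum_distrib_left ..
  \<comment> \<open>Requiring a child to avoid \<open>s\<close> tilts its law by 1 - p, and (1 - p)
    exp(-p) \<le> exp(-2p). The resulting factor exp(-2 load) cancels both the
    \<open>exp load\<close> of the posterior bound and the one contained in \<open>bias\<close>,
    which leaves a constant divided by k^2.\<close>
  also have "(\<Sum>\<tau>\<in>families_avoiding s. exp (- sumpost \<tau> s)) \<le> bias * M ^ \<Delta> * exp (\<Delta> * (2 * e - 2 / k))"
  proof -
    have "exp (- sumpost \<tau> s) = (\<Prod>i<\<Delta>. exp (- post (\<tau> i) s))" for \<tau>
    proof -
      have "(\<Prod>i<\<Delta>. exp (- post (\<tau> i) s)) = exp (\<Sum>i<\<Delta>. - post (\<tau> i) s)"
        by (rule exp_sum[symmetric]) simp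
      then show ?thesis by (simp add: sumpost_def sum_negf)
    qed
    then have 1: "(\<Sum>\<tau>\<in>families_avoiding s. exp (- sumpost \<tau> s)) = (\<Sum>x\<in>{x\<in>S. c x \<noteq> s}. exp (- post x s)) ^ \<Delta>"
      using sum_prod_families_avoiding[where h = "\<lambda>x. exp (- post x s)" and s = s] by simp
    have "(\<Sum>x\<in>{x\<in>S. c x \<noteq> s}. exp (- post x s)) = (\<Sum>x\<in>S. exp (- post x s) - of_bool (c x = s) * exp (- post x s))"
      by (subst sum.inter_filter[OF S(1)]) (auto intro!: sum.cong)
    also have "\<dots> = (\<Sum>x\<in>S. exp (- post x s)) - (\<Sum>x\<in>S. post x s * exp (- post x s))"
    proof -
      have "(\<Sum>x\<in>S. of_bool (c x = s) * exp (- post x s)) = (\<Sum>x\<in>S. post x s * exp (- post x s))"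
        unfolding post_def
        by (rule sum_cexp_mult[OF S(1), symmetric]) (rule arg_cong[where f = "\<lambda>z. exp (- z)"], rule cexp_key)
      then show ?thesis by (simp add: sum_subtractf)
    qed
    also have "\<dots> = (\<Sum>x\<in>S. (1 - post x s) * exp (- post x s))"
      by (simp add: left_diff_distrib sum_subtractf)
    also have "\<dots> \<le> (\<Sum>x\<in>S. 1 - 2 * post x s + 2 * (post x s)\<^sup>2)"
    proof (rule sum_mono)
      fix x
      have "(1 - post x s) * exp (- post x s) \<le> exp (- post x s) * exp (- post x s)"
        using exp_ge_add_one_self[of "- post x s"] by (intro mult_right_mono) auto
      also have "\<dots> = exp (- (2 * post x s))" by (simp flip: exp_add)
      also have "\<dots> \<le> 1 - 2 * post x s + (2 * post x s)\<^sup>2 / 2"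
        using post_nonneg by (intro exp_minus_le_quadratic) auto
      finally show "(1 - post x s) * exp (- post x s) \<le> 1 - 2 * post x s + 2 * (post x s)\<^sup>2"
        by (simp add: power2_eq_square)
    qed
    also have "\<dots> = card S * avg S (\<lambda>x. 1 - 2 * post x s + 2 * (post x s)\<^sup>2)"
      using cardS by (simp add: avg_def)
    also have "\<dots> = card S * (1 - 2 * (1 / k) + 2 * avg S (\<lambda>x. (post x s)\<^sup>2))"
      unfolding avg_add avg_diff avg_cmult using avg_post[OF s] S by (simp add: avg_const)
    also have "\<dots> \<le> card S * (1 + (2 * e - 2 / k))"
      using e by (intro mult_left_mono) auto
    also have "\<dots> \<le> card S * exp (2 * e - 2 / k)"
      by (intro mult_left_mono exp_ge_add_one_self) auto
    finally have "(\<Sum>x\<in>{x\<in>S. c x \<noteq> s}. exp (- post x s)) ^ \<Delta> \<le> (card S * exp (2 * e - 2 / k)) ^ \<Delta>"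
      by (intro power_mono sum_nonneg) auto
    also have "\<dots> = bias * M ^ \<Delta> * exp (\<Delta> * (2 * e - 2 / k))"
      using card_families_eq card_families
      by (simp add: power_mult_distrib M_def exp_of_nat_mult[symmetric])
    finally show ?thesis unfolding 1 .
  qed
  also have "(\<Sum>\<tau>\<in>families_avoiding s. of_bool (\<beta>\<^sup>2 * k < nbad \<beta> \<tau>)) \<le> bias * M ^ \<Delta> * P"
  proof -
    have "(\<Sum>\<tau>\<in>families_avoiding s. of_bool (\<beta>\<^sup>2 * k < nbad \<beta> \<tau>)) \<le>
        card families * avg families (\<lambda>\<tau>. of_bool (\<beta>\<^sup>2 * k < nbad \<beta> \<tau>))"
      by (rule sum_families_avoiding_le) auto
    also have "\<dots> \<le> card families * P" using P by (intro mult_left_mono) auto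
    finally show ?thesis by (simp only: card_families_eq M_def)
  qed
  finally have "(\<Sum>\<sigma>\<in>S'. (post' \<sigma> s)\<^sup>2) \<le>
      exp (T + load) / k * (bias * M ^ \<Delta> * exp (\<Delta> * (2 * e - 2 / k))) + bias * M ^ \<Delta> * P"
    by (simp add: mult_left_mono divide_right_mono)
  also have "\<dots> = real (card S') * (exp (T + load) * bias * exp (\<Delta> * (2 * e - 2 / k)) / (real k)\<^sup>2 + bias * P / k)"
  proof -
    have cS': "real (card S') = k * M ^ \<Delta>" unfolding card_S' full M_def by simp
    have "X / k * (bias * M ^ \<Delta> * Y) + bias * M ^ \<Delta> * P =
        k * M ^ \<Delta> * (X * bias * Y / (real k)\<^sup>2 + bias * P / k)" for X Y
      using kp by (simp add: field_simps power2_eq_square)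
    then show ?thesis unfolding cS' .
  qed
  finally have "avg S' (\<lambda>\<sigma>. (post' \<sigma> s)\<^sup>2) \<le> exp (T + load) * bias * exp (\<Delta> * (2 * e - 2 / k)) / (real k)\<^sup>2 + bias * P / k"
    using finite_S' S'_nonempty by (simp add: avg_def card_gt_0_iff pos_divide_le_eq mult.commute)
  also have "exp (T + load) * bias * exp (\<Delta> * (2 * e - 2 / k)) \<le> exp (T + load) * exp (\<Delta> / (real k - 1)) * exp (\<Delta> * (2 * e - 2 / k))"
    using bias_le by (intro mult_right_mono mult_left_mono) auto
  also have "\<dots> = exp (T + \<Delta> / (real k * (real k - 1)) + 2 * \<Delta> * e)"
  proof -
    \<comment> \<open>The exponent in the bound on \<open>bias\<close> is \<Delta>/(k - 1) rather
      than \<open>load\<close>; this is the size of the discrepancy.\<close>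
    have "1 / (real k - 1) - 1 / real k = 1 / (real k * (real k - 1))" using k by (simp add: field_simps)
    then have "\<Delta> * (1 / (real k - 1) - 1 / real k) = \<Delta> * (1 / (real k * (real k - 1)))" by simp
    then have "\<Delta> / (real k - 1) = load + \<Delta> / (real k * (real k - 1))" by (simp add: right_diff_distrib)
    then show ?thesis by (simp add: algebra_simps flip: exp_add)
  qed
  finally show ?thesis by (simp add: T_def divide_right_mono)
qed

text \<open>Three regimes. Deviations up to \<open>\<delta>\<close> are harmless. If many children
  are biased, only the bound \<open>k\<close> is known, to be paid for by the probability
  \<open>P\<close>. Otherwise the deviation is at most \<open>U\<close>, and exceeding
  \<open>\<delta>\<close> forces \<open>sumpost\<close> below its mean by
  \<open>\<delta> / 4\<close>, which gains a Chernoff factor with parameter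
  \<open>l\<close>.\<close>

lemma tail_le:
  fixes \<beta> \<delta> l e P U :: real
  assumes s: "s \<in> D" and \<beta>: "0 < \<beta>" "\<beta> \<le> 1 / 4" "1 \<le> \<beta> * k"
    and e: "avg S (\<lambda>x. (post x s)\<^sup>2) \<le> e"
    and P: "bias * avg families (\<lambda>\<tau>. of_bool (\<beta>\<^sup>2 * k < nbad \<beta> \<tau>)) \<le> P"
    and \<delta>: "0 < \<delta>" "\<delta> \<le> 1" "10 * \<beta> * (1 + load) \<le> \<delta> / 4" and l: "0 \<le> l"
    and U: "U = exp (10 * \<beta> * (1 + load) + load)"
    and \<phi>: "\<And>\<sigma>. \<phi> \<sigma> = card D * post' \<sigma> s - 1"
  shows "avg S' (\<lambda>\<sigma>. max 0 (\<phi> \<sigma>) * exp (41 * max 0 (\<phi> \<sigma>))) \<le>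
    \<delta> * exp (41 * \<delta>) + bias * (U * exp (41 * U) * exp (\<Delta> * (l\<^sup>2 * e / 2) - l * \<delta> / 4)) + k * exp (41 * k) * P"
proof -
  let ?h = "\<lambda>z::real. z * exp (41 * z)"
  have h_mono: "?h a \<le> ?h b" if "0 \<le> a" "a \<le> b" for a b
    using that by (intro mult_mono) auto
  define F where "F \<tau> = U * exp (41 * U) * exp (- l * \<delta> / 4) * exp (l * (load - sumpost \<tau> s))
      + k * exp (41 * k) * of_bool (\<beta>\<^sup>2 * k < nbad \<beta> \<tau>)" for \<tau>
  have U0: "U > 0" by (simp add: U)
  have F0: "0 \<le> F \<tau>" for \<tau> unfolding F_def using U0 by (intro add_nonneg_nonneg mult_nonneg_nonneg) auto
  have pw: "?h (max 0 (\<phi> \<sigma>)) \<le> \<delta> * exp (41 * \<delta>) + F (kids \<sigma>)" if \<sigma>: "\<sigma> \<in> S'" for \<sigma>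
  proof (cases "\<phi> \<sigma> \<le> \<delta>")
    case True
    then have "?h (max 0 (\<phi> \<sigma>)) \<le> ?h \<delta>" using \<delta> by (intro h_mono) auto
    then show ?thesis using F0[of "kids \<sigma>"] by simp
  next
    case False
    then have big: "max 0 (\<phi> \<sigma>) = \<phi> \<sigma>" "0 \<le> \<phi> \<sigma>" "\<delta> < \<phi> \<sigma>" using \<delta> by auto
    have d0: "0 \<le> \<delta> * exp (41 * \<delta>)" using \<delta> by simp
    show ?thesis
    proof (cases "\<beta>\<^sup>2 * k < nbad \<beta> (kids \<sigma>)")
      case True
      have "card D * post' \<sigma> s \<le> real k * 1"
        using cardD post'_nonneg post'_le_1[OF \<sigma>] by (intro mult_mono) auto
      then have "\<phi> \<sigma> \<le> k" by (simp add: \<phi>)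
      then have "?h (\<phi> \<sigma>) \<le> ?h k" using big by (intro h_mono) auto
      also have "\<dots> \<le> F (kids \<sigma>)" using True U0 by (simp add: F_def)
      finally show ?thesis using big d0 by simp
    next
      case False
      define G where "G = load - sumpost (kids \<sigma>) s"
      have le: "1 + \<phi> \<sigma> \<le> exp (10 * \<beta> * (1 + load) + G)"
        using post'_le_exp[OF \<sigma> s \<beta>] False by (simp add: \<phi> G_def algebra_simps)
      have "G \<le> load" by (simp add: G_def sumpost_def sum_nonneg post_nonneg)
      then have "exp (10 * \<beta> * (1 + load) + G) \<le> U" by (simp add: U)
      then have "\<phi> \<sigma> \<le> U" using le by linarith
      then have 1: "?h (\<phi> \<sigma>) \<le> ?h U" using big by (intro h_mono) auto
      \<comment> \<open>A deviation above \<open>\<delta>\<close> makes the exponent larger than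
        \<open>\<delta> / 2\<close>; the error term takes at most \<open>\<delta> / 4\<close> of it,
        and the rest must come from \<open>G\<close>.\<close>
      have "exp (\<delta> / 2) \<le> 1 + \<delta>"
      proof -
        have "exp (\<delta> / 2) \<le> 1 + \<delta> / 2 + (\<delta> / 2)\<^sup>2"
          using \<delta> by (intro exp_bound) auto
        also have "(\<delta> / 2)\<^sup>2 \<le> \<delta> / 2" using \<delta> by (simp add: power2_eq_square field_simps)
        finally show ?thesis by simp
      qed
      then have "exp (\<delta> / 2) < exp (10 * \<beta> * (1 + load) + G)" using le big by linarith
      then have "\<delta> / 4 \<le> G" using \<delta> by simp
      then have "l * (\<delta> / 4) \<le> l * G" using l by (intro mult_left_mono) auto
      then have "1 \<le> exp (l * G - l * (\<delta> / 4))" by simp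
      then have "?h U * 1 \<le> ?h U * exp (l * G - l * (\<delta> / 4))" using U0 by (intro mult_left_mono) auto
      also have "\<dots> = ?h U * (exp (- l * \<delta> / 4) * exp (l * G))" by (simp flip: exp_add)
      also have "\<dots> = F (kids \<sigma>)" using False by (simp add: F_def G_def)
      finally show ?thesis using 1 big d0 by simp
    qed
  qed
  have "avg S' (\<lambda>\<sigma>. ?h (max 0 (\<phi> \<sigma>))) \<le> avg S' (\<lambda>\<sigma>. \<delta> * exp (41 * \<delta>) + F (kids \<sigma>))"
    using pw by (rule avg_mono)
  also have "\<dots> = \<delta> * exp (41 * \<delta>) + avg S' (\<lambda>\<sigma>. F (kids \<sigma>))"
    unfolding avg_add using finite_S' S'_nonempty by (simp add: avg_const)
  also have "avg S' (\<lambda>\<sigma>. F (kids \<sigma>)) \<le> bias * avg families F"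
    using F0 by (intro avg_kids_le) auto
  also have "avg families F = U * exp (41 * U) * exp (- l * \<delta> / 4) * avg families (\<lambda>\<tau>. exp (l * (load - sumpost \<tau> s)))
      + k * exp (41 * k) * avg families (\<lambda>\<tau>. of_bool (\<beta>\<^sup>2 * k < nbad \<beta> \<tau>))"
    unfolding F_def[abs_def] avg_add avg_cmult ..
  also have "bias * \<dots> = bias * (U * exp (41 * U) * exp (- l * \<delta> / 4) * avg families (\<lambda>\<tau>. exp (l * (load - sumpost \<tau> s))))
      + k * exp (41 * k) * (bias * avg families (\<lambda>\<tau>. of_bool (\<beta>\<^sup>2 * k < nbad \<beta> \<tau>)))"
    by (simp add: algebra_simps)
  also have "\<dots> \<le> bias * (U * exp (41 * U) * exp (- l * \<delta> / 4) * exp (\<Delta> * (l\<^sup>2 * e / 2))) + k * exp (41 * k) * P"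
    using avg_exp_sumpost[OF _ e l] s D P bias_pos U0
    by (intro add_mono mult_left_mono) auto
  also have "U * exp (41 * U) * exp (- l * \<delta> / 4) * exp (\<Delta> * (l\<^sup>2 * e / 2)) =
      U * exp (41 * U) * exp (\<Delta> * (l\<^sup>2 * e / 2) - l * \<delta> / 4)"
  proof -
    have "exp (\<Delta> * (l\<^sup>2 * e / 2) - l * \<delta> / 4) = exp (- l * \<delta> / 4) * exp (\<Delta> * (l\<^sup>2 * e / 2))"
      by (simp flip: exp_add)
    then show ?thesis by simp
  qed
  finally show ?thesis by simp
qed


text \<open>
  If the children's colors are fully revealed, the posterior is uniform on the colors missing among
  the children, so the statement is a second-moment bound for the coupon collector.
\<close>

lemma revealed_bad'_le:
  fixes \<beta> \<mu> :: real
  assumes full: "D = {1..k}" and rev: "\<And>x q. x \<in> S \<Longrightarrow> post x q = of_bool (c x = q)"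
    and \<mu>: "\<mu> = (real k - 1) * ((real k - 2) / (real k - 1)) ^ \<Delta>"
    and \<beta>: "0 < \<beta>" "1 / \<beta> \<le> \<mu> / 2"
  shows "avg S' (\<lambda>\<sigma>. of_bool (bad' \<beta> \<sigma>)) \<le> 4 / \<mu>"
proof -
  define M where "M = (1 - 1 / k) * card S"
  define \<rho> where "\<rho> = (real k - 2) / (real k - 1)"
  have M: "M > 0" using base_pos by (simp add: M_def)
  have \<rho>: "\<rho> > 0" using k by (simp add: \<rho>_def)
  have kp: "real k > 3" using k by simp
  have \<mu>0: "\<mu> > 0" using \<rho> kp by (simp add: \<mu> \<rho>_def[symmetric])
  \<comment> \<open>The common number of child states of each color, that is card S / k.\<close>
  define X where "X = M / (real k - 1)"
  have X: "M * (z / (real k - 1)) = z * X" for z by (simp add: X_def)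
  have cS: "card S = real k * X"
  proof -
    have "real k * M = (real k - 1) * card S" using kp by (simp add: M_def left_diff_distrib right_diff_distrib)
    then show ?thesis using kp by (simp add: X_def field_simps)
  qed
  have card1: "card {x\<in>S. c x = q} = card S / k" if "q \<in> {1..k}" for q
  proof -
    have "real k * card {x\<in>S. c x = q} = card S" using unif[OF that] by (metis of_nat_mult)
    then show ?thesis using kp by (simp add: field_simps)
  qed
  have avoid: "real (card {x\<in>S. c x \<notin> Q}) = card S - card Q * (card S / k)" if "Q \<subseteq> {1..k}" for Q
  proof -
    have "finite Q" using that finite_subset by blast
    have "real (card {x\<in>S. c x \<in> Q}) = (\<Sum>q\<in>Q. real (card {x\<in>S. c x = q}))"
    proof -
      have "{x\<in>S. c x \<in> Q} = (\<Union>q\<in>Q. {x\<in>S. c x = q})" by blast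
      then have "card {x\<in>S. c x \<in> Q} = (\<Sum>q\<in>Q. card {x\<in>S. c x = q})"
        using \<open>finite Q\<close> S by (simp add: card_UN_disjoint disjoint_iff)
      then show ?thesis by simp
    qed
    also have "\<dots> = card Q * (card S / k)" using that card1 by (simp add: subset_iff)
    finally show ?thesis using card_Collect_split[OF S(1), of "\<lambda>x. c x \<in> Q"] by linarith
  qed
  have lik01: "lik \<tau> q = (\<Prod>i<\<Delta>. of_bool (c (\<tau> i) \<noteq> q))" if "\<tau> \<in> families" for \<tau> q
    unfolding lik_def using that rev by (intro prod.cong) (auto simp: PiE_iff)
  have sum_lik: "(\<Sum>\<tau>\<in>families_avoiding s. \<Prod>i<\<Delta>. of_bool (c (\<tau> i) \<notin> Q)) = (card S - (1 + card Q) * (card S / k)) ^ \<Delta>"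
    if "s \<in> {1..k}" "Q \<subseteq> {1..k} - {s}" for s Q
  proof -
    have "finite Q" using that finite_subset by blast
    have "(\<Sum>x\<in>{x\<in>S. c x \<noteq> s}. of_bool (c x \<notin> Q)) = real (card {x\<in>S. c x \<notin> insert s Q})"
      using S by (simp add: Int_def conj_assoc)
    also have "\<dots> = card S - card (insert s Q) * (card S / k)" using that by (intro avoid) auto
    also have "card (insert s Q) = 1 + card Q" using that \<open>finite Q\<close> by (subst card_insert_disjoint) auto
    finally show ?thesis
      using sum_prod_families_avoiding[of "\<lambda>x. of_bool (c x \<notin> Q)" s] by simp
  qed
  \<comment> \<open>With revealed colors \<open>lik\<close> is the indicator that no child has the
    color \<open>q\<close>, so this counts unseen colors. The parent's own color \<open>s\<close> is
    always unseen and therefore left out.\<close>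
  define N where "N \<tau> s = (\<Sum>q\<in>{1..k}-{s}. lik \<tau> q)" for \<tau> s
  have in_fam: "\<tau> \<in> families" if "\<tau> \<in> families_avoiding s" for \<tau> s
    using that by (auto simp: PiE_iff)
  have first: "(\<Sum>\<tau>\<in>families_avoiding s. lik \<tau> q) = M ^ \<Delta> * \<rho> ^ \<Delta>"
    if s: "s \<in> {1..k}" and q: "q \<in> {1..k} - {s}" for s q
  proof -
    have "(\<Sum>\<tau>\<in>families_avoiding s. lik \<tau> q) = (\<Sum>\<tau>\<in>families_avoiding s. \<Prod>i<\<Delta>. of_bool (c (\<tau> i) \<notin> {q}))"
      using in_fam by (intro sum.cong) (auto simp: lik01)
    also have "\<dots> = (card S - (1 + card {q}) * (card S / k)) ^ \<Delta>"
      using s q by (intro sum_lik) auto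
    also have "card S - (1 + card {q}) * (card S / k) = M * \<rho>"
      unfolding cS \<rho>_def X using kp by (simp add: left_diff_distrib)
    finally show ?thesis by (simp add: power_mult_distrib)
  qed
  \<comment> \<open>For two distinct colors the events of being unseen are negatively correlated, by
    (k-3)(k-1) \<le> (k-2)^2. Hence the variance of the count is at most its mean.\<close>
  have second: "(\<Sum>\<tau>\<in>families_avoiding s. lik \<tau> q * lik \<tau> q') \<le> M ^ \<Delta> * (\<rho> ^ \<Delta>)\<^sup>2 + of_bool (q = q') * (M ^ \<Delta> * \<rho> ^ \<Delta>)"
    if s: "s \<in> {1..k}" and q: "q \<in> {1..k} - {s}" "q' \<in> {1..k} - {s}" for s q q'
  proof (cases "q = q'")
    case True
    have "lik \<tau> q * lik \<tau> q = lik \<tau> q" if "\<tau> \<in> families_avoiding s" for \<tau>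
      unfolding lik01[OF in_fam[OF that]] prod.distrib[symmetric] by (intro prod.cong) auto
    then have "(\<Sum>\<tau>\<in>families_avoiding s. lik \<tau> q * lik \<tau> q) = (\<Sum>\<tau>\<in>families_avoiding s. lik \<tau> q)"
      by (rule sum.cong[OF refl])
    then have "(\<Sum>\<tau>\<in>families_avoiding s. lik \<tau> q * lik \<tau> q') = M ^ \<Delta> * \<rho> ^ \<Delta>"
      unfolding True[symmetric] first[OF s q(1)] .
    then show ?thesis using True M \<rho> by simp
  next
    case False
    have "lik \<tau> q * lik \<tau> q' = (\<Prod>i<\<Delta>. of_bool (c (\<tau> i) \<notin> {q, q'}))" if "\<tau> \<in> families_avoiding s" for \<tau>
      unfolding lik01[OF in_fam[OF that]] prod.distrib[symmetric] by (intro prod.cong) auto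
    then have "(\<Sum>\<tau>\<in>families_avoiding s. lik \<tau> q * lik \<tau> q') =
        (\<Sum>\<tau>\<in>families_avoiding s. \<Prod>i<\<Delta>. of_bool (c (\<tau> i) \<notin> {q, q'}))"
      by (rule sum.cong[OF refl])
    also have "\<dots> = (card S - (1 + card {q, q'}) * (card S / k)) ^ \<Delta>"
      using q by (intro sum_lik[OF s]) auto
    also have "card {q, q'} = 2" using False by simp
    also have "card S - real (1 + 2) * (card S / k) = M * ((real k - 3) / (real k - 1))"
      unfolding cS X using kp by (simp add: left_diff_distrib)
    also have "\<dots> ^ \<Delta> \<le> (M * \<rho>\<^sup>2) ^ \<Delta>"
    proof (intro power_mono mult_left_mono)
      have "(real k - 3) * (real k - 1) \<le> (real k - 2)\<^sup>2" by (simp add: power2_eq_square algebra_simps)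
      then have "((real k - 3) * (real k - 1)) / (real k - 1)\<^sup>2 \<le> (real k - 2)\<^sup>2 / (real k - 1)\<^sup>2"
        by (intro divide_right_mono) auto
      then show "(real k - 3) / (real k - 1) \<le> \<rho>\<^sup>2"
        using kp by (simp add: \<rho>_def power_divide power2_eq_square[of "real k - 1"])
    qed (use M kp in auto)
    also have "\<dots> = M ^ \<Delta> * (\<rho> ^ \<Delta>)\<^sup>2"
      by (simp add: power_mult_distrib power_mult[symmetric] mult.commute)
    finally show ?thesis using False by simp
  qed
  have \<mu>': "\<mu> = (real k - 1) * \<rho> ^ \<Delta>" by (simp add: \<mu> \<rho>_def)
  have cardQ: "real (card ({1..k} - {s})) = real k - 1" if "s \<in> {1..k}" for s
    using that kp by (simp add: of_nat_diff)
  have var: "(\<Sum>\<tau>\<in>families_avoiding s. (N \<tau> s - \<mu>)\<^sup>2) \<le> M ^ \<Delta> * \<mu>" if s: "s \<in> {1..k}" for s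
  proof -
    let ?Q = "{1..k} - {s}"
    have "(\<Sum>\<tau>\<in>families_avoiding s. N \<tau> s) = (\<Sum>q\<in>?Q. \<Sum>\<tau>\<in>families_avoiding s. lik \<tau> q)"
      unfolding N_def by (rule sum.swap)
    also have "\<dots> = (\<Sum>q\<in>?Q. M ^ \<Delta> * \<rho> ^ \<Delta>)" using first[OF s] by (intro sum.cong refl)
    also have "\<dots> = M ^ \<Delta> * \<mu>" using cardQ[OF s] by (simp add: \<mu>')
    finally have m1: "(\<Sum>\<tau>\<in>families_avoiding s. N \<tau> s) = M ^ \<Delta> * \<mu>" .
    have "(\<Sum>\<tau>\<in>families_avoiding s. (N \<tau> s)\<^sup>2) = (\<Sum>\<tau>\<in>families_avoiding s. \<Sum>q\<in>?Q. \<Sum>q'\<in>?Q. lik \<tau> q * lik \<tau> q')"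
      by (simp add: N_def power2_eq_square sum_product)
    also have "\<dots> = (\<Sum>q\<in>?Q. \<Sum>\<tau>\<in>families_avoiding s. \<Sum>q'\<in>?Q. lik \<tau> q * lik \<tau> q')"
      by (rule sum.swap)
    also have "\<dots> = (\<Sum>q\<in>?Q. \<Sum>q'\<in>?Q. \<Sum>\<tau>\<in>families_avoiding s. lik \<tau> q * lik \<tau> q')"
      by (intro sum.cong refl sum.swap)
    also have "\<dots> \<le> (\<Sum>q\<in>?Q. \<Sum>q'\<in>?Q. M ^ \<Delta> * (\<rho> ^ \<Delta>)\<^sup>2 + of_bool (q = q') * (M ^ \<Delta> * \<rho> ^ \<Delta>))"
      by (intro sum_mono second[OF s])
    also have "\<dots> = (\<Sum>q\<in>?Q. (real k - 1) * (M ^ \<Delta> * (\<rho> ^ \<Delta>)\<^sup>2) + M ^ \<Delta> * \<rho> ^ \<Delta>)"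
    proof (rule sum.cong[OF refl])
      fix q assume q: "q \<in> ?Q"
      have "(\<Sum>q'\<in>?Q. of_bool (q = q') * (M ^ \<Delta> * \<rho> ^ \<Delta>)) = M ^ \<Delta> * \<rho> ^ \<Delta>"
        using q by (simp add: of_bool_def if_distrib[of "\<lambda>z. z * _"] sum.delta' cong: if_cong)
      then show "(\<Sum>q'\<in>?Q. M ^ \<Delta> * (\<rho> ^ \<Delta>)\<^sup>2 + of_bool (q = q') * (M ^ \<Delta> * \<rho> ^ \<Delta>)) =
        (real k - 1) * (M ^ \<Delta> * (\<rho> ^ \<Delta>)\<^sup>2) + M ^ \<Delta> * \<rho> ^ \<Delta>"
        unfolding sum.distrib using cardQ[OF s] by simp
    qed
    also have "\<dots> = M ^ \<Delta> * (\<mu>\<^sup>2 + \<mu>)"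
      unfolding sum_constant cardQ[OF s] by (simp add: \<mu>' power2_eq_square algebra_simps)
    finally have m2: "(\<Sum>\<tau>\<in>families_avoiding s. (N \<tau> s)\<^sup>2) \<le> M ^ \<Delta> * (\<mu>\<^sup>2 + \<mu>)" .
    have "(\<Sum>\<tau>\<in>families_avoiding s. (N \<tau> s - \<mu>)\<^sup>2) =
        (\<Sum>\<tau>\<in>families_avoiding s. (N \<tau> s)\<^sup>2 - 2 * \<mu> * N \<tau> s + \<mu>\<^sup>2)"
      by (simp add: power2_diff algebra_simps)
    also have "\<dots> = (\<Sum>\<tau>\<in>families_avoiding s. (N \<tau> s)\<^sup>2) - 2 * \<mu> * (M ^ \<Delta> * \<mu>) + M ^ \<Delta> * \<mu>\<^sup>2"
      unfolding sum.distrib sum_subtractf m1[symmetric] sum_distrib_left[symmetric]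
      using card_families_avoiding[OF s] by (simp add: M_def)
    also have "\<dots> \<le> M ^ \<Delta> * (\<mu>\<^sup>2 + \<mu>) - 2 * \<mu> * (M ^ \<Delta> * \<mu>) + M ^ \<Delta> * \<mu>\<^sup>2"
      using m2 by simp
    also have "\<dots> = M ^ \<Delta> * \<mu>" by (simp add: algebra_simps power2_eq_square)
    finally show ?thesis .
  qed
  \<comment> \<open>Unseen colors share the posterior equally, so a weight above \<beta> leaves at
    most 1/\<beta> \<le> \<mu>/2 of them. The count then deviates from its mean \<mu> by at least
    \<mu>/2, and Chebyshev's inequality applies.\<close>
  have markov: "of_bool (bad' \<beta> \<sigma>) \<le> 4 / \<mu>\<^sup>2 * (N (kids \<sigma>) s - \<mu>)\<^sup>2" if \<sigma>: "\<sigma> \<in> S'" for \<sigma> s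
  proof (cases "bad' \<beta> \<sigma>")
    case True
    then obtain q where q: "q \<in> D" "\<beta> < post' \<sigma> q" using full by (auto simp: bad'_def)
    have fam: "kids \<sigma> \<in> families" by (rule kids_in[OF \<sigma>])
    let ?L = "\<Sum>q\<in>D. lik (kids \<sigma>) q"
    have "\<beta> * ?L \<le> post' \<sigma> q * ?L"
      using q post'_eq(2)[OF \<sigma> q(1)] by (intro mult_right_mono) auto
    also have "\<dots> = lik (kids \<sigma>) q" by (rule post'_eq[OF \<sigma> q(1)])
    also have "\<dots> \<le> 1" by (rule lik_le_1[OF fam])
    finally have "?L \<le> 1 / \<beta>" using \<beta> by (simp add: field_simps)
    moreover have "N (kids \<sigma>) s \<le> ?L"
      unfolding N_def full using lik_nonneg[OF fam] by (intro sum_mono2) auto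
    ultimately have "\<mu> / 2 \<le> \<mu> - N (kids \<sigma>) s" using \<beta> by linarith
    then have "(\<mu> / 2)\<^sup>2 \<le> (\<mu> - N (kids \<sigma>) s)\<^sup>2" using \<mu>0 by (intro power_mono) auto
    then show ?thesis using True \<mu>0 by (simp add: power2_commute field_simps power2_eq_square)
  qed simp
  have "(\<Sum>\<sigma>\<in>S'. of_bool (bad' \<beta> \<sigma>)) = (\<Sum>s\<in>D. \<Sum>\<sigma>\<in>{\<sigma>\<in>S'. r \<sigma> = s}. of_bool (bad' \<beta> \<sigma>))"
    by (rule sum_roots)
  also have "\<dots> \<le> (\<Sum>s\<in>D. \<Sum>\<sigma>\<in>{\<sigma>\<in>S'. r \<sigma> = s}. 4 / \<mu>\<^sup>2 * (N (kids \<sigma>) s - \<mu>)\<^sup>2)"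
    using markov by (intro sum_mono) auto
  also have "\<dots> = (\<Sum>s\<in>D. \<Sum>\<tau>\<in>families_avoiding s. 4 / \<mu>\<^sup>2 * (N \<tau> s - \<mu>)\<^sup>2)"
    by (intro sum.cong refl sum_kids_root)
  also have "\<dots> \<le> (\<Sum>s\<in>D. 4 / \<mu>\<^sup>2 * (M ^ \<Delta> * \<mu>))"
  proof (rule sum_mono)
    fix s assume "s \<in> D"
    then show "(\<Sum>\<tau>\<in>families_avoiding s. 4 / \<mu>\<^sup>2 * (N \<tau> s - \<mu>)\<^sup>2) \<le> 4 / \<mu>\<^sup>2 * (M ^ \<Delta> * \<mu>)"
      unfolding sum_distrib_left[symmetric] using var[of s] full by (intro mult_left_mono) auto
  qed
  also have "\<dots> = card S' * (4 / \<mu>)"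
    unfolding card_S' using \<mu>0 by (simp add: M_def power2_eq_square)
  finally have "(\<Sum>\<sigma>\<in>S'. of_bool (bad' \<beta> \<sigma>)) \<le> card S' * (4 / \<mu>)" .
  moreover have "card S' > 0" using finite_S' S'_nonempty by (simp add: card_gt_0_iff)
  ultimately show ?thesis unfolding avg_def by (simp add: divide_le_eq mult.commute)
qed

end

section \<open>Four steps of the recursion\<close>

text \<open>\<open>post\<close> and \<open>post'\<close> belong to one instance of the locale. This
  common form lets the parent system of one step serve as the child system of the next.\<close>

definition posterior :: "'a set \<Rightarrow> ('a \<Rightarrow> 'o) \<Rightarrow> ('a \<Rightarrow> nat) \<Rightarrow> 'a \<Rightarrow> nat \<Rightarrow> real" where
  "posterior S \<kappa> c x s = cexp S \<kappa> (\<lambda>y. of_bool (c y = s)) x"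

definition biased :: "nat \<Rightarrow> real \<Rightarrow> 'a set \<Rightarrow> ('a \<Rightarrow> 'o) \<Rightarrow> ('a \<Rightarrow> nat) \<Rightarrow> 'a \<Rightarrow> bool" where
  "biased k \<beta> S \<kappa> c x \<longleftrightarrow> (\<exists>q\<in>{1..k}. \<beta> < posterior S \<kappa> c x q)"

text \<open>
  A vertex is biased only if more than \<open>b = \<beta>\<^sup>2 k\<close> of its children are, and \<open>\<mu>\<close> is the expected number of
  colors, other than its own, that a vertex does not see among its children.
\<close>

definition admissible :: "nat \<Rightarrow> nat \<Rightarrow> real \<Rightarrow> bool" where
  "admissible k \<Delta> \<beta> \<longleftrightarrow>
     (let y = real \<Delta> / real k; b = \<beta>\<^sup>2 * k; T = 10 * \<beta> * (1 + y); A = exp (\<Delta> / (real k - 1));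
          \<mu> = (real k - 1) * ((real k - 2) / (real k - 1)) ^ \<Delta>; U = exp (T + y)
      in 4 \<le> k \<and> 0 < \<beta> \<and> \<beta> \<le> 1 / 4 \<and> 1 \<le> \<beta> * k \<and> U \<le> \<beta> * k \<and> 1 / \<beta> \<le> \<mu> / 2 \<and>
         A * exp (\<Delta> * (4 / \<mu> * exp 1) - b) \<le> exp (- b / 2) \<and>
         A * exp (\<Delta> * (exp (- b / 2) * exp (b / 4)) - b / 4 * b) \<le> exp (- 43 * real k) \<and>
         exp (T + \<Delta> / (real k * (real k - 1)) + 2 * \<Delta> * (\<beta> / k + exp (- b / 2))) + k * exp (- 43 * real k) \<le> 2 \<and>
         (\<exists>\<delta> l. 0 < \<delta> \<and> \<delta> \<le> 1 \<and> T \<le> \<delta> / 4 \<and> 0 \<le> l \<and>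
            \<delta> * exp (41 * \<delta>) + A * (U * exp (41 * U) * exp (\<Delta> * (l\<^sup>2 * (2 / (real k)\<^sup>2) / 2) - l * \<delta> / 4))
              + k * exp (41 * k) * exp (- 43 * real k) \<le> 1 / (20 * (1 + exp 40))))"

context branching
begin

lemma post_posterior: "post = posterior S \<kappa> c" "post' = posterior S' \<kappa>' r"
  by (intro ext, simp add: post_def post'_def posterior_def)+

lemma bad_biased: "bad \<beta> = biased k \<beta> S \<kappa> c" "bad' \<beta> = biased k \<beta> S' \<kappa>' r"
  by (intro ext, simp add: bad_def bad'_def biased_def post_posterior)+

lemma avg_nbad_bias_le:
  fixes t p b \<beta> :: real
  assumes t: "0 \<le> t" and p: "avg S (\<lambda>x. of_bool (biased k \<beta> S \<kappa> c x)) \<le> p"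
    and q: "exp (\<Delta> / (real k - 1)) * exp (\<Delta> * (p * exp t) - t * b) \<le> q"
  shows "bias * avg families (\<lambda>\<tau>. of_bool (b < real (nbad \<beta> \<tau>))) \<le> q"
proof -
  have "bias * avg families (\<lambda>\<tau>. of_bool (b < real (nbad \<beta> \<tau>))) \<le>
      exp (\<Delta> / (real k - 1)) * exp (\<Delta> * (p * exp t) - t * b)"
    using bias_le bias_pos avg_nbad_le[OF t, of \<beta> p b] p
    by (intro mult_mono avg_nonneg) (auto simp: bad_biased)
  then show ?thesis using q by linarith
qed

lemma avg_biased_le:
  fixes t p \<beta> :: real
  assumes full: "D = {1..k}" and \<beta>: "0 < \<beta>" "\<beta> \<le> 1 / 4" "1 \<le> \<beta> * k"
    and good: "exp (10 * \<beta> * (1 + load) + load) \<le> \<beta> * k"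
    and t: "0 \<le> t" and p: "avg S (\<lambda>x. of_bool (biased k \<beta> S \<kappa> c x)) \<le> p"
    and q: "exp (\<Delta> / (real k - 1)) * exp (\<Delta> * (p * exp t) - t * (\<beta>\<^sup>2 * k)) \<le> q"
  shows "avg S' (\<lambda>x. of_bool (biased k \<beta> S' \<kappa>' r x)) \<le> q"
  using avg_bad'_le[OF full \<beta> good] avg_nbad_bias_le[OF t p q] by (simp add: bad_biased)

text \<open>On an unbiased state the square of the posterior weight p is at most \<beta> p, and p
  has mean 1/k. This starts the second-moment recursion.\<close>

lemma second_moment_crude:
  fixes \<beta> p :: real
  assumes s: "s \<in> {1..k}" and \<beta>: "0 < \<beta>" and p: "avg S (\<lambda>x. of_bool (biased k \<beta> S \<kappa> c x)) \<le> p"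
  shows "avg S (\<lambda>x. (post x s)\<^sup>2) \<le> \<beta> / k + p"
proof -
  have "avg S (\<lambda>x. (post x s)\<^sup>2) \<le> avg S (\<lambda>x. \<beta> * post x s + of_bool (bad \<beta> x))"
  proof (rule avg_mono)
    fix x assume x: "x \<in> S"
    show "(post x s)\<^sup>2 \<le> \<beta> * post x s + of_bool (bad \<beta> x)"
    proof (cases "bad \<beta> x")
      case True
      have "(post x s)\<^sup>2 \<le> 1" using post_le_1[OF x] post_nonneg by (simp add: power_le_one)
      moreover have "0 \<le> \<beta> * post x s" using \<beta> post_nonneg by simp
      ultimately show ?thesis using True by simp
    next
      case False
      then have "post x s \<le> \<beta>" using s by (force simp: bad_def)
      then show ?thesis using False post_nonneg by (simp add: power2_eq_square mult_right_mono)
    qed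
  qed
  also have "\<dots> = \<beta> * (1 / k) + avg S (\<lambda>x. of_bool (bad \<beta> x))"
    unfolding avg_add avg_cmult using avg_post[OF s] by simp
  also have "\<dots> \<le> \<beta> / k + p" using p by (simp add: bad_biased)
  finally show ?thesis .
qed

end

text \<open>The system \<open>S0\<close> has its colors revealed, and each later observation is the
  collection of the children's observations. Only the last root may have a forbidden color, since
  only it can have a parent outside the subtree under consideration; hence \<open>D\<close> enters
  in the fourth step alone.\<close>

lemma four_step_tail:
  fixes \<beta> :: real
  assumes adm: "admissible k \<Delta> \<beta>"
    and B1: "branching k \<Delta> {1..k} S0 c0 \<kappa>0 S1 c1 sub1 \<kappa>1"
    and B2: "branching k \<Delta> {1..k} S1 c1 \<kappa>1 S2 c2 sub2 \<kappa>2"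
    and B3: "branching k \<Delta> {1..k} S2 c2 \<kappa>2 S3 c3 sub3 \<kappa>3"
    and B4: "branching k \<Delta> D S3 c3 \<kappa>3 S4 c4 sub4 \<kappa>4"
    and rev: "\<And>x q. x \<in> S0 \<Longrightarrow> posterior S0 \<kappa>0 c0 x q = of_bool (c0 x = q)"
    and s: "s \<in> D" and \<phi>: "\<And>\<sigma>. \<phi> \<sigma> = card D * posterior S4 \<kappa>4 c4 \<sigma> s - 1"
  shows "avg S4 (\<lambda>\<sigma>. max 0 (\<phi> \<sigma>) * exp (41 * max 0 (\<phi> \<sigma>))) \<le> 1 / (20 * (1 + exp 40))"
proof -
  interpret B1: branching k \<Delta> "{1..k}" S0 c0 \<kappa>0 S1 c1 sub1 \<kappa>1 by (rule B1)
  interpret B2: branching k \<Delta> "{1..k}" S1 c1 \<kappa>1 S2 c2 sub2 \<kappa>2 by (rule B2)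
  interpret B3: branching k \<Delta> "{1..k}" S2 c2 \<kappa>2 S3 c3 sub3 \<kappa>3 by (rule B3)
  interpret B4: branching k \<Delta> D S3 c3 \<kappa>3 S4 c4 sub4 \<kappa>4 by (rule B4)
  define y where "y = real \<Delta> / real k"
  define b where "b = \<beta>\<^sup>2 * k"
  define T where "T = 10 * \<beta> * (1 + y)"
  define A where "A = exp (\<Delta> / (real k - 1))"
  define \<mu> where "\<mu> = (real k - 1) * ((real k - 2) / (real k - 1)) ^ \<Delta>"
  define U where "U = exp (T + y)"
  from adm obtain \<delta> l where
    k: "4 \<le> k" and \<beta>: "0 < \<beta>" "\<beta> \<le> 1 / 4" "1 \<le> \<beta> * k" and good: "U \<le> \<beta> * k"
    and \<mu>: "1 / \<beta> \<le> \<mu> / 2"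
    and n4: "A * exp (\<Delta> * (4 / \<mu> * exp 1) - b) \<le> exp (- b / 2)"
    and n5: "A * exp (\<Delta> * (exp (- b / 2) * exp (b / 4)) - b / 4 * b) \<le> exp (- 43 * real k)"
    and n6: "exp (T + \<Delta> / (real k * (real k - 1)) + 2 * \<Delta> * (\<beta> / k + exp (- b / 2))) + k * exp (- 43 * real k) \<le> 2"
    and \<delta>: "0 < \<delta>" "\<delta> \<le> 1" "T \<le> \<delta> / 4" and l: "0 \<le> l"
    and n7: "\<delta> * exp (41 * \<delta>) + A * (U * exp (41 * U) * exp (\<Delta> * (l\<^sup>2 * (2 / (real k)\<^sup>2) / 2) - l * \<delta> / 4))
      + k * exp (41 * k) * exp (- 43 * real k) \<le> 1 / (20 * (1 + exp 40))"
    unfolding admissible_def Let_def y_def b_def T_def A_def \<mu>_def U_def by auto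
  have kp: "real k > 0" using k by simp
  have good': "exp (10 * \<beta> * (1 + real \<Delta> / real k) + real \<Delta> / real k) \<le> \<beta> * k"
    using good by (simp add: U_def T_def y_def)
  have b0: "0 \<le> b" by (simp add: b_def)
  have h1: "avg S1 (\<lambda>x. of_bool (biased k \<beta> S1 \<kappa>1 c1 x)) \<le> 4 / \<mu>"
    using B1.revealed_bad'_le[OF refl _ \<mu>_def \<beta>(1) \<mu>] rev
    by (simp add: B1.bad_biased B1.post_posterior)
  have h2: "avg S2 (\<lambda>x. of_bool (biased k \<beta> S2 \<kappa>2 c2 x)) \<le> exp (- b / 2)"
    using n4 by (intro B2.avg_biased_le[OF refl \<beta> good' _ h1, of 1]) (auto simp: A_def b_def)
  \<comment> \<open>The probability \<open>exp (- b / 2)\<close> is small enough for the Chernoff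
    parameter b/4, in place of the 1 used one level earlier, and the gain b^2/4 exceeds 43
    k.\<close>
  have h3': "B3.bias * avg B3.families (\<lambda>\<tau>. of_bool (b < real (B3.nbad \<beta> \<tau>))) \<le> exp (- 43 * real k)"
    using n5 b0 by (intro B3.avg_nbad_bias_le[OF _ h2, of "b / 4"]) (auto simp: A_def)
  have h3: "avg S3 (\<lambda>x. of_bool (biased k \<beta> S3 \<kappa>3 c3 x)) \<le> exp (- 43 * real k)"
    using n5 b0 by (intro B3.avg_biased_le[OF refl \<beta> good' _ h2, of "b / 4"]) (auto simp: A_def b_def)
  \<comment> \<open>The bound for \<open>S3\<close> is deliberately weakened to the one for
    \<open>S2\<close>, so that the same numerical condition \<open>n5\<close> covers the next level
    as well.\<close>
  have "\<beta>\<^sup>2 \<le> 1" using \<beta> by (simp add: power_le_one)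
  then have "b \<le> 1 * real k" unfolding b_def by (intro mult_right_mono) auto
  then have "exp (- 43 * real k) \<le> exp (- b / 2)" using kp by simp
  then have h3b: "avg S3 (\<lambda>x. of_bool (biased k \<beta> S3 \<kappa>3 c3 x)) \<le> exp (- b / 2)"
    using h3 by linarith
  have h4: "B4.bias * avg B4.families (\<lambda>\<tau>. of_bool (b < real (B4.nbad \<beta> \<tau>))) \<le> exp (- 43 * real k)"
    using n5 b0 by (intro B4.avg_nbad_bias_le[OF _ h3b, of "b / 4"]) (auto simp: A_def)
  \<comment> \<open>The crude second moment at \<open>S2\<close> enters only through \<Delta> times
    itself in an exponent, where it is negligible; the recursion returns the order 1/k^2 at
    \<open>S3\<close>.\<close>
  have e3: "avg S3 (\<lambda>x. (B4.post x s)\<^sup>2) \<le> 2 / (real k)\<^sup>2"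
  proof -
    have sk: "s \<in> {1..k}" using s B4.D by blast
    define E where "E = exp (T + \<Delta> / (real k * (real k - 1)) + 2 * \<Delta> * (\<beta> / k + exp (- b / 2)))"
    have e2: "avg S2 (\<lambda>x. (B3.post x s)\<^sup>2) \<le> \<beta> / k + exp (- b / 2)"
      by (rule B3.second_moment_crude[OF sk \<beta>(1) h2])
    have "avg S3 (\<lambda>\<sigma>. (B3.post' \<sigma> s)\<^sup>2) \<le> E / (real k)\<^sup>2 +
        B3.bias * avg B3.families (\<lambda>\<tau>. of_bool (b < real (B3.nbad \<beta> \<tau>))) / k"
      using B3.second_moment_le[OF refl sk \<beta> e2 order_refl] by (simp add: E_def T_def y_def b_def)
    also have "\<dots> \<le> E / (real k)\<^sup>2 + exp (- 43 * real k) / k"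
      using h3' kp by (intro add_left_mono divide_right_mono) auto
    also have "\<dots> = (E + k * exp (- 43 * real k)) / (real k)\<^sup>2"
      using kp by (simp add: add_divide_distrib power2_eq_square)
    also have "\<dots> \<le> 2 / (real k)\<^sup>2" using n6 by (intro divide_right_mono) (auto simp: E_def)
    finally show ?thesis by (simp add: B3.post_posterior B4.post_posterior)
  qed
  have "avg S4 (\<lambda>\<sigma>. max 0 (\<phi> \<sigma>) * exp (41 * max 0 (\<phi> \<sigma>))) \<le>
    \<delta> * exp (41 * \<delta>) + B4.bias * (U * exp (41 * U) * exp (\<Delta> * (l\<^sup>2 * (2 / (real k)\<^sup>2) / 2) - l * \<delta> / 4))
      + k * exp (41 * k) * exp (- 43 * real k)"
    using \<delta> h4[unfolded b_def] by (intro B4.tail_le[OF s \<beta> e3 _ _ _ _ l])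
      (auto simp: \<phi> B4.post_posterior U_def T_def y_def)
  also have "\<dots> \<le> \<delta> * exp (41 * \<delta>) + A * (U * exp (41 * U) * exp (\<Delta> * (l\<^sup>2 * (2 / (real k)\<^sup>2) / 2) - l * \<delta> / 4))
      + k * exp (41 * k) * exp (- 43 * real k)"
    unfolding A_def using B4.bias_le by (intro add_mono mult_right_mono order_refl) (auto simp: U_def)
  also note n7
  finally show ?thesis .
qed

section \<open>The regime of many colors\<close>

lemma exp_minus_inverse_le:
  fixes n :: real
  assumes "n > 1"
  shows "exp (- (1 / (n - 1))) \<le> 1 - 1 / n"
proof -
  have "n / (n - 1) = 1 + 1 / (n - 1)" using assms by (simp add: field_simps)
  also have "\<dots> \<le> exp (1 / (n - 1))" by (rule exp_ge_add_one_self)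
  finally have "inverse (exp (1 / (n - 1))) \<le> inverse (n / (n - 1))"
    using assms by (intro le_imp_inverse_le) auto
  then show ?thesis using assms by (simp add: exp_minus field_simps)
qed

text \<open>Since y = \<Delta>/k is at most (1 - 8a) ln \<Delta>, exp(y) is at most \<Delta>^(1-8a),
  while k is at least \<Delta>/ln \<Delta>. With \<beta> = \<Delta>^(-a), U is at most of order
  \<Delta>^(1-8a), b is at least \<Delta>^(1-2a)/ln \<Delta> and \<mu> at least a multiple of
  \<Delta>^(4a). The conditions then compare different powers of \<Delta>, and the margin 8a leaves
  room for every loss.\<close>

lemma admissible_of_large_degree:
  fixes a :: real
  assumes a: "0 < a" "a \<le> 1 / 32"
  shows "\<forall>\<^sub>F \<Delta> in sequentially. \<forall>k::nat.
    real \<Delta> / ln \<Delta> \<le> (1 - 8 * a) * k \<longrightarrow> admissible k \<Delta> (\<Delta> powr (- a))"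
proof -
  define \<eta> :: real where "\<eta> = 1 / (20 * (1 + exp 40))"
  \<comment> \<open>Chosen so that 41 \<delta> \<le> 1 and hence \<delta> exp(41 \<delta>) \<le> 3
    \<delta> = \<eta>/4, one quarter of the allowance \<eta>.\<close>
  define \<delta> where "\<delta> = \<eta> / 12"
  have ex: "(0::real) < 1 + exp 40" by (intro add_pos_pos) auto
  have "(1::real) \<le> 20 * (1 + exp 40)" using exp_gt_zero[of "40::real"] unfolding distrib_left by linarith
  then have \<eta>: "0 < \<eta>" "\<eta> \<le> 1" using ex by (simp_all add: \<eta>_def)
  have \<delta>: "0 < \<delta>" "\<delta> \<le> 1" "41 * \<delta> \<le> 41 / 12" using \<eta> by (simp_all add: \<delta>_def)
  have a': "1 - 2 * a > 0" "1 - 4 * a > 0" "1 - 8 * a > 0" "7 * a > 0" "- a < 0" using a by auto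
  have "\<forall>\<^sub>F x in at_top. exp 1 * ln x \<le> x powr (7 * a)"
    and "\<forall>\<^sub>F x in at_top. x powr (- a) \<le> 1 / 4"
    and "\<forall>\<^sub>F x in at_top. 8 * exp 1 * ln x \<le> x powr (4 * a)"
    and "\<forall>\<^sub>F x in at_top. 2 * ln x + exp 1 * x powr (1 - 4 * a) \<le> x powr (1 - 2 * a) / (2 * ln x)"
    and "\<forall>\<^sub>F x in at_top. ln x \<le> x powr (1 - 2 * a) / (4 * ln x)"
    and "\<forall>\<^sub>F x in at_top. 44 \<le> x powr (1 - 4 * a) / (4 * ln x)"
    and "\<forall>\<^sub>F x in at_top. 10 * x powr (- a) * (1 + ln x) + 2 * ln x / (x / ln x) + 2 * ln x * x powr (- a)
     + 2 * x * exp (- (x powr (1 - 2 * a) / (2 * ln x))) \<le> (1/2::real)"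
    and "\<forall>\<^sub>F x in at_top. 2 * ln x + 126 * x powr (1 - 8 * a) - \<delta>\<^sup>2 / 64 * (x / (ln x)\<^sup>2) \<le> ln (\<eta> / 4)"
    and "\<forall>\<^sub>F x in at_top. 10 * x powr (- a) * (1 + ln x) \<le> \<delta> / 4"
    and "\<forall>\<^sub>F x in at_top. 4 * ln x + 4 \<le> x / ln (x::real)"
    and "\<forall>\<^sub>F x in at_top. 4 / \<eta> \<le> x / ln (x::real)"
    and "\<forall>\<^sub>F x in at_top. 1 \<le> ln (x::real)" and "\<forall>\<^sub>F x in at_top. (0::real) < x"
    using a a' \<delta> \<eta> by real_asymp+
  then have "\<forall>\<^sub>F x in at_top. \<forall>\<Delta> k::nat. x = real \<Delta> \<longrightarrow> x / ln x \<le> (1 - 8 * a) * k \<longrightarrow> admissible k \<Delta> (x powr (- a))"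
  proof eventually_elim
    \<comment> \<open>The asymptotic inequalities involve x = \<Delta> alone. The number of colors
      enters afterwards through \<open>x / ln x \<le> (1 - 8 * a) * k\<close> only, which makes the
      threshold for \<Delta> uniform in \<open>k\<close>.\<close>
    case (elim x)
    note C1 = elim(1) and C2 = elim(2) and C5 = elim(3) and C6 = elim(4) and C7 = elim(5)
      and C9 = elim(6) and C10 = elim(7) and C11 = elim(8) and Cd = elim(9) and C8 = elim(10)
      and C12 = elim(11) and L1 = elim(12) and x0 = elim(13)
    show ?case
    proof (intro allI impI)
      fix \<Delta> k :: nat
      assume x: "x = real \<Delta>" and kx: "x / ln x \<le> (1 - 8 * a) * k"
      define L where "L = ln x"
      define \<beta> where "\<beta> = x powr (- a)"
      define y where "y = real \<Delta> / real k"
      define b where "b = \<beta>\<^sup>2 * k"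
      define T where "T = 10 * \<beta> * (1 + y)"
      define A where "A = exp (\<Delta> / (real k - 1))"
      define \<mu> where "\<mu> = (real k - 1) * ((real k - 2) / (real k - 1)) ^ \<Delta>"
      define U where "U = exp (T + y)"
      have L: "1 \<le> L" using L1 by (simp add: L_def)
      have xL: "4 * L + 4 \<le> x / L" using C8 by (simp add: L_def)
      have "(1 - 8 * a) * k \<le> 1 * real k" using a by (intro mult_right_mono) auto
      then have kL: "x / L \<le> k" using kx by (simp add: L_def)
      have k4: "4 * L + 4 \<le> k" "8 \<le> k" using xL kL L by linarith+
      have k: "real k \<ge> 8" using k4 by linarith
      have kp: "real k > 0" using k by simp
      have yL: "y \<le> (1 - 8 * a) * L"
      proof -
        have "x \<le> (1 - 8 * a) * k * L" using kx L by (simp add: L_def field_simps)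
        then show ?thesis using kp by (simp add: y_def x field_simps)
      qed
      also have "\<dots> \<le> 1 * L" using a L by (intro mult_right_mono) auto
      finally have yL1: "y \<le> L" by simp
      have y0: "0 \<le> y" by (simp add: y_def)
      have ey: "exp y \<le> x powr (1 - 8 * a)"
        using yL x0 by (simp add: powr_def L_def)
      have \<beta>0: "0 < \<beta>" using x0 by (simp add: \<beta>_def)
      have \<beta>4: "\<beta> \<le> 1 / 4" using C2 by (simp add: \<beta>_def)
      have T0: "0 \<le> T" using \<beta>0 y0 by (simp add: T_def)
      have TL: "T \<le> 10 * \<beta> * (1 + L)" using yL1 \<beta>0 by (simp add: T_def)
      also have Td: "\<dots> \<le> \<delta> / 4" using Cd by (simp add: \<beta>_def L_def)
      finally have T\<delta>: "T \<le> \<delta> / 4" .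
      then have T1: "T \<le> 1" using \<delta> by linarith
      have eU: "U \<le> exp 1 * x powr (1 - 8 * a)"
        unfolding U_def exp_add using T1 ey by (intro mult_mono) auto
      have pw: "x powr u * x powr v = x powr (u + v)" for u v by (simp add: powr_add)
      have xp: "x powr u * x = x powr (u + 1)" "x * x powr u = x powr (u + 1)" for u
        using x0 by (simp_all add: powr_add)
      have good: "U \<le> \<beta> * k"
      proof -
        have "exp 1 * L * x powr (1 - 8 * a) \<le> x powr (7 * a) * x powr (1 - 8 * a)"
          using C1 by (intro mult_right_mono) (auto simp: L_def)
        also have "\<dots> = \<beta> * x" unfolding \<beta>_def xp pw by simp
        finally have "exp 1 * x powr (1 - 8 * a) \<le> \<beta> * (x / L)" using L by (simp add: field_simps)
        also have "\<dots> \<le> \<beta> * k" using kL \<beta>0 by (intro mult_left_mono) auto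
        finally show ?thesis using eU by linarith
      qed
      have "1 \<le> U" using T0 y0 by (simp add: U_def)
      then have \<beta>k: "1 \<le> \<beta> * k" using good by linarith
      have Dk: "\<Delta> / (real k - 1) \<le> 2 * y"
      proof -
        have "\<Delta> / (real k - 1) \<le> \<Delta> / (real k / 2)" using k by (intro divide_left_mono) auto
        also have "\<dots> = 2 * y" by (simp add: y_def)
        finally show ?thesis .
      qed
      then have AL: "A \<le> exp (2 * L)" using yL1 by (simp add: A_def)
      \<comment> \<open>The power in \<mu> is at least exp(-\<Delta>/(k-2)) \<ge> exp(-(y+1)), so
        \<mu> is at least a constant times k exp(-y), and the latter is at least \<Delta>^(8a)/ln
        \<Delta>. Half of the exponent is given up to the logarithm and the constants.\<close>
      have \<mu>ge: "2 * x powr (4 * a) \<le> \<mu> / 2"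
      proof -
        have n: "real k - 1 > 1" using k by simp
        have "\<Delta> * (1 / (real k - 2)) \<le> y + 1"
        proof -
          have "1 / (real k - 2) = 1 / k + 2 / (k * (real k - 2))" using k by (simp add: field_simps)
          also have "2 / (k * (real k - 2)) \<le> 2 / (k * (real k / 2))"
            using k by (intro divide_left_mono mult_left_mono) auto
          finally have "1 / (real k - 2) \<le> 1 / k + 4 / (k * real k)" by simp
          then have "\<Delta> * (1 / (real k - 2)) \<le> \<Delta> * (1 / k + 4 / (k * real k))" by (intro mult_left_mono) auto
          also have "\<dots> = y + 4 * y / k" by (simp add: y_def field_simps)
          also have "4 * y / k \<le> 1" using yL1 k4 kp by (simp add: field_simps)
          finally show ?thesis by simp
        qed
        then have "exp (- (y + 1)) \<le> exp (\<Delta> * (- (1 / (real k - 1 - 1))))" by simp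
        also have "\<dots> = exp (- (1 / (real k - 1 - 1))) ^ \<Delta>" by (rule exp_of_nat_mult)
        also have "\<dots> \<le> (1 - 1 / (real k - 1)) ^ \<Delta>"
          using exp_minus_inverse_le[OF n] by (intro power_mono) auto
        also have "1 - 1 / (real k - 1) = (real k - 2) / (real k - 1)" using n by (simp add: field_simps)
        finally have "exp (- (y + 1)) \<le> ((real k - 2) / (real k - 1)) ^ \<Delta>" .
        then have "(real k / 2) * exp (- (y + 1)) \<le> \<mu>"
          unfolding \<mu>_def using k by (intro mult_mono) auto
        then have "(real k / 2) * exp (- (y + 1)) * (2 * exp (y + 1)) \<le> \<mu> * (2 * exp (y + 1))"
          by (intro mult_right_mono) auto
        moreover have "(real k / 2) * exp (- (y + 1)) * (2 * exp (y + 1)) = real k"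
          by (simp add: mult.assoc flip: exp_add)
        ultimately have "real k \<le> \<mu> * (2 * exp (y + 1))" by (simp only:)
        then have *: "real k \<le> 2 * exp 1 * exp y * \<mu>"
          unfolding exp_add by (simp add: mult.commute mult.left_commute)
        have "0 < \<mu>" using k by (simp add: \<mu>_def)
        have "x \<le> k * L" using kL L by (simp add: field_simps)
        also have "\<dots> \<le> 2 * exp 1 * exp y * \<mu> * L" using * L by (intro mult_right_mono) auto
        also have "\<dots> \<le> 2 * exp 1 * x powr (1 - 8 * a) * \<mu> * L"
          using ey \<open>0 < \<mu>\<close> L by (intro mult_right_mono mult_left_mono) auto
        also have "\<dots> = x powr (1 - 8 * a) * (\<mu> / 4) * (8 * exp 1 * L)" by simp
        also have "\<dots> \<le> x powr (1 - 8 * a) * (\<mu> / 4) * x powr (4 * a)"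
          using C5 \<open>0 < \<mu>\<close> by (intro mult_left_mono) (auto simp: L_def)
        also have "\<dots> = x powr (1 - 4 * a) * (\<mu> / 4)" by (simp add: mult.commute mult.left_commute pw)
        finally have "x powr (1 - 4 * a) * x powr (4 * a) \<le> x powr (1 - 4 * a) * (\<mu> / 4)"
          using x0 by (simp add: pw)
        then have "x powr (4 * a) \<le> \<mu> / 4" using x0 by simp
        then show ?thesis by simp
      qed
      have x1: "1 \<le> x" using L L1 x0 ln_ge_zero_iff[of x] by linarith
      have \<mu>\<beta>: "1 / \<beta> \<le> \<mu> / 2"
      proof -
        have "1 / \<beta> = x powr a" using x0 by (simp add: \<beta>_def powr_minus field_simps)
        also have "\<dots> \<le> x powr (4 * a)" using x1 a by (intro powr_mono) auto
        also have "\<dots> \<le> 2 * x powr (4 * a)" by simp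
        finally show ?thesis using \<mu>ge by linarith
      qed
      have \<beta>2: "\<beta>\<^sup>2 = x powr (- 2 * a)"
        by (simp add: \<beta>_def power2_eq_square pw)
      have b_ge: "x powr (1 - 2 * a) / L \<le> b"
      proof -
        have "x powr (1 - 2 * a) / L = \<beta>\<^sup>2 * (x / L)" unfolding \<beta>2 times_divide_eq_right xp by simp
        also have "\<dots> \<le> b" unfolding b_def using kL by (intro mult_left_mono) auto
        finally show ?thesis .
      qed
      have n4: "A * exp (\<Delta> * (4 / \<mu> * exp 1) - b) \<le> exp (- b / 2)"
      proof -
        have "x powr (4 * a) \<le> \<mu> / 4" using \<mu>ge by simp
        then have "4 / \<mu> \<le> 1 / x powr (4 * a)"
          using x0 frac_le[of 1 1 "x powr (4 * a)" "\<mu> / 4"] by simp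
        also have "\<dots> = x powr (- 4 * a)" by (simp add: powr_minus field_simps)
        finally have "\<Delta> * (4 / \<mu> * exp 1) \<le> \<Delta> * (x powr (- 4 * a) * exp 1)"
          by (intro mult_left_mono mult_right_mono) auto
        also have "\<dots> = exp 1 * (x * x powr (- 4 * a))" by (simp add: x)
        also have "\<dots> = exp 1 * x powr (1 - 4 * a)" unfolding xp by simp
        finally have "2 * L + \<Delta> * (4 / \<mu> * exp 1) \<le> b / 2"
          using C6 b_ge by (simp add: L_def)
        then have "exp (2 * L) * exp (\<Delta> * (4 / \<mu> * exp 1) - b) \<le> exp (- b / 2)"
          by (simp flip: exp_add)
        moreover have "A * exp (\<Delta> * (4 / \<mu> * exp 1) - b) \<le> exp (2 * L) * exp (\<Delta> * (4 / \<mu> * exp 1) - b)"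
          using AL by (intro mult_right_mono) auto
        ultimately show ?thesis by linarith
      qed
      have xe: "x = exp L" using x0 by (simp add: L_def)
      \<comment> \<open>b^2/4 equals (\<beta>^4 k/4) k, which is at least 44 k. The surplus k pays
        for \<open>A\<close>, at most exp(2 ln \<Delta>), and for the remaining term, at most
        1.\<close>
      have n5: "A * exp (\<Delta> * (exp (- b / 2) * exp (b / 4)) - b / 4 * b) \<le> exp (- 43 * real k)"
      proof -
        have "L \<le> b / 4" using C7 b_ge by (simp add: L_def)
        then have "\<Delta> * (exp (- b / 2) * exp (b / 4)) \<le> 1"
          by (simp add: x[symmetric] xe flip: exp_add)
        moreover have "44 * k \<le> b / 4 * b"
        proof -
          have "b / 4 * b = (\<beta>\<^sup>2 * \<beta>\<^sup>2 * k / 4) * k" by (simp add: b_def)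
          moreover have "44 \<le> \<beta>\<^sup>2 * \<beta>\<^sup>2 * k / 4"
          proof -
            have "44 \<le> (x powr (- 4 * a) * x) / (4 * L)" using C9 by (simp add: L_def xp)
            also have "\<dots> = x powr (- 4 * a) * (x / L) / 4" by simp
            also have "\<dots> \<le> x powr (- 4 * a) * k / 4" using kL by (intro divide_right_mono mult_left_mono) auto
            also have "x powr (- 4 * a) = \<beta>\<^sup>2 * \<beta>\<^sup>2" by (simp add: \<beta>2 pw)
            finally show ?thesis .
          qed
          ultimately show ?thesis using mult_right_mono[of 44 "\<beta>\<^sup>2 * \<beta>\<^sup>2 * k / 4" "real k"] by simp
        qed
        moreover have "2 * L + 1 \<le> k" using k4 L by linarith
        ultimately have "2 * L + (\<Delta> * (exp (- b / 2) * exp (b / 4)) - b / 4 * b) \<le> - 43 * real k"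
          by linarith
        then have "exp (2 * L) * exp (\<Delta> * (exp (- b / 2) * exp (b / 4)) - b / 4 * b) \<le> exp (- 43 * real k)"
          unfolding exp_add[symmetric] by (simp only: exp_le_cancel_iff)
        moreover have "A * exp (\<Delta> * (exp (- b / 2) * exp (b / 4)) - b / 4 * b) \<le> exp (2 * L) * exp (\<Delta> * (exp (- b / 2) * exp (b / 4)) - b / 4 * b)"
          using AL by (intro mult_right_mono) auto
        ultimately show ?thesis by linarith
      qed
      have n6: "exp (T + \<Delta> / (real k * (real k - 1)) + 2 * \<Delta> * (\<beta> / k + exp (- b / 2))) + k * exp (- 43 * real k) \<le> 2"
      proof -
        have "\<Delta> / (real k * (real k - 1)) = \<Delta> / (real k - 1) / k" by simp
        also have "\<dots> \<le> 2 * L / k" using Dk yL1 by (intro divide_right_mono) auto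
        also have "\<dots> \<le> 2 * L / (x / L)" using kL L x0 kp by (intro divide_left_mono) (auto intro!: mult_pos_pos divide_pos_pos)
        finally have 1: "\<Delta> / (real k * (real k - 1)) \<le> 2 * L / (x / L)" .
        have "2 * \<Delta> * (\<beta> / k) = 2 * y * \<beta>" by (simp add: y_def)
        also have "\<dots> \<le> 2 * L * \<beta>" using yL1 \<beta>0 by (intro mult_right_mono) auto
        finally have 2: "2 * \<Delta> * (\<beta> / k) \<le> 2 * L * \<beta>" .
        have 3: "2 * \<Delta> * exp (- b / 2) \<le> 2 * x * exp (- (x powr (1 - 2 * a) / (2 * L)))"
          using b_ge by (simp add: x mult_left_mono)
        have "T + \<Delta> / (real k * (real k - 1)) + 2 * \<Delta> * (\<beta> / k + exp (- b / 2)) \<le> 1 / 2"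
          using C10 1 2 3 TL unfolding L_def[symmetric] \<beta>_def[symmetric] distrib_left by linarith
        then have "exp (T + \<Delta> / (real k * (real k - 1)) + 2 * \<Delta> * (\<beta> / k + exp (- b / 2))) \<le> exp (1 / 2)"
          by (simp only: exp_le_cancel_iff)
        also have "exp (1 / 2 :: real) \<le> 1 + 1 / 2 + (1 / 2)\<^sup>2" by (intro exp_bound) auto
        finally have e: "exp (T + \<Delta> / (real k * (real k - 1)) + 2 * \<Delta> * (\<beta> / k + exp (- b / 2))) \<le> 7 / 4"
          by (simp add: power2_eq_square)
        have "4 * real k \<le> 1 + 43 * real k" by simp
        also have "\<dots> \<le> exp (43 * real k)" by (rule exp_ge_add_one_self)
        finally have "k * exp (- 43 * real k) \<le> 1 / 4" by (simp add: exp_minus field_simps)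
        then show ?thesis using e by linarith
      qed
      \<comment> \<open>The minimiser of \<Delta> l^2/k^2 - l \<delta>/4; the minimum is -\<delta>^2
        k^2/(64 \<Delta>).\<close>
      define l where "l = \<delta> * k\<^sup>2 / (8 * x)"
      have n7: "\<delta> * exp (41 * \<delta>) + A * (U * exp (41 * U) * exp (\<Delta> * (l\<^sup>2 * (2 / (real k)\<^sup>2) / 2) - l * \<delta> / 4))
              + k * exp (41 * k) * exp (- 43 * real k) \<le> \<eta>"
      proof -
        have t1: "\<delta> * exp (41 * \<delta>) \<le> \<eta> / 4"
        proof -
          have "41 * \<delta> \<le> 1"
          proof -
            have "41 \<le> 12 * (20 * (1 + exp 40 :: real))" using exp_gt_zero[of "40::real"]
              unfolding distrib_left by linarith
            then show ?thesis using ex by (simp add: \<delta>_def \<eta>_def)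
          qed
          then have "exp (41 * \<delta>) \<le> exp 1" by simp
          also have "\<dots> \<le> 3" using exp_le by simp
          finally have "\<delta> * exp (41 * \<delta>) \<le> \<delta> * 3" using \<delta> by (intro mult_left_mono) auto
          then show ?thesis by (simp add: \<delta>_def)
        qed
        have E: "\<Delta> * (l\<^sup>2 * (2 / (real k)\<^sup>2) / 2) - l * \<delta> / 4 = - (\<delta>\<^sup>2 * k\<^sup>2 / (64 * x))"
          using x0 kp unfolding x[symmetric] l_def by (simp add: field_simps power2_eq_square)
        have kk: "x / L\<^sup>2 \<le> k\<^sup>2 / x"
        proof -
          have "(x / L)\<^sup>2 \<le> (real k)\<^sup>2" using kL L x0 by (intro power_mono) auto
          then have "(x / L)\<^sup>2 / x \<le> k\<^sup>2 / x" using x0 by (simp add: divide_right_mono)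
          then show ?thesis using x0 by (simp add: power_divide power2_eq_square)
        qed
        have t2: "A * (U * exp (41 * U) * exp (\<Delta> * (l\<^sup>2 * (2 / (real k)\<^sup>2) / 2) - l * \<delta> / 4)) \<le> \<eta> / 4"
        proof -
          have UeU: "U \<le> exp U" using exp_ge_add_one_self[of U] by linarith
          have "42 * U \<le> 126 * x powr (1 - 8 * a)"
          proof -
            have "exp 1 * x powr (1 - 8 * a) \<le> 3 * x powr (1 - 8 * a)" using exp_le by (intro mult_right_mono) auto
            then show ?thesis using eU by linarith
          qed
          moreover have "\<delta>\<^sup>2 / 64 * (x / L\<^sup>2) \<le> \<delta>\<^sup>2 / 64 * (k\<^sup>2 / x)" using kk by (intro mult_left_mono) auto
          then have "\<delta>\<^sup>2 / 64 * (x / L\<^sup>2) \<le> \<delta>\<^sup>2 * k\<^sup>2 / (64 * x)" by simp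
          ultimately have le: "2 * L + 42 * U - \<delta>\<^sup>2 * k\<^sup>2 / (64 * x) \<le> ln (\<eta> / 4)"
            using C11 unfolding L_def[symmetric] by linarith
          have "A * (U * exp (41 * U) * exp (- (\<delta>\<^sup>2 * k\<^sup>2 / (64 * x)))) \<le>
              exp (2 * L) * (exp U * exp (41 * U) * exp (- (\<delta>\<^sup>2 * k\<^sup>2 / (64 * x))))"
            using AL UeU \<open>1 \<le> U\<close> by (intro mult_mono mult_right_mono) (auto simp: A_def)
          also have "\<dots> = exp (2 * L + 42 * U - \<delta>\<^sup>2 * k\<^sup>2 / (64 * x))"
            by (simp add: exp_add[symmetric] algebra_simps)
          also have "\<dots> \<le> exp (ln (\<eta> / 4))" using le by (simp only: exp_le_cancel_iff)
          also have "\<dots> = \<eta> / 4" using \<eta> by simp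
          finally show ?thesis unfolding E .
        qed
        have t3: "k * exp (41 * k) * exp (- 43 * real k) \<le> \<eta> / 4"
        proof -
          have "exp (41 * real k) * exp (- 43 * real k) = exp (- k) * exp (- real k)" by (simp flip: exp_add)
          then have "k * exp (41 * k) * exp (- 43 * real k) = (k * exp (- real k)) * exp (- real k)" by (simp add: mult.assoc)
          also have "\<dots> \<le> 1 * exp (- real k)"
          proof (rule mult_right_mono)
            have "real k \<le> exp k" using exp_ge_add_one_self[of "real k"] by linarith
            then show "k * exp (- real k) \<le> 1" by (simp add: exp_minus field_simps)
          qed simp
          also have "real k \<le> exp k" using exp_ge_add_one_self[of "real k"] by linarith
          then have "1 * exp (- real k) \<le> 1 / k" using kp by (simp add: exp_minus field_simps)
          also have "\<dots> \<le> \<eta> / 4"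
          proof -
            have "4 / \<eta> \<le> k" using C12 kL by (simp add: L_def)
            then show ?thesis using kp \<eta> by (simp add: field_simps)
          qed
          finally show ?thesis .
        qed
        show ?thesis using t1 t2 t3 \<eta> by linarith
      qed
      have l0: "0 \<le> l" using \<delta> x0 by (simp add: l_def)
      show "admissible k \<Delta> (x powr - a)"
        unfolding admissible_def Let_def \<beta>_def[symmetric] y_def[symmetric] b_def[symmetric]
          T_def[symmetric] A_def[symmetric] \<mu>_def[symmetric] U_def[symmetric] \<eta>_def[symmetric]
        using k \<beta>0 \<beta>4 \<beta>k good \<mu>\<beta> n4 n5 n6 n7 \<delta> T\<delta> l0 by auto
    qed
  qed
  then have "\<forall>\<^sub>F \<Delta> in sequentially. \<forall>\<Delta>' k::nat. real \<Delta> = real \<Delta>' \<longrightarrow>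
      real \<Delta> / ln (real \<Delta>) \<le> (1 - 8 * a) * k \<longrightarrow> admissible k \<Delta>' (real \<Delta> powr (- a))"
    by (rule eventually_compose_filterlim[OF _ filterlim_real_sequentially])
  then show ?thesis by eventually_elim blast
qed

section \<open>Resampling sets of vertices of the tree\<close>

text \<open>The key of the conditional expectation that averages over the colors on
  \<open>A\<close>: its level sets consist of colorings that coincide on the rest of the
  tree.\<close>

definition agree_off :: "nat \<Rightarrow> nat \<Rightarrow> vertex set \<Rightarrow> coloring \<Rightarrow> coloring" where
  "agree_off \<Delta> n A \<sigma> = restrict \<sigma> (tree_verts \<Delta> n - A)"

definition below :: "nat \<Rightarrow> nat \<Rightarrow> vertex \<Rightarrow> vertex set" where
  "below \<Delta> n x = {v \<in> tree_verts \<Delta> n. \<exists>u. v = x @ u}"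

definition down_closed :: "nat \<Rightarrow> nat \<Rightarrow> vertex set \<Rightarrow> bool" where
  "down_closed \<Delta> n A \<longleftrightarrow> A \<subseteq> tree_verts \<Delta> n \<and> (\<forall>v i. v \<in> A \<longrightarrow> v @ [i] \<in> tree_verts \<Delta> n \<longrightarrow> v @ [i] \<in> A)"

definition separated :: "vertex set \<Rightarrow> vertex set \<Rightarrow> bool" where
  "separated A C \<longleftrightarrow> A \<inter> C = {} \<and> (\<forall>v\<in>A. \<forall>w\<in>C. \<not> tree_adj v w)"

lemma tree_adj_sym: "tree_adj v w \<longleftrightarrow> tree_adj w v"
  by (auto simp: tree_adj_def)

lemma separated_sym: "separated A C \<Longrightarrow> separated C A"
  unfolding separated_def using tree_adj_sym by blast

lemma finite_tree_verts: "finite (tree_verts \<Delta> n)"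
proof -
  have "tree_verts \<Delta> n \<subseteq> {v. set v \<subseteq> {..<\<Delta>} \<and> length v \<le> n}" by (simp add: tree_verts_def)
  then show ?thesis using finite_lists_length_le[of "{..<\<Delta>}" n] finite_subset by blast
qed

lemma tree_verts_append: "x @ u \<in> tree_verts \<Delta> n \<Longrightarrow> x \<in> tree_verts \<Delta> n"
  by (auto simp: tree_verts_def)

lemma finite_colorings: "finite (colorings \<Delta> k n)"
proof -
  have "finite (tree_verts \<Delta> n \<rightarrow>\<^sub>E {1..k})" by (intro finite_PiE finite_tree_verts) auto
  then show ?thesis by (rule rev_finite_subset) (auto simp: colorings_def)
qed

lemma agree_off_iff: "agree_off \<Delta> n A \<tau> = agree_off \<Delta> n A \<sigma> \<longleftrightarrow> (\<forall>w\<in>tree_verts \<Delta> n - A. \<tau> w = \<sigma> w)"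
  unfolding agree_off_def by (auto simp: restrict_def fun_eq_iff)

lemma agree_off_mono:
  "A \<subseteq> A' \<Longrightarrow> agree_off \<Delta> n A \<tau> = agree_off \<Delta> n A \<sigma> \<Longrightarrow> agree_off \<Delta> n A' \<tau> = agree_off \<Delta> n A' \<sigma>"
  unfolding agree_off_iff by blast

lemma coloring_eqI:
  assumes "\<sigma> \<in> colorings \<Delta> k n" "\<tau> \<in> colorings \<Delta> k n" "\<And>w. w \<in> tree_verts \<Delta> n \<Longrightarrow> \<sigma> w = \<tau> w"
  shows "\<sigma> = \<tau>"
proof (rule PiE_ext)
  show "\<sigma> \<in> tree_verts \<Delta> n \<rightarrow>\<^sub>E {1..k}" "\<tau> \<in> tree_verts \<Delta> n \<rightarrow>\<^sub>E {1..k}"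
    using assms by (auto simp: colorings_def)
qed (rule assms(3))

text \<open>An edge leaving \<open>A\<close> ends outside \<open>A \<union> C\<close>, where both
  colorings agree, so on each edge the glued coloring coincides with one of the two.\<close>

lemma glue_coloring:
  assumes \<sigma>: "\<sigma> \<in> colorings \<Delta> k n" and \<rho>: "\<rho> \<in> colorings \<Delta> k n"
    and sep: "separated A C" and eq: "\<forall>w\<in>tree_verts \<Delta> n - (A \<union> C). \<rho> w = \<sigma> w"
  shows "(\<lambda>w. if w \<in> A then \<rho> w else \<sigma> w) \<in> colorings \<Delta> k n" (is "?g \<in> _")
proof -
  have "?g \<in> tree_verts \<Delta> n \<rightarrow>\<^sub>E {1..k}"
    using \<sigma> \<rho> by (auto simp: colorings_def PiE_iff extensional_def)
  moreover have "?g v \<noteq> ?g w" if v: "v \<in> tree_verts \<Delta> n" and w: "w \<in> tree_verts \<Delta> n" and adj: "tree_adj v w" for v w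
  proof -
    have s: "\<sigma> v \<noteq> \<sigma> w" "\<rho> v \<noteq> \<rho> w" using \<sigma> \<rho> v w adj by (auto simp: colorings_def)
    consider "v \<in> A" "w \<in> A" | "v \<in> A" "w \<notin> A" | "v \<notin> A" "w \<in> A" | "v \<notin> A" "w \<notin> A" by blast
    then show ?thesis
    proof cases
      case 2
      then have "w \<notin> C" using sep adj by (auto simp: separated_def)
      then show ?thesis using 2 w eq s by auto
    next
      case 3
      then have "v \<notin> C" using sep adj tree_adj_sym by (auto simp: separated_def)
      then show ?thesis using 3 v eq s by auto
    qed (use s in auto)
  qed
  ultimately show ?thesis by (auto simp: colorings_def)
qed

text \<open>The heat-bath operator of the vertex set \<open>A\<close>; a move of the dynamics is the
  case of a block.\<close>

definition resample :: "nat \<Rightarrow> nat \<Rightarrow> nat \<Rightarrow> vertex set \<Rightarrow> (coloring \<Rightarrow> real) \<Rightarrow> coloring \<Rightarrow> real" where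
  "resample \<Delta> k n A f = cexp (colorings \<Delta> k n) (agree_off \<Delta> n A) f"

lemma resample_cong:
  "(\<And>\<sigma>. \<sigma> \<in> colorings \<Delta> k n \<Longrightarrow> f \<sigma> = g \<sigma>) \<Longrightarrow> resample \<Delta> k n A f \<sigma> = resample \<Delta> k n A g \<sigma>"
  unfolding resample_def cexp_def by (intro avg_cong) auto

lemma resample_tower:
  assumes "A \<subseteq> A'"
  shows "resample \<Delta> k n A' (resample \<Delta> k n A f) \<sigma> = resample \<Delta> k n A' f \<sigma>"
  unfolding resample_def by (rule cexp_tower[OF finite_colorings]) (rule agree_off_mono[OF assms])

lemma resample_nonneg: "\<forall>\<sigma>\<in>colorings \<Delta> k n. 0 \<le> f \<sigma> \<Longrightarrow> 0 \<le> resample \<Delta> k n A f \<sigma>"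
  unfolding resample_def by (rule cexp_nonneg)

text \<open>The spatial Markov property: with the colors off \<open>A \<union> C\<close> fixed,
  those on \<open>A\<close> and on \<open>C\<close> vary independently, so the fibre is a product. A
  function already averaged over \<open>C\<close> depends on the first factor only.\<close>

lemma resample_separated:
  assumes sep: "separated A C" and \<sigma>: "\<sigma> \<in> colorings \<Delta> k n"
  shows "resample \<Delta> k n A (resample \<Delta> k n C f) \<sigma> = resample \<Delta> k n (A \<union> C) f \<sigma>"
proof -
  define g where "g = resample \<Delta> k n C f"
  define fib where "fib A = {\<tau>\<in>colorings \<Delta> k n. \<forall>w\<in>tree_verts \<Delta> n - A. \<tau> w = \<sigma> w}" for A
  define pr where "pr A \<rho> = (\<lambda>w. if w \<in> A then \<rho> w else \<sigma> w)" for A and \<rho> :: coloring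
  have disj: "A \<inter> C = {}" using sep by (simp add: separated_def)
  have fibre: "resample \<Delta> k n A h \<sigma> = avg (fib A) h" for A h
    by (simp add: resample_def cexp_def fib_def agree_off_iff)
  have fin: "finite (fib A)" and mem: "\<sigma> \<in> fib A" for A
    using \<sigma> finite_colorings by (auto simp: fib_def)
  have ginv: "g \<rho> = g \<tau>" if "\<forall>w\<in>tree_verts \<Delta> n - C. \<rho> w = \<tau> w" for \<rho> \<tau>
    unfolding g_def resample_def by (rule cexp_key) (simp add: agree_off_iff that)
  have bij: "bij_betw (\<lambda>\<rho>. (pr A \<rho>, pr C \<rho>)) (fib (A \<union> C)) (fib A \<times> fib C)"
  proof (rule bij_betwI[where g = "\<lambda>(\<alpha>, \<gamma>). (\<lambda>w. if w \<in> A then \<alpha> w else \<gamma> w)"])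
    show "(\<lambda>\<rho>. (pr A \<rho>, pr C \<rho>)) \<in> fib (A \<union> C) \<rightarrow> fib A \<times> fib C"
    proof
      fix \<rho> assume "\<rho> \<in> fib (A \<union> C)"
      then have "pr A \<rho> \<in> colorings \<Delta> k n" "pr C \<rho> \<in> colorings \<Delta> k n"
        unfolding pr_def using \<sigma> by (auto simp: fib_def Un_commute intro!: glue_coloring[OF _ _ sep] glue_coloring[OF _ _ separated_sym[OF sep]])
      then show "(pr A \<rho>, pr C \<rho>) \<in> fib A \<times> fib C" by (auto simp: fib_def pr_def)
    qed
    show "(\<lambda>(\<alpha>, \<gamma>). (\<lambda>w. if w \<in> A then \<alpha> w else \<gamma> w)) \<in> fib A \<times> fib C \<rightarrow> fib (A \<union> C)"
    proof (clarify)
      fix \<alpha> \<gamma> assume \<alpha>: "\<alpha> \<in> fib A" and \<gamma>: "\<gamma> \<in> fib C"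
      have "(\<lambda>w. if w \<in> A then \<alpha> w else \<gamma> w) \<in> colorings \<Delta> k n"
        using \<alpha> \<gamma> by (intro glue_coloring[OF _ _ sep]) (auto simp: fib_def)
      then show "(\<lambda>w. if w \<in> A then \<alpha> w else \<gamma> w) \<in> fib (A \<union> C)"
        using \<alpha> \<gamma> by (auto simp: fib_def)
    qed
    show "(case (pr A \<rho>, pr C \<rho>) of (\<alpha>, \<gamma>) \<Rightarrow> \<lambda>w. if w \<in> A then \<alpha> w else \<gamma> w) = \<rho>"
      if \<rho>: "\<rho> \<in> fib (A \<union> C)" for \<rho>
    proof -
      have "\<sigma> w = \<rho> w" if "w \<notin> A" "w \<notin> C" for w
      proof (cases "w \<in> tree_verts \<Delta> n")
        case False
        then show ?thesis using \<sigma> \<rho> by (auto simp: fib_def colorings_def PiE_iff extensional_def)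
      qed (use \<rho> that in \<open>auto simp: fib_def\<close>)
      then show ?thesis by (auto simp: pr_def)
    qed
    show "(pr A (case q of (\<alpha>, \<gamma>) \<Rightarrow> \<lambda>w. if w \<in> A then \<alpha> w else \<gamma> w),
           pr C (case q of (\<alpha>, \<gamma>) \<Rightarrow> \<lambda>w. if w \<in> A then \<alpha> w else \<gamma> w)) = q"
      if q: "q \<in> fib A \<times> fib C" for q
    proof -
      obtain \<alpha> \<gamma> where q': "q = (\<alpha>, \<gamma>)" "\<alpha> \<in> fib A" "\<gamma> \<in> fib C" using q by auto
      have "\<sigma> w = \<alpha> w" if "w \<notin> A" for w
      proof (cases "w \<in> tree_verts \<Delta> n")
        case False
        then show ?thesis using \<sigma> q' by (auto simp: fib_def colorings_def PiE_iff extensional_def)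
      qed (use q' that in \<open>auto simp: fib_def\<close>)
      moreover have "\<sigma> w = \<gamma> w" if "w \<notin> C" for w
      proof (cases "w \<in> tree_verts \<Delta> n")
        case False
        then show ?thesis using \<sigma> q' by (auto simp: fib_def colorings_def PiE_iff extensional_def)
      qed (use q' that in \<open>auto simp: fib_def\<close>)
      ultimately show ?thesis using disj by (auto simp: q' pr_def fun_eq_iff)
    qed
  qed
  have "avg (fib (A \<union> C)) g = avg (fib (A \<union> C)) (\<lambda>\<rho>. (\<lambda>(\<alpha>, \<gamma>). g \<alpha>) (pr A \<rho>, pr C \<rho>))"
  proof (rule avg_cong)
    fix \<rho> assume "\<rho> \<in> fib (A \<union> C)"
    then show "g \<rho> = (\<lambda>(\<alpha>, \<gamma>). g \<alpha>) (pr A \<rho>, pr C \<rho>)"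
      by (auto simp: fib_def pr_def intro!: ginv)
  qed
  also have "\<dots> = avg (fib A \<times> fib C) (\<lambda>(\<alpha>, \<gamma>). g \<alpha>)"
    by (rule avg_bij_betw[OF bij, symmetric])
  also have "\<dots> = avg (fib A) g"
  proof -
    have "card (fib C) > 0" using fin mem by (auto simp: card_gt_0_iff)
    moreover have "(\<Sum>q\<in>fib A \<times> fib C. (\<lambda>(\<alpha>, \<gamma>). g \<alpha>) q) = card (fib C) * (\<Sum>\<alpha>\<in>fib A. g \<alpha>)"
      by (subst sum.cartesian_product[symmetric]) (simp add: sum_distrib_left)
    ultimately show ?thesis by (simp add: avg_def card_cartesian_product)
  qed
  finally have "resample \<Delta> k n (A \<union> C) g \<sigma> = resample \<Delta> k n A g \<sigma>" by (simp add: fibre)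
  then show ?thesis using resample_tower[of C "A \<union> C" \<Delta> k n f \<sigma>] by (simp add: g_def)
qed

section \<open>Tensorisation of entropy over the tree\<close>

text \<open>The quantity V x of the overview, multiplied by the number of colorings: the entropy
  lost when \<open>x\<close> is averaged out after all its proper descendants.\<close>

definition site_entropy :: "nat \<Rightarrow> nat \<Rightarrow> nat \<Rightarrow> (coloring \<Rightarrow> real) \<Rightarrow> vertex \<Rightarrow> real" where
  "site_entropy \<Delta> k n f x = xent (colorings \<Delta> k n) (resample \<Delta> k n (below \<Delta> n x - {x}) f)
     - xent (colorings \<Delta> k n) (resample \<Delta> k n (below \<Delta> n x) f)"

lemma xent_cong: "(\<And>s. s \<in> S \<Longrightarrow> f s = g s) \<Longrightarrow> xent S f = xent S g"
  by (simp add: xent_def)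

lemma rent_cong: "(\<And>s. s \<in> S \<Longrightarrow> f s = f' s) \<Longrightarrow> (\<And>s. s \<in> S \<Longrightarrow> g s = g' s) \<Longrightarrow> rent S f g = rent S f' g'"
  by (simp add: rent_def)

lemma rent_resample:
  assumes f: "\<forall>\<sigma>\<in>colorings \<Delta> k n. 0 \<le> f \<sigma>" and A: "A \<subseteq> A'"
  shows "rent (colorings \<Delta> k n) (resample \<Delta> k n A f) (resample \<Delta> k n A' f) =
    xent (colorings \<Delta> k n) (resample \<Delta> k n A f) - xent (colorings \<Delta> k n) (resample \<Delta> k n A' f)"
  unfolding resample_def by (rule rent_cexp_cexp[OF finite_colorings f]) (rule agree_off_mono[OF A])

lemma resample_abs_cont:
  assumes f: "\<forall>\<sigma>\<in>colorings \<Delta> k n. 0 \<le> f \<sigma>" and A: "A \<subseteq> A'"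
    and \<sigma>: "\<sigma> \<in> colorings \<Delta> k n" and z: "resample \<Delta> k n A' f \<sigma> = 0"
  shows "resample \<Delta> k n A f \<sigma> = 0"
proof (rule cexp_eq_0[OF finite_colorings _ \<sigma>])
  show "\<forall>\<sigma>\<in>colorings \<Delta> k n. 0 \<le> resample \<Delta> k n A f \<sigma>" using resample_nonneg[OF f] by blast
  show "cexp (colorings \<Delta> k n) (agree_off \<Delta> n A') (resample \<Delta> k n A f) \<sigma> = 0"
    using resample_tower[OF A, of \<Delta> k n f \<sigma>] z by (simp add: resample_def)
qed

lemma rent_resample_le:
  assumes f: "\<forall>\<sigma>\<in>colorings \<Delta> k n. 0 \<le> f \<sigma>" and A: "A \<subseteq> A'"
  shows "rent (colorings \<Delta> k n) (resample \<Delta> k n C (resample \<Delta> k n A f)) (resample \<Delta> k n C (resample \<Delta> k n A' f))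
    \<le> rent (colorings \<Delta> k n) (resample \<Delta> k n A f) (resample \<Delta> k n A' f)"
  using resample_nonneg[OF f] resample_abs_cont[OF f A]
  by (subst (1 2) resample_def) (intro rent_cexp_le finite_colorings, auto)

lemma xent_resample_le:
  assumes "\<forall>\<sigma>\<in>colorings \<Delta> k n. 0 \<le> f \<sigma>"
  shows "xent (colorings \<Delta> k n) (resample \<Delta> k n A f) \<le> xent (colorings \<Delta> k n) f"
  unfolding resample_def by (rule xent_cexp_le[OF finite_colorings assms])

lemma xent_resample_antimono:
  assumes f: "\<forall>\<sigma>\<in>colorings \<Delta> k n. 0 \<le> f \<sigma>" and A: "A \<subseteq> A'"
  shows "xent (colorings \<Delta> k n) (resample \<Delta> k n A' f) \<le> xent (colorings \<Delta> k n) (resample \<Delta> k n A f)"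
proof -
  have "xent (colorings \<Delta> k n) (resample \<Delta> k n A' f) = xent (colorings \<Delta> k n) (resample \<Delta> k n A' (resample \<Delta> k n A f))"
    by (intro xent_cong) (simp add: resample_tower[OF A])
  also have "\<dots> \<le> xent (colorings \<Delta> k n) (resample \<Delta> k n A f)"
    using resample_nonneg[OF f] by (intro xent_resample_le) auto
  finally show ?thesis .
qed

lemma site_entropy_nonneg: "\<forall>\<sigma>\<in>colorings \<Delta> k n. 0 \<le> f \<sigma> \<Longrightarrow> 0 \<le> site_entropy \<Delta> k n f x"
  unfolding site_entropy_def using xent_resample_antimono[of \<Delta> k n f "below \<Delta> n x - {x}" "below \<Delta> n x"] by auto

lemma below_subset:
  assumes A: "down_closed \<Delta> n A" and x: "x \<in> A"
  shows "below \<Delta> n x \<subseteq> A"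
proof -
  have "x @ u \<in> tree_verts \<Delta> n \<longrightarrow> x @ u \<in> A" for u
  proof (induction u rule: rev_induct)
    case (snoc i u)
    then show ?case using A tree_verts_append[of "x @ u" "[i]"] by (auto simp: down_closed_def)
  qed (use x in simp)
  then show ?thesis by (auto simp: below_def)
qed

text \<open>The part \<open>C\<close> of \<open>A\<close> outside the subtree of \<open>x\<close>
  has no edge to that subtree, so averaging over \<open>A\<close> means averaging over proper
  descendants of \<open>x\<close> and then over \<open>C\<close>. The second average can only
  decrease relative entropy.\<close>

lemma insert_site_entropy:
  assumes f: "\<forall>\<sigma>\<in>colorings \<Delta> k n. 0 \<le> f \<sigma>" and A: "down_closed \<Delta> n A"
    and x: "x \<in> tree_verts \<Delta> n" "x \<notin> A" and sub: "below \<Delta> n x - {x} \<subseteq> A"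
  shows "xent (colorings \<Delta> k n) (resample \<Delta> k n A f) - xent (colorings \<Delta> k n) (resample \<Delta> k n (insert x A) f)
    \<le> site_entropy \<Delta> k n f x"
proof -
  define C where "C = A - below \<Delta> n x"
  have xb: "x \<in> below \<Delta> n x" using x by (auto simp: below_def)
  \<comment> \<open>The only edge leaving the subtree goes to the parent of \<open>x\<close>, which
    cannot lie in \<open>A\<close>: \<open>A\<close> is closed under children and does not contain
    \<open>x\<close>.\<close>
  have "\<not> tree_adj v w" if v: "v \<in> C" and w: "w \<in> below \<Delta> n x" for v w
  proof
    assume "tree_adj v w"
    then consider i where "w = v @ [i]" | i where "v = w @ [i]" by (auto simp: tree_adj_def)
    then show False
    proof cases
      case (1 i)
      obtain u where u: "w = x @ u" "w \<in> tree_verts \<Delta> n" using w by (auto simp: below_def)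
      show False
      proof (cases u rule: rev_cases)
        case Nil
        then have "x = v @ [i]" using u 1 by simp
        then show False using A v x by (auto simp: down_closed_def C_def)
      next
        case (snoc u' j)
        then have "v = x @ u'" using u 1 by simp
        then have "v \<in> below \<Delta> n x" using v A by (auto simp: below_def C_def down_closed_def)
        then show False using v by (simp add: C_def)
      qed
    next
      case (2 i)
      then have "v \<in> below \<Delta> n x" using v w A by (auto simp: below_def C_def down_closed_def)
      then show False using v by (simp add: C_def)
    qed
  qed
  then have sep: "separated C (below \<Delta> n x)" by (auto simp: separated_def C_def)
  then have sep': "separated C (below \<Delta> n x - {x})" by (auto simp: separated_def)
  have un: "A = C \<union> (below \<Delta> n x - {x})" "insert x A = C \<union> below \<Delta> n x"
    using sub xb x by (auto simp: C_def)
  have 1: "resample \<Delta> k n A f \<sigma> = resample \<Delta> k n C (resample \<Delta> k n (below \<Delta> n x - {x}) f) \<sigma>"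
    "resample \<Delta> k n (insert x A) f \<sigma> = resample \<Delta> k n C (resample \<Delta> k n (below \<Delta> n x) f) \<sigma>"
    if "\<sigma> \<in> colorings \<Delta> k n" for \<sigma>
    using resample_separated[OF sep' that] resample_separated[OF sep that] un by simp_all
  have "xent (colorings \<Delta> k n) (resample \<Delta> k n A f) - xent (colorings \<Delta> k n) (resample \<Delta> k n (insert x A) f) =
      rent (colorings \<Delta> k n) (resample \<Delta> k n A f) (resample \<Delta> k n (insert x A) f)"
    by (rule rent_resample[OF f, symmetric]) auto
  also have "\<dots> = rent (colorings \<Delta> k n) (resample \<Delta> k n C (resample \<Delta> k n (below \<Delta> n x - {x}) f))
      (resample \<Delta> k n C (resample \<Delta> k n (below \<Delta> n x) f))"
    using 1 by (rule rent_cong)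
  also have "\<dots> \<le> rent (colorings \<Delta> k n) (resample \<Delta> k n (below \<Delta> n x - {x}) f) (resample \<Delta> k n (below \<Delta> n x) f)"
    by (rule rent_resample_le[OF f]) auto
  also have "\<dots> = site_entropy \<Delta> k n f x"
    unfolding site_entropy_def by (rule rent_resample[OF f]) auto
  finally show ?thesis .
qed

lemma entropy_telescope:
  assumes f: "\<forall>\<sigma>\<in>colorings \<Delta> k n. 0 \<le> f \<sigma>" and A: "down_closed \<Delta> n A" and A': "down_closed \<Delta> n A'"
    and sub: "A \<subseteq> A'"
  shows "xent (colorings \<Delta> k n) (resample \<Delta> k n A f) - xent (colorings \<Delta> k n) (resample \<Delta> k n A' f)
    \<le> (\<Sum>x\<in>A'-A. site_entropy \<Delta> k n f x)"
  using A sub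
proof (induction "card (A' - A)" arbitrary: A)
  case 0
  have "finite A'" using A' finite_tree_verts finite_subset by (auto simp: down_closed_def)
  then have "A' - A = {}" using 0 by simp
  then have "A = A'" using 0 by blast
  then show ?case by simp
next
  case (Suc m)
  have fin: "finite (A' - A)" using Suc(2) card_ge_0_finite[of "A' - A"] by simp
  have ne: "A' - A \<noteq> {}" using Suc(2) by (metis card.empty nat.distinct(1))
  obtain x where x: "x \<in> A' - A" "\<And>v. v \<in> A' - A \<Longrightarrow> length v \<le> length x"
  proof -
    have "Max (length ` (A' - A)) \<in> length ` (A' - A)" using fin ne by (intro Max_in) auto
    then obtain x where "x \<in> A' - A" "Max (length ` (A' - A)) = length x" by auto
    then show ?thesis using that[of x] fin by (metis Max_ge finite_imageI imageI)
  qed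
  have child: "x @ [i] \<in> A" if "x @ [i] \<in> tree_verts \<Delta> n" for i
    using x(2)[of "x @ [i]"] x(1) A' that by (auto simp: down_closed_def)
  have xT: "x \<in> tree_verts \<Delta> n" using x A' by (auto simp: down_closed_def)
  have cl: "down_closed \<Delta> n (insert x A)"
    using Suc(3) child xT by (auto simp: down_closed_def)
  have sub: "below \<Delta> n x - {x} \<subseteq> A"
  proof
    fix v assume "v \<in> below \<Delta> n x - {x}"
    then obtain w where w: "v = x @ w" "v \<in> tree_verts \<Delta> n" "w \<noteq> []" by (auto simp: below_def)
    then obtain i u where "w = i # u" by (cases w) auto
    then have v: "v = (x @ [i]) @ u" "v \<in> tree_verts \<Delta> n" using w by auto
    have "x @ [i] \<in> A" using child tree_verts_append[of "x @ [i]" u] v by simp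
    moreover have "v \<in> below \<Delta> n (x @ [i])" unfolding below_def using v by blast
    ultimately show "v \<in> A" using below_subset[OF Suc(3)] by blast
  qed
  have diff: "A' - A = insert x (A' - insert x A)" using x by auto
  have "m = card (A' - insert x A)" using Suc(2) fin x by (subst (asm) diff) (simp add: card_insert_if)
  then have IH: "xent (colorings \<Delta> k n) (resample \<Delta> k n (insert x A) f) - xent (colorings \<Delta> k n) (resample \<Delta> k n A' f)
    \<le> (\<Sum>x\<in>A'-insert x A. site_entropy \<Delta> k n f x)"
    using Suc(1)[OF _ cl] Suc(4) x by auto
  have "(\<Sum>x\<in>A'-A. site_entropy \<Delta> k n f x) = site_entropy \<Delta> k n f x + (\<Sum>x\<in>A'-insert x A. site_entropy \<Delta> k n f x)"
    using fin by (subst diff) (simp add: sum.insert_if)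
  then show ?case using IH insert_site_entropy[OF f Suc(3) xT _ sub] x by auto
qed

section \<open>The coloring of a subtree as a branching process\<close>

definition level :: "nat \<Rightarrow> nat \<Rightarrow> vertex \<Rightarrow> nat \<Rightarrow> vertex set" where
  "level \<Delta> n x h = {v \<in> tree_verts \<Delta> n. \<exists>u. v = x @ u \<and> length u = h}"

text \<open>The parent of \<open>x\<close> lies outside the subtree, so its color is fixed and
  forbidden at \<open>x\<close>; the root of the tree has no such restriction.\<close>

definition root_colors :: "nat \<Rightarrow> vertex \<Rightarrow> coloring \<Rightarrow> nat set" where
  "root_colors k x \<sigma> = (if x = [] then {1..k} else {1..k} - {\<sigma> (butlast x)})"

definition subtree_fibre :: "nat \<Rightarrow> nat \<Rightarrow> nat \<Rightarrow> vertex \<Rightarrow> coloring \<Rightarrow> coloring set" where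
  "subtree_fibre \<Delta> k n x \<sigma> = {\<tau> \<in> colorings \<Delta> k n. \<forall>w\<in>tree_verts \<Delta> n - below \<Delta> n x. \<tau> w = \<sigma> w}"

text \<open>Reindexed by the path below the child, so that the subtrees of all children share one
  state space, the colorings of the tree of depth \<open>d\<close>.\<close>

definition child_coloring :: "nat \<Rightarrow> nat \<Rightarrow> vertex \<Rightarrow> coloring \<Rightarrow> nat \<Rightarrow> coloring" where
  "child_coloring \<Delta> d x \<tau> i = restrict (\<lambda>u. \<tau> (x @ i # u)) (tree_verts \<Delta> d)"

lemma colorings_iff:
  "\<sigma> \<in> colorings \<Delta> k n \<longleftrightarrow> \<sigma> \<in> tree_verts \<Delta> n \<rightarrow>\<^sub>E {1..k} \<and> (\<forall>v i. v @ [i] \<in> tree_verts \<Delta> n \<longrightarrow> \<sigma> v \<noteq> \<sigma> (v @ [i]))"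
proof
  assume "\<sigma> \<in> colorings \<Delta> k n"
  then show "\<sigma> \<in> tree_verts \<Delta> n \<rightarrow>\<^sub>E {1..k} \<and> (\<forall>v i. v @ [i] \<in> tree_verts \<Delta> n \<longrightarrow> \<sigma> v \<noteq> \<sigma> (v @ [i]))"
    using tree_verts_append by (fastforce simp: colorings_def tree_adj_def)
next
  assume R: "\<sigma> \<in> tree_verts \<Delta> n \<rightarrow>\<^sub>E {1..k} \<and> (\<forall>v i. v @ [i] \<in> tree_verts \<Delta> n \<longrightarrow> \<sigma> v \<noteq> \<sigma> (v @ [i]))"
  have "\<sigma> v \<noteq> \<sigma> w" if "v \<in> tree_verts \<Delta> n" "w \<in> tree_verts \<Delta> n" "tree_adj v w" for v w
    using R that unfolding tree_adj_def by metis
  then show "\<sigma> \<in> colorings \<Delta> k n" using R by (auto simp: colorings_def)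
qed

lemma child_vertex_iff:
  assumes "length x + Suc d = n" "x \<in> tree_verts \<Delta> n" "i < \<Delta>"
  shows "x @ i # u \<in> tree_verts \<Delta> n \<longleftrightarrow> u \<in> tree_verts \<Delta> d"
  using assms by (auto simp: tree_verts_def)

lemma below_cases:
  assumes "v \<in> below \<Delta> n x" "length x + Suc d = n"
  obtains "v = x" | i u where "v = x @ i # u" "i < \<Delta>" "u \<in> tree_verts \<Delta> d"
proof -
  obtain w where w: "v = x @ w" "v \<in> tree_verts \<Delta> n" using assms by (auto simp: below_def)
  show thesis
  proof (cases w)
    case Nil
    then show ?thesis using w that by simp
  next
    case (Cons i u)
    then show ?thesis using w assms that(2)[of i u] by (auto simp: tree_verts_def)
  qed
qed

text \<open>Level \<open>h\<close> of all child subtrees together is level \<open>h + 1\<close>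
  below \<open>x\<close>. Uniformity of the child's root color is a hypothesis here because its
  proof by induction on the depth passes through this lemma.\<close>

lemma branching_subtree:
  assumes k: "4 \<le> k" and x: "x \<in> tree_verts \<Delta> n" and d: "length x + Suc d = n"
    and \<sigma>: "\<sigma> \<in> colorings \<Delta> k n" and ne: "colorings \<Delta> k d \<noteq> {}"
    and unif: "\<And>s. s \<in> {1..k} \<Longrightarrow> k * card {\<tau>\<in>colorings \<Delta> k d. \<tau> [] = s} = card (colorings \<Delta> k d)"
  shows "branching k \<Delta> (root_colors k x \<sigma>) (colorings \<Delta> k d) (\<lambda>\<tau>. \<tau> []) (\<lambda>\<tau>. restrict \<tau> (level \<Delta> d [] h))
    (subtree_fibre \<Delta> k n x \<sigma>) (\<lambda>\<tau>. \<tau> x) (child_coloring \<Delta> d x) (\<lambda>\<tau>. restrict \<tau> (level \<Delta> n x (Suc h)))"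
proof
  note cv = child_vertex_iff[OF d x]
  show "4 \<le> k" by (rule k)
  show "finite (colorings \<Delta> k d)" by (rule finite_colorings)
  show "colorings \<Delta> k d \<noteq> {}" by (rule ne)
  have nil: "[] \<in> tree_verts \<Delta> d" by (simp add: tree_verts_def)
  show "(\<lambda>\<tau>. \<tau> []) ` colorings \<Delta> k d \<subseteq> {1..k}" using nil by (auto simp: colorings_def PiE_iff)
  show "k * card {\<tau>\<in>colorings \<Delta> k d. \<tau> [] = s} = card (colorings \<Delta> k d)" if "s \<in> {1..k}" for s
    by (rule unif[OF that])
  show "root_colors k x \<sigma> \<subseteq> {1..k}" by (auto simp: root_colors_def)
  have "card ({1..k} - {c}) + 1 \<ge> k" for c using card_Diff1_le[of "{1..k}" c] card_Diff_singleton_if[of "{1..k}" c] by (auto split: if_splits)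
  then show "k \<le> card (root_colors k x \<sigma>) + 1" by (simp add: root_colors_def)
  show "restrict \<tau> (level \<Delta> n x (Suc h)) = restrict \<tau>' (level \<Delta> n x (Suc h)) \<longleftrightarrow>
      (\<forall>i<\<Delta>. restrict (child_coloring \<Delta> d x \<tau> i) (level \<Delta> d [] h) = restrict (child_coloring \<Delta> d x \<tau>' i) (level \<Delta> d [] h))"
    if "\<tau> \<in> subtree_fibre \<Delta> k n x \<sigma>" "\<tau>' \<in> subtree_fibre \<Delta> k n x \<sigma>" for \<tau> \<tau>'
  proof -
    have "restrict \<tau> (level \<Delta> n x (Suc h)) = restrict \<tau>' (level \<Delta> n x (Suc h)) \<longleftrightarrow>
        (\<forall>v\<in>level \<Delta> n x (Suc h). \<tau> v = \<tau>' v)"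
      by (auto simp: restrict_def fun_eq_iff)
    also have "\<dots> \<longleftrightarrow> (\<forall>i<\<Delta>. \<forall>u\<in>level \<Delta> d [] h. \<tau> (x @ i # u) = \<tau>' (x @ i # u))"
    proof (intro iffI allI impI ballI)
      fix i u assume *: "\<forall>v\<in>level \<Delta> n x (Suc h). \<tau> v = \<tau>' v" "i < \<Delta>" "u \<in> level \<Delta> d [] h"
      then have "x @ i # u \<in> level \<Delta> n x (Suc h)" using cv by (auto simp: level_def)
      then show "\<tau> (x @ i # u) = \<tau>' (x @ i # u)" using * by blast
    next
      fix v assume *: "\<forall>i<\<Delta>. \<forall>u\<in>level \<Delta> d [] h. \<tau> (x @ i # u) = \<tau>' (x @ i # u)" "v \<in> level \<Delta> n x (Suc h)"
      then obtain w where w: "v = x @ w" "length w = Suc h" "v \<in> tree_verts \<Delta> n" by (auto simp: level_def)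
      then obtain i u where iu: "w = i # u" by (cases w) auto
      then have i: "i < \<Delta>" using w by (auto simp: tree_verts_def)
      then have "u \<in> level \<Delta> d [] h" using w iu cv[OF i, of u] by (auto simp: level_def)
      then show "\<tau> v = \<tau>' v" using * i iu w by blast
    qed
    also have "\<dots> \<longleftrightarrow> (\<forall>i<\<Delta>. restrict (child_coloring \<Delta> d x \<tau> i) (level \<Delta> d [] h) = restrict (child_coloring \<Delta> d x \<tau>' i) (level \<Delta> d [] h))"
      by (auto simp: restrict_def fun_eq_iff child_coloring_def level_def)
    finally show ?thesis .
  qed
  let ?kids = "\<lambda>\<tau>. (\<tau> x, \<lambda>i\<in>{..<\<Delta>}. child_coloring \<Delta> d x \<tau> i)"
  let ?R = "SIGMA s:root_colors k x \<sigma>. PiE {..<\<Delta>} (\<lambda>_. {\<tau>\<in>colorings \<Delta> k d. \<tau> [] \<noteq> s})"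
  let ?F = "subtree_fibre \<Delta> k n x \<sigma>"
  have xb: "x \<in> below \<Delta> n x" using x by (auto simp: below_def)
  have xn: "x @ [i] \<in> tree_verts \<Delta> n" if "i < \<Delta>" for i using cv[OF that, of "[]"] nil by simp
  have parent: "butlast x \<in> tree_verts \<Delta> n - below \<Delta> n x" if "x \<noteq> []"
  proof
    show "butlast x \<in> tree_verts \<Delta> n"
      using tree_verts_append[of "butlast x" "[last x]" \<Delta> n] x that by simp
    show "butlast x \<notin> below \<Delta> n x"
    proof
      assume "butlast x \<in> below \<Delta> n x"
      then obtain u where "butlast x = x @ u" by (auto simp: below_def)
      then have "length x \<le> length (butlast x)" by simp
      moreover have "length (butlast x) = length x - 1" "0 < length x" using that by simp_all
      ultimately show False by linarith
    qed
  qed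
  show "bij_betw ?kids ?F ?R"
    unfolding bij_betw_def
  proof
    show "inj_on ?kids ?F"
    proof (rule inj_onI)
      fix \<tau> \<tau>' assume \<tau>: "\<tau> \<in> ?F" "\<tau>' \<in> ?F" and eq: "?kids \<tau> = ?kids \<tau>'"
      show "\<tau> = \<tau>'"
      proof (rule coloring_eqI)
        show "\<tau> \<in> colorings \<Delta> k n" "\<tau>' \<in> colorings \<Delta> k n" using \<tau> by (auto simp: subtree_fibre_def)
        fix w assume w: "w \<in> tree_verts \<Delta> n"
        show "\<tau> w = \<tau>' w"
        proof (cases "w \<in> below \<Delta> n x")
          case True
          then show ?thesis using d
          proof (cases rule: below_cases)
            case 1
            then show ?thesis using eq by simp
          next
            case (2 i u)
            have "(\<lambda>i\<in>{..<\<Delta>}. child_coloring \<Delta> d x \<tau> i) i u = (\<lambda>i\<in>{..<\<Delta>}. child_coloring \<Delta> d x \<tau>' i) i u"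
              using eq by simp
            then show ?thesis using 2 by (simp add: child_coloring_def)
          qed
        qed (use \<tau> w in \<open>auto simp: subtree_fibre_def\<close>)
      qed
    qed
    show "?kids ` ?F = ?R"
    proof
      show "?kids ` ?F \<subseteq> ?R"
      proof
        fix q assume "q \<in> ?kids ` ?F"
        then obtain \<tau> where q: "q = ?kids \<tau>" and \<tau>: "\<tau> \<in> ?F" by auto
        have col: "\<tau> \<in> colorings \<Delta> k n" using \<tau> by (simp add: subtree_fibre_def)
        have rng: "\<tau> v \<in> {1..k}" if "v \<in> tree_verts \<Delta> n" for v using col that by (auto simp: colorings_def PiE_iff)
        have proper: "\<tau> v \<noteq> \<tau> (v @ [i])" if "v @ [i] \<in> tree_verts \<Delta> n" for v i
          using col that by (auto simp: colorings_iff)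
        have "\<tau> x \<in> root_colors k x \<sigma>"
        proof (cases "x = []")
          case False
          then have "\<tau> (butlast x) \<noteq> \<tau> x" using proper[of "butlast x" "last x"] x by simp
          moreover have "\<tau> (butlast x) = \<sigma> (butlast x)" using \<tau> parent[OF False] by (simp add: subtree_fibre_def)
          ultimately show ?thesis using rng[OF x] False by (auto simp: root_colors_def)
        qed (use rng[OF x] in \<open>auto simp: root_colors_def\<close>)
        moreover have "child_coloring \<Delta> d x \<tau> i \<in> colorings \<Delta> k d" if i: "i < \<Delta>" for i
          unfolding colorings_iff
        proof (intro conjI allI impI)
          show "child_coloring \<Delta> d x \<tau> i \<in> tree_verts \<Delta> d \<rightarrow>\<^sub>E {1..k}"
            using rng cv[OF i] unfolding child_coloring_def by (auto simp: PiE_iff)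
          fix v j assume vj: "v @ [j] \<in> tree_verts \<Delta> d"
          then have "v \<in> tree_verts \<Delta> d" by (rule tree_verts_append)
          moreover have "\<tau> (x @ i # v) \<noteq> \<tau> ((x @ i # v) @ [j])"
            using cv[OF i, of "v @ [j]"] vj by (intro proper) simp
          ultimately show "child_coloring \<Delta> d x \<tau> i v \<noteq> child_coloring \<Delta> d x \<tau> i (v @ [j])"
            using vj by (simp add: child_coloring_def)
        qed
        moreover have "child_coloring \<Delta> d x \<tau> i [] \<noteq> \<tau> x" if "i < \<Delta>" for i
          using proper[OF xn[OF that]] nil by (simp add: child_coloring_def)
        ultimately show "q \<in> ?R" unfolding q by auto
      qed
      show "?R \<subseteq> ?kids ` ?F"
      proof
        fix q assume "q \<in> ?R"
        then obtain s \<rho> where q: "q = (s, \<rho>)" and s: "s \<in> root_colors k x \<sigma>"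
          and \<rho>: "\<rho> \<in> PiE {..<\<Delta>} (\<lambda>_. {\<tau>\<in>colorings \<Delta> k d. \<tau> [] \<noteq> s})" by auto
        \<comment> \<open>A vertex x @ i # u is decoded into the child index at position
          \<open>length x\<close> and the remaining path u.\<close>
        define \<tau> where "\<tau> v = (if v \<in> below \<Delta> n x then (if v = x then s
            else \<rho> (v ! length x) (drop (Suc (length x)) v)) else \<sigma> v)" for v
        have \<rho>i: "\<rho> i \<in> colorings \<Delta> k d" "\<rho> i [] \<noteq> s" if "i < \<Delta>" for i using \<rho> that by (auto simp: PiE_iff)
        have \<tau>x: "\<tau> x = s" using xb by (simp add: \<tau>_def)
        have \<tau>c: "\<tau> (x @ i # u) = \<rho> i u" if "i < \<Delta>" "u \<in> tree_verts \<Delta> d" for i u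
          using cv[OF that(1), of u] that by (auto simp: \<tau>_def below_def)
        have \<tau>o: "\<tau> v = \<sigma> v" if "v \<notin> below \<Delta> n x" for v using that by (simp add: \<tau>_def)
        have "\<tau> v \<in> {1..k}" if v: "v \<in> tree_verts \<Delta> n" for v
        proof (cases "v \<in> below \<Delta> n x")
          case True
          then show ?thesis using d
          proof (cases rule: below_cases)
            case 1
            then show ?thesis using s \<tau>x by (auto simp: root_colors_def split: if_splits)
          next
            case (2 i u)
            then show ?thesis using \<tau>c[OF 2(2,3)] \<rho>i(1)[OF 2(2)] by (auto simp: colorings_def PiE_iff)
          qed
        next
          case False
          then show ?thesis using \<sigma> v \<tau>o by (auto simp: colorings_def PiE_iff)
        qed
        moreover have "\<tau> v = undefined" if v: "v \<notin> tree_verts \<Delta> n" for v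
          using v \<sigma> by (auto simp: \<tau>_def below_def colorings_def PiE_iff extensional_def)
        moreover have "\<tau> v \<noteq> \<tau> (v @ [j])" if vj: "v @ [j] \<in> tree_verts \<Delta> n" for v j
        proof (cases "v @ [j] \<in> below \<Delta> n x")
          case True
          then show ?thesis using d
          proof (cases rule: below_cases)
            case 1
            then have xne: "x \<noteq> []" and b: "butlast x = v" by auto
            have "\<tau> v = \<sigma> v" using parent[OF xne] b by (intro \<tau>o) auto
            then show ?thesis using s 1 \<tau>x b xne by (auto simp: root_colors_def)
          next
            case (2 i u)
            show ?thesis
            proof (cases u rule: rev_cases)
              case Nil
              then have "v = x" "j = i" using 2 by auto
              then show ?thesis using \<tau>x \<tau>c[OF 2(2) nil] \<rho>i(2)[OF 2(2)] by simp
            next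
              case (snoc u' j')
              then have v: "v = x @ i # u'" "j = j'" using 2 by auto
              have "u' \<in> tree_verts \<Delta> d" using tree_verts_append 2 snoc by blast
              then have "\<tau> v = \<rho> i u'" unfolding v by (rule \<tau>c[OF 2(2)])
              moreover have "\<tau> (v @ [j]) = \<rho> i (u' @ [j])" using \<tau>c[OF 2(2,3)] 2(1) snoc v by simp
              moreover have "\<rho> i u' \<noteq> \<rho> i (u' @ [j])" using \<rho>i(1)[OF 2(2)] 2(3) snoc v by (auto simp: colorings_iff)
              ultimately show ?thesis by simp
            qed
          qed
        next
          case False
          then have "v \<notin> below \<Delta> n x" using vj tree_verts_append[OF vj] by (auto simp: below_def)
          then show ?thesis using False \<sigma> vj \<tau>o by (auto simp: colorings_iff)
        qed
        ultimately have "\<tau> \<in> colorings \<Delta> k n" unfolding colorings_iff by (auto simp: PiE_iff extensional_def)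
        then have F: "\<tau> \<in> ?F" using \<tau>o by (auto simp: subtree_fibre_def)
        have "(\<lambda>i\<in>{..<\<Delta>}. child_coloring \<Delta> d x \<tau> i) i = \<rho> i" for i
        proof (cases "i < \<Delta>")
          case True
          have "child_coloring \<Delta> d x \<tau> i u = \<rho> i u" for u
            using \<tau>c[OF True] \<rho>i(1)[OF True] by (cases "u \<in> tree_verts \<Delta> d") (auto simp: child_coloring_def colorings_def PiE_iff extensional_def)
          then show ?thesis using True by auto
        next
          case False
          then show ?thesis using \<rho> by (auto simp: PiE_iff extensional_def)
        qed
        then have "q = ?kids \<tau>" unfolding q using \<tau>x by auto
        then show "q \<in> ?kids ` ?F" using F by (rule image_eqI)
      qed
    qed
  qed
qed

lemma subtree_fibre_root: "subtree_fibre \<Delta> k n [] \<sigma> = colorings \<Delta> k n"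
  by (auto simp: subtree_fibre_def below_def)

text \<open>Induction on the depth: the branching step turns uniform root colors of the children
  into a uniform root color of the parent.\<close>

lemma colorings_root_uniform:
  assumes k: "4 \<le> k"
  shows "colorings \<Delta> k d \<noteq> {} \<and> (\<forall>s\<in>{1..k}. k * card {\<tau>\<in>colorings \<Delta> k d. \<tau> [] = s} = card (colorings \<Delta> k d))"
proof (induction d)
  case 0
  have T: "tree_verts \<Delta> 0 = {[]}" by (auto simp: tree_verts_def)
  have "colorings \<Delta> k 0 = {[]} \<rightarrow>\<^sub>E {1..k}" unfolding colorings_def T by (auto simp: tree_adj_def)
  then have bij: "bij_betw (\<lambda>s. \<lambda>v\<in>{[]}. s) {1..k} (colorings \<Delta> k 0)"
    by (auto intro!: bij_betwI[where g = "\<lambda>\<tau>. \<tau> []"] simp: PiE_iff extensional_def fun_eq_iff)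
  have c: "card (colorings \<Delta> k 0) = k" using bij_betw_same_card[OF bij] by simp
  have "card {\<tau>\<in>colorings \<Delta> k 0. \<tau> [] = s} = 1" if s: "s \<in> {1..k}" for s
  proof -
    have "{\<tau>\<in>colorings \<Delta> k 0. \<tau> [] = s} = {\<lambda>v\<in>{[]}. s}"
      using s bij_betw_imp_surj_on[OF bij, symmetric] by auto
    then show ?thesis by simp
  qed
  then show ?case using c k by auto
next
  case (Suc d)
  \<comment> \<open>The coloring by parity of the depth. It witnesses nonemptiness and serves as the
    reference coloring of the fibre, which at the root is the set of all colorings.\<close>
  define s0 where "s0 v = (if v \<in> tree_verts \<Delta> (Suc d) then length v mod 2 + 1 else undefined)" for v :: vertex
  have s0: "s0 \<in> colorings \<Delta> k (Suc d)"
  proof -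
    have "length v mod 2 \<le> 1" for v :: vertex by linarith
    then have "s0 \<in> tree_verts \<Delta> (Suc d) \<rightarrow>\<^sub>E {1..k}" using k by (auto simp: s0_def PiE_iff extensional_def intro: order_trans[of _ 2])
    moreover have "s0 v \<noteq> s0 (v @ [i])" if "v @ [i] \<in> tree_verts \<Delta> (Suc d)" for v i
      using that tree_verts_append[OF that] by (auto simp: s0_def) presburger
    ultimately show ?thesis unfolding colorings_iff by blast
  qed
  have r: "root_colors k [] s0 = {1..k}" by (simp add: root_colors_def)
  interpret branching k \<Delta> "root_colors k [] s0" "colorings \<Delta> k d" "\<lambda>\<tau>. \<tau> []" "\<lambda>\<tau>. restrict \<tau> (level \<Delta> d [] 0)"
    "subtree_fibre \<Delta> k (Suc d) [] s0" "\<lambda>\<tau>. \<tau> []" "child_coloring \<Delta> d []" "\<lambda>\<tau>. restrict \<tau> (level \<Delta> (Suc d) [] (Suc 0))"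
    using Suc s0 k by (intro branching_subtree) (auto simp: tree_verts_def)
  show ?case using unif' s0 unfolding r subtree_fibre_root by auto
qed

lemma branching_colorings:
  assumes k: "4 \<le> k"
  shows "branching k \<Delta> {1..k} (colorings \<Delta> k d) (\<lambda>\<tau>. \<tau> []) (\<lambda>\<tau>. restrict \<tau> (level \<Delta> d [] h))
    (colorings \<Delta> k (Suc d)) (\<lambda>\<tau>. \<tau> []) (child_coloring \<Delta> d []) (\<lambda>\<tau>. restrict \<tau> (level \<Delta> (Suc d) [] (Suc h)))"
proof -
  obtain \<sigma> where \<sigma>: "\<sigma> \<in> colorings \<Delta> k (Suc d)" using colorings_root_uniform[OF k] by blast
  have "[] \<in> tree_verts \<Delta> (Suc d)" by (simp add: tree_verts_def)
  then show ?thesis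
    using branching_subtree[OF k _ _ \<sigma>, of "[]" d h] colorings_root_uniform[OF k, of \<Delta> d]
    by (simp add: subtree_fibre_root root_colors_def)
qed

lemma subtree_tail:
  fixes \<beta> :: real
  assumes adm: "admissible k \<Delta> \<beta>" and x: "x \<in> tree_verts \<Delta> n" and n: "length x + 4 \<le> n"
    and \<sigma>: "\<sigma> \<in> colorings \<Delta> k n" and s: "s \<in> root_colors k x \<sigma>"
    and \<phi>: "\<And>\<tau>. \<phi> \<tau> = card (root_colors k x \<sigma>) *
      cexp (subtree_fibre \<Delta> k n x \<sigma>) (\<lambda>\<tau>. restrict \<tau> (level \<Delta> n x 4)) (\<lambda>\<tau>. of_bool (\<tau> x = s)) \<tau> - 1"
  shows "avg (subtree_fibre \<Delta> k n x \<sigma>) (\<lambda>\<tau>. max 0 (\<phi> \<tau>) * exp (41 * max 0 (\<phi> \<tau>))) \<le> 1 / (20 * (1 + exp 40))"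
proof -
  have k: "4 \<le> k" using adm by (simp add: admissible_def Let_def)
  define d where "d = n - length x - 4"
  have d: "n = length x + Suc (Suc (Suc (Suc d)))" using n by (simp add: d_def)
  note u = colorings_root_uniform[OF k]
  \<comment> \<open>Level 0 consists of the root alone, so the chain of four steps starts from fully
    revealed colors.\<close>
  have rev: "posterior (colorings \<Delta> k d) (\<lambda>\<tau>. restrict \<tau> (level \<Delta> d [] 0)) (\<lambda>\<tau>. \<tau> []) \<tau> q = of_bool (\<tau> [] = q)"
    if "\<tau> \<in> colorings \<Delta> k d" for \<tau> q
    unfolding posterior_def
  proof (rule cexp_eq_self[OF finite_colorings that])
    fix \<tau>' assume "restrict \<tau>' (level \<Delta> d [] 0) = restrict \<tau> (level \<Delta> d [] 0)"
    then have "restrict \<tau>' (level \<Delta> d [] 0) [] = restrict \<tau> (level \<Delta> d [] 0) []" by simp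
    then have "\<tau>' [] = \<tau> []" by (simp add: level_def tree_verts_def)
    then show "of_bool (\<tau>' [] = q) = (of_bool (\<tau> [] = q) :: real)" by simp
  qed
  have n4: "length x + Suc (Suc (Suc (Suc d))) = n" using d by simp
  have l4: "(4::nat) = Suc (Suc (Suc (Suc 0)))" by simp
  note B4 = branching_subtree[OF k x n4 \<sigma> conjunct1[OF u], of "Suc (Suc (Suc 0))",
      OF conjunct2[OF u, rule_format]]
  show ?thesis
    by (rule four_step_tail[OF adm branching_colorings[OF k] branching_colorings[OF k] branching_colorings[OF k] B4 rev s])
      (simp_all add: \<phi> posterior_def l4)
qed

section \<open>Comparison of site and block entropies\<close>

definition block_entropy :: "nat \<Rightarrow> nat \<Rightarrow> nat \<Rightarrow> nat \<Rightarrow> (coloring \<Rightarrow> real) \<Rightarrow> vertex \<Rightarrow> real" where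
  "block_entropy \<Delta> k n l f x = xent (colorings \<Delta> k n) f - xent (colorings \<Delta> k n) (resample \<Delta> k n (block \<Delta> n l x) f)"

text \<open>With the colors off the subtree of \<open>x\<close> fixed, the hypothesis
  \<open>inv\<close> makes \<open>g\<close> a function of level 4 only. This is the observation in
  the chi-square estimate, and the color of \<open>x\<close> is the hidden variable.\<close>

lemma fibre_contraction:
  fixes \<beta> :: real
  assumes adm: "admissible k \<Delta> \<beta>" and x: "x \<in> tree_verts \<Delta> n" and n: "length x + 4 \<le> n"
    and \<sigma>: "\<sigma> \<in> colorings \<Delta> k n" and g: "\<forall>\<sigma>\<in>colorings \<Delta> k n. 0 \<le> g \<sigma>"
    and inv: "\<And>\<tau> \<tau>'. \<tau> \<in> colorings \<Delta> k n \<Longrightarrow> \<tau>' \<in> colorings \<Delta> k n \<Longrightarrow>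
      \<forall>w\<in>tree_verts \<Delta> n - (below \<Delta> n x - level \<Delta> n x 4). \<tau> w = \<tau>' w \<Longrightarrow> g \<tau> = g \<tau>'"
    and m: "m = avg (subtree_fibre \<Delta> k n x \<sigma>) g"
  shows "avg (subtree_fibre \<Delta> k n x \<sigma>) (\<lambda>\<tau>. (resample \<Delta> k n (below \<Delta> n x - {x}) g \<tau> - m)\<^sup>2 / m)
    \<le> avg (subtree_fibre \<Delta> k n x \<sigma>) (\<lambda>\<tau>. g \<tau> * ln (g \<tau> / m)) / 10"
proof -
  let ?F = "subtree_fibre \<Delta> k n x \<sigma>"
  let ?D = "root_colors k x \<sigma>"
  let ?\<kappa> = "\<lambda>\<tau>. restrict \<tau> (level \<Delta> n x 4)"
  have k: "4 \<le> k" using adm by (simp add: admissible_def Let_def)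
  have F: "finite ?F" "?F \<noteq> {}" "?F \<subseteq> colorings \<Delta> k n"
    using \<sigma> finite_colorings[of \<Delta> k n] by (auto simp: subtree_fibre_def)
  have m0: "0 \<le> m" unfolding m using g F by (intro avg_nonneg) auto
  show ?thesis
  proof (cases "m = 0")
    \<comment> \<open>A zero mean forces \<open>g\<close> to vanish on the fibre; both sides are
      then 0, on the left through division by zero.\<close>
    case True
    have "g \<tau> = 0" if "\<tau> \<in> ?F" for \<tau>
    proof -
      have "(\<Sum>\<tau>\<in>?F. g \<tau>) = 0" using True F by (auto simp: m avg_def)
      then show ?thesis using F g that by (subst (asm) sum_nonneg_eq_0_iff) auto
    qed
    then show ?thesis using True by (simp add: avg_def)
  next
    case False
    define d where "d = n - length x - 1"
    have d: "length x + Suc d = n" using n by (simp add: d_def)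
    interpret branching k \<Delta> ?D "colorings \<Delta> k d" "\<lambda>\<tau>. \<tau> []" "\<lambda>\<tau>. restrict \<tau> (level \<Delta> d [] 3)"
      ?F "\<lambda>\<tau>. \<tau> x" "child_coloring \<Delta> d x" "\<lambda>\<tau>. restrict \<tau> (level \<Delta> n x (Suc 3))"
      using colorings_root_uniform[OF k, of \<Delta> d] by (intro branching_subtree[OF k x d \<sigma>]) auto
    have img: "(\<lambda>\<tau>. \<tau> x) ` ?F \<subseteq> ?D" using root_in_D by auto
    have ginv: "g \<tau> = g \<tau>'" if "\<tau> \<in> ?F" "\<tau>' \<in> ?F" "?\<kappa> \<tau> = ?\<kappa> \<tau>'" for \<tau> \<tau>'
    proof (rule inv)
      show "\<tau> \<in> colorings \<Delta> k n" "\<tau>' \<in> colorings \<Delta> k n" using that F by auto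
      show "\<forall>w\<in>tree_verts \<Delta> n - (below \<Delta> n x - level \<Delta> n x 4). \<tau> w = \<tau>' w"
      proof
        fix w assume w: "w \<in> tree_verts \<Delta> n - (below \<Delta> n x - level \<Delta> n x 4)"
        show "\<tau> w = \<tau>' w"
        proof (cases "w \<in> level \<Delta> n x 4")
          case True
          then show ?thesis using fun_cong[OF that(3), of w] by simp
        next
          case False
          then show ?thesis using w that by (simp add: subtree_fibre_def)
        qed
      qed
    qed
    have strict: "resample \<Delta> k n (below \<Delta> n x - {x}) g \<tau> = cexp ?F (\<lambda>\<tau>. \<tau> x) g \<tau>" if \<tau>: "\<tau> \<in> ?F" for \<tau>
    proof -
      have "{\<tau>' \<in> colorings \<Delta> k n. \<forall>w\<in>tree_verts \<Delta> n - (below \<Delta> n x - {x}). \<tau>' w = \<tau> w} = {\<tau>' \<in> ?F. \<tau>' x = \<tau> x}"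
      proof -
        have \<tau>\<sigma>: "\<tau> w = \<sigma> w" if "w \<in> tree_verts \<Delta> n - below \<Delta> n x" for w
          using \<tau> that by (simp add: subtree_fibre_def)
        have "(\<forall>w\<in>tree_verts \<Delta> n - (below \<Delta> n x - {x}). \<tau>' w = \<tau> w) \<longleftrightarrow>
            (\<forall>w\<in>tree_verts \<Delta> n - below \<Delta> n x. \<tau>' w = \<sigma> w) \<and> \<tau>' x = \<tau> x" for \<tau>'
          using \<tau>\<sigma> x by (metis Diff_iff singletonD singletonI)
        then show ?thesis unfolding subtree_fibre_def by blast
      qed
      then show ?thesis by (simp add: resample_def cexp_def agree_off_iff)
    qed
    have "avg ?F (\<lambda>\<tau>. (cexp ?F (\<lambda>\<tau>. \<tau> x) g \<tau> - m)\<^sup>2 / m) \<le> avg ?F (\<lambda>\<tau>. g \<tau> * ln (g \<tau> / m)) / 10"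
    proof (rule chi_square_le_entropy[where \<kappa> = ?\<kappa> and D = ?D])
      show "finite ?F" "?F \<noteq> {}" by fact+
      show "finite ?D" by (rule finD)
      show "(\<lambda>\<tau>. \<tau> x) ` ?F \<subseteq> ?D" by (rule img)
      show "card ?D * card {\<tau>\<in>?F. \<tau> x = s} = card ?F" if "s \<in> ?D" for s using unif'[OF that] .
      show "\<forall>\<tau>\<in>?F. 0 \<le> g \<tau>" using g F by auto
      show "avg ?F g = m" "0 < m" using m m0 False by auto
      show "g \<tau> = g \<tau>'" if "\<tau> \<in> ?F" "\<tau>' \<in> ?F" "?\<kappa> \<tau> = ?\<kappa> \<tau>'" for \<tau> \<tau>' using ginv[OF that] .
      show "avg ?F (\<lambda>\<tau>. max 0 (card ?D * cexp ?F ?\<kappa> (\<lambda>\<tau>. of_bool (\<tau> x = s)) \<tau> - 1)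
          * exp (41 * max 0 (card ?D * cexp ?F ?\<kappa> (\<lambda>\<tau>. of_bool (\<tau> x = s)) \<tau> - 1))) \<le> 1 / (20 * (1 + exp 40))"
        if "s \<in> ?D" for s
        by (rule subtree_tail[OF adm x n \<sigma> that]) (rule refl)
    qed (rule refl)
    then show ?thesis using avg_cong[of ?F "\<lambda>\<tau>. (resample \<Delta> k n (below \<Delta> n x - {x}) g \<tau> - m)\<^sup>2 / m"
      "\<lambda>\<tau>. (cexp ?F (\<lambda>\<tau>. \<tau> x) g \<tau> - m)\<^sup>2 / m"] strict by simp
  qed
qed

lemma resample_below_eq_avg: "resample \<Delta> k n (below \<Delta> n x) g \<sigma> = avg (subtree_fibre \<Delta> k n x \<sigma>) g"
  by (simp add: resample_def cexp_def agree_off_iff subtree_fibre_def)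

text \<open>Averaging over the fibres preserves sums, and the mean in the denominators is constant
  on each fibre, so the fibrewise estimate integrates.\<close>

lemma global_contraction:
  fixes \<beta> :: real
  assumes adm: "admissible k \<Delta> \<beta>" and x: "x \<in> tree_verts \<Delta> n" and n: "length x + 4 \<le> n"
    and g: "\<forall>\<sigma>\<in>colorings \<Delta> k n. 0 \<le> g \<sigma>"
    and inv: "\<And>\<tau> \<tau>'. \<tau> \<in> colorings \<Delta> k n \<Longrightarrow> \<tau>' \<in> colorings \<Delta> k n \<Longrightarrow>
      \<forall>w\<in>tree_verts \<Delta> n - (below \<Delta> n x - level \<Delta> n x 4). \<tau> w = \<tau>' w \<Longrightarrow> g \<tau> = g \<tau>'"
  shows "(\<Sum>\<sigma>\<in>colorings \<Delta> k n. (resample \<Delta> k n (below \<Delta> n x - {x}) g \<sigma> - resample \<Delta> k n (below \<Delta> n x) g \<sigma>)\<^sup>2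
      / resample \<Delta> k n (below \<Delta> n x) g \<sigma>) \<le> rent (colorings \<Delta> k n) g (resample \<Delta> k n (below \<Delta> n x) g) / 10"
proof -
  let ?\<Omega> = "colorings \<Delta> k n"
  let ?m = "resample \<Delta> k n (below \<Delta> n x) g"
  let ?h1 = "\<lambda>\<sigma>. (resample \<Delta> k n (below \<Delta> n x - {x}) g \<sigma> - ?m \<sigma>)\<^sup>2 / ?m \<sigma>"
  let ?h2 = "\<lambda>\<sigma>. g \<sigma> * ln (g \<sigma> / ?m \<sigma>)"
  have le: "resample \<Delta> k n (below \<Delta> n x) ?h1 \<sigma> \<le> resample \<Delta> k n (below \<Delta> n x) ?h2 \<sigma> / 10" if \<sigma>: "\<sigma> \<in> ?\<Omega>" for \<sigma>
  proof -
    let ?F = "subtree_fibre \<Delta> k n x \<sigma>"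
    have m: "?m \<tau> = ?m \<sigma>" if "\<tau> \<in> ?F" for \<tau>
      unfolding resample_def using that by (intro cexp_key) (simp add: agree_off_iff subtree_fibre_def)
    have "resample \<Delta> k n (below \<Delta> n x) ?h1 \<sigma> = avg ?F (\<lambda>\<tau>. (resample \<Delta> k n (below \<Delta> n x - {x}) g \<tau> - ?m \<sigma>)\<^sup>2 / ?m \<sigma>)"
      unfolding resample_below_eq_avg[of \<Delta> k n x ?h1] by (rule avg_cong) (simp only: m)
    also have "\<dots> \<le> avg ?F (\<lambda>\<tau>. g \<tau> * ln (g \<tau> / ?m \<sigma>)) / 10"
      by (rule fibre_contraction[OF adm x n \<sigma> g inv]) (auto simp: resample_below_eq_avg)
    also have "avg ?F (\<lambda>\<tau>. g \<tau> * ln (g \<tau> / ?m \<sigma>)) = resample \<Delta> k n (below \<Delta> n x) ?h2 \<sigma>"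
      unfolding resample_below_eq_avg[of \<Delta> k n x ?h2] by (rule avg_cong) (simp only: m)
    finally show ?thesis .
  qed
  have "(\<Sum>\<sigma>\<in>?\<Omega>. ?h1 \<sigma>) = (\<Sum>\<sigma>\<in>?\<Omega>. resample \<Delta> k n (below \<Delta> n x) ?h1 \<sigma>)"
    unfolding resample_def[of \<Delta> k n "below \<Delta> n x" ?h1] by (rule sum_cexp[symmetric]) (rule finite_colorings)
  also have "\<dots> \<le> (\<Sum>\<sigma>\<in>?\<Omega>. resample \<Delta> k n (below \<Delta> n x) ?h2 \<sigma> / 10)" by (intro sum_mono le)
  also have "\<dots> = (\<Sum>\<sigma>\<in>?\<Omega>. resample \<Delta> k n (below \<Delta> n x) ?h2 \<sigma>) / 10" by (simp add: sum_divide_distrib)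
  also have "(\<Sum>\<sigma>\<in>?\<Omega>. resample \<Delta> k n (below \<Delta> n x) ?h2 \<sigma>) = (\<Sum>\<sigma>\<in>?\<Omega>. ?h2 \<sigma>)"
    unfolding resample_def[of \<Delta> k n "below \<Delta> n x" ?h2] by (rule sum_cexp) (rule finite_colorings)
  finally show ?thesis by (simp add: rent_def)
qed

lemma block_subset_below: "block \<Delta> n l x \<subseteq> below \<Delta> n x"
  by (auto simp: block_def below_def)

lemma block_entropy_nonneg: "\<forall>\<sigma>\<in>colorings \<Delta> k n. 0 \<le> f \<sigma> \<Longrightarrow> 0 \<le> block_entropy \<Delta> k n l f x"
  unfolding block_entropy_def using xent_resample_le by force

lemma down_closed_below: "down_closed \<Delta> n (below \<Delta> n x)"
  by (auto simp: down_closed_def below_def)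

lemma site_entropy_le:
  fixes \<beta> :: real
  assumes adm: "admissible k \<Delta> \<beta>" and x: "x \<in> tree_verts \<Delta> n"
    and f: "\<forall>\<sigma>\<in>colorings \<Delta> k n. 0 \<le> f \<sigma>"
  shows "site_entropy \<Delta> k n f x \<le> 2 * block_entropy \<Delta> k n 3 f x
    + (\<Sum>y\<in>{y\<in>below \<Delta> n x. length y \<le> length x + 4}. site_entropy \<Delta> k n f y) / 10"
proof (cases "length x + 4 \<le> n")
  \<comment> \<open>Near the leaves the block is the entire subtree, and its entropy dominates that
    of the site directly.\<close>
  case False
  then have "block \<Delta> n 3 x = below \<Delta> n x" by (auto simp: block_def below_def tree_verts_def)
  then have "site_entropy \<Delta> k n f x \<le> block_entropy \<Delta> k n 3 f x"
    using xent_resample_le[OF f] by (simp add: site_entropy_def block_entropy_def)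
  moreover have "0 \<le> (\<Sum>y\<in>{y\<in>below \<Delta> n x. length y \<le> length x + 4}. site_entropy \<Delta> k n f y)"
    using site_entropy_nonneg[OF f] by (intro sum_nonneg) auto
  ultimately show ?thesis using block_entropy_nonneg[OF f, of 3 x] by simp
next
  case True
  let ?\<Omega> = "colorings \<Delta> k n"
  define T where "T = below \<Delta> n x"
  define B where "B = block \<Delta> n 3 x"
  \<comment> \<open>\<open>B\<close> occupies levels 0 to 3 below \<open>x\<close> and
    \<open>F\<close> all levels from 5 on, so averaging over both leaves exactly level 4 of the
    subtree visible.\<close>
  define F where "F = {v\<in>T. length x + 5 \<le> length v}"
  define g where "g = resample \<Delta> k n (B \<union> F) f"
  have fg: "\<forall>\<sigma>\<in>?\<Omega>. 0 \<le> g \<sigma>" unfolding g_def using resample_nonneg[OF f] by blast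
  have BT: "B \<subseteq> T" using block_subset_below by (simp add: B_def T_def)
  have FT: "F \<subseteq> T" by (auto simp: F_def)
  have xT: "x \<in> T" using x by (auto simp: T_def below_def)
  have lenB: "length v \<le> length x + 3" if "v \<in> B" for v using that by (auto simp: B_def block_def)
  have sep: "separated F B"
    unfolding separated_def
  proof (intro conjI ballI notI)
    show "F \<inter> B = {}" using lenB by (force simp: F_def)
    fix v w assume "v \<in> F" "w \<in> B" "tree_adj v w"
    then show False using lenB[of w] by (auto simp: F_def tree_adj_def)
  qed
  have level: "T - level \<Delta> n x 4 = B \<union> F"
    by (auto simp: T_def level_def B_def block_def F_def below_def)
  have inv: "g \<tau> = g \<tau>'"
    if "\<forall>w\<in>tree_verts \<Delta> n - (below \<Delta> n x - level \<Delta> n x 4). \<tau> w = \<tau>' w" for \<tau> \<tau>'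
    unfolding g_def resample_def
    by (rule cexp_key) (use that in \<open>simp add: agree_off_iff level[unfolded T_def]\<close>)
  \<comment> \<open>Densities for the color of \<open>x\<close> together with the coloring off the
    subtree: \<open>a\<close> is the actual one, \<open>a'\<close> is obtained after resampling the
    block, that is from level 4 through the stationary kernel, and \<open>m\<close> has the color of
    \<open>x\<close> averaged out.\<close>
  define a where "a = resample \<Delta> k n (T - {x}) f"
  define a' where "a' = resample \<Delta> k n (T - {x}) (resample \<Delta> k n B f)"
  define m where "m = resample \<Delta> k n T f"
  have Bf: "\<forall>\<sigma>\<in>?\<Omega>. 0 \<le> resample \<Delta> k n B f \<sigma>" using resample_nonneg[OF f] by blast
  have mg: "resample \<Delta> k n T g \<sigma> = m \<sigma>" for \<sigma>
    unfolding g_def m_def using BT FT by (intro resample_tower) auto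
  have a'g: "a' \<sigma> = resample \<Delta> k n (T - {x}) g \<sigma>" for \<sigma>
  proof -
    have xF: "F \<subseteq> T - {x}" by (auto simp: F_def)
    have "resample \<Delta> k n (T - {x}) g \<sigma> = resample \<Delta> k n (T - {x}) (resample \<Delta> k n F (resample \<Delta> k n B f)) \<sigma>"
      unfolding g_def Un_commute[of B] by (rule resample_cong) (simp add: resample_separated[OF sep])
    then show ?thesis unfolding a'_def by (simp add: resample_tower[OF xF])
  qed
  have mB: "resample \<Delta> k n T (resample \<Delta> k n B f) \<sigma> = m \<sigma>" for \<sigma>
    unfolding m_def by (rule resample_tower[OF BT])
  have sums: "(\<Sum>\<sigma>\<in>?\<Omega>. resample \<Delta> k n A h \<sigma>) = (\<Sum>\<sigma>\<in>?\<Omega>. h \<sigma>)" for A h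
    unfolding resample_def by (rule sum_cexp[OF finite_colorings])
  \<comment> \<open>\<open>a\<close> and \<open>a'\<close> arise from \<open>f\<close> and from its
    block average by one and the same averaging, so data processing bounds their relative entropy by
    the block entropy.\<close>
  have rr: "rent ?\<Omega> a a' \<le> block_entropy \<Delta> k n 3 f x"
  proof -
    have "rent ?\<Omega> a a' \<le> rent ?\<Omega> f (resample \<Delta> k n B f)"
      unfolding a_def a'_def resample_def[of _ _ _ "T - {x}"]
    proof (rule rent_cexp_le[OF finite_colorings f Bf])
      show "\<forall>\<sigma>\<in>?\<Omega>. resample \<Delta> k n B f \<sigma> = 0 \<longrightarrow> f \<sigma> = 0"
        using cexp_eq_0[OF finite_colorings f] by (auto simp: resample_def)
    qed
    also have "\<dots> = block_entropy \<Delta> k n 3 f x"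
      unfolding block_entropy_def B_def[symmetric] unfolding resample_def by (rule rent_cexp_eq[OF finite_colorings f])
    finally show ?thesis .
  qed
  have "site_entropy \<Delta> k n f x = rent ?\<Omega> a m"
    unfolding site_entropy_def a_def m_def T_def[symmetric] by (rule rent_resample[OF f, symmetric]) auto
  also have "\<dots> \<le> 2 * rent ?\<Omega> a a' + (\<Sum>\<sigma>\<in>?\<Omega>. (a' \<sigma> - m \<sigma>)\<^sup>2 / m \<sigma>)"
  proof (rule rent_triangle[OF finite_colorings])
    show "\<forall>\<sigma>\<in>?\<Omega>. 0 \<le> a \<sigma>" unfolding a_def using resample_nonneg[OF f] by blast
    show "\<forall>\<sigma>\<in>?\<Omega>. 0 \<le> a' \<sigma>" unfolding a'_def using resample_nonneg[OF Bf] by blast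
    show "\<forall>\<sigma>\<in>?\<Omega>. 0 \<le> m \<sigma>" unfolding m_def using resample_nonneg[OF f] by blast
    show "\<forall>\<sigma>\<in>?\<Omega>. a' \<sigma> = 0 \<longrightarrow> a \<sigma> = 0"
    proof (intro ballI impI)
      fix \<sigma> assume \<sigma>: "\<sigma> \<in> ?\<Omega>" and z: "a' \<sigma> = 0"
      have B0: "resample \<Delta> k n B f \<tau> = 0"
        if \<tau>: "\<tau> \<in> ?\<Omega>" "agree_off \<Delta> n (T - {x}) \<tau> = agree_off \<Delta> n (T - {x}) \<sigma>" for \<tau>
      proof (rule cexp_eq_0[OF finite_colorings Bf \<tau>(1)])
        show "cexp ?\<Omega> (agree_off \<Delta> n (T - {x})) (resample \<Delta> k n B f) \<tau> = 0"
          using cexp_key[of "agree_off \<Delta> n (T - {x})" \<tau> \<sigma> ?\<Omega> "resample \<Delta> k n B f"] \<tau>(2) z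
          by (simp add: a'_def resample_def)
      qed
      have "f \<tau> = 0" if \<tau>: "\<tau> \<in> ?\<Omega>" "agree_off \<Delta> n (T - {x}) \<tau> = agree_off \<Delta> n (T - {x}) \<sigma>" for \<tau>
        using cexp_eq_0[OF finite_colorings f \<tau>(1)] B0[OF \<tau>] by (simp add: resample_def)
      then show "a \<sigma> = 0" by (simp add: a_def resample_def cexp_def avg_def)
    qed
    show "\<forall>\<sigma>\<in>?\<Omega>. m \<sigma> = 0 \<longrightarrow> a' \<sigma> = 0"
      using resample_abs_cont[OF Bf, of "T - {x}" T] by (auto simp: mB a'_def)
    show "(\<Sum>\<sigma>\<in>?\<Omega>. a \<sigma>) = (\<Sum>\<sigma>\<in>?\<Omega>. m \<sigma>)" by (simp add: a_def m_def sums)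
    show "(\<Sum>\<sigma>\<in>?\<Omega>. a' \<sigma>) = (\<Sum>\<sigma>\<in>?\<Omega>. m \<sigma>)" by (simp add: a'_def m_def sums)
  qed
  also have "(\<Sum>\<sigma>\<in>?\<Omega>. (a' \<sigma> - m \<sigma>)\<^sup>2 / m \<sigma>) \<le> rent ?\<Omega> g m / 10"
    using global_contraction[OF adm x True fg inv]
    unfolding T_def[symmetric] a'g[symmetric] mg by simp
  also have "rent ?\<Omega> g m = xent ?\<Omega> g - xent ?\<Omega> m"
    unfolding g_def m_def using BT FT by (intro rent_resample[OF f]) auto
  \<comment> \<open>\<open>B \<union> F\<close> is not closed under children, but \<open>F\<close>
    is. Averaging over less increases the entropy and makes the telescoping over sites
    available.\<close>
  also have "xent ?\<Omega> g \<le> xent ?\<Omega> (resample \<Delta> k n F f)"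
    unfolding g_def by (rule xent_resample_antimono[OF f]) auto
  also have "xent ?\<Omega> (resample \<Delta> k n F f) - xent ?\<Omega> m \<le> (\<Sum>y\<in>T-F. site_entropy \<Delta> k n f y)"
    unfolding m_def
  proof (rule entropy_telescope[OF f])
    show "down_closed \<Delta> n F" using down_closed_below[of \<Delta> n x] by (auto simp: down_closed_def F_def T_def)
    show "down_closed \<Delta> n T" unfolding T_def by (rule down_closed_below)
  qed (rule FT)
  also have "T - F = {y\<in>below \<Delta> n x. length y \<le> length x + 4}" by (auto simp: T_def F_def)
  finally show ?thesis using rr by simp
qed

lemma card_close_ancestors: "card {x\<in>tree_verts \<Delta> n. y \<in> below \<Delta> n x \<and> length y \<le> length x + 4} \<le> 5"
proof -
  have "{x\<in>tree_verts \<Delta> n. y \<in> below \<Delta> n x \<and> length y \<le> length x + 4} \<subseteq> (\<lambda>j. take j y) ` {length y - 4..length y}"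
  proof
    fix x assume "x \<in> {x\<in>tree_verts \<Delta> n. y \<in> below \<Delta> n x \<and> length y \<le> length x + 4}"
    then obtain u where "y = x @ u" "length y \<le> length x + 4" by (auto simp: below_def)
    then show "x \<in> (\<lambda>j. take j y) ` {length y - 4..length y}" by (intro image_eqI[of _ _ "length x"]) auto
  qed
  then have "card {x\<in>tree_verts \<Delta> n. y \<in> below \<Delta> n x \<and> length y \<le> length x + 4} \<le> card ((\<lambda>j. take j y) ` {length y - 4..length y})"
    by (intro card_mono) auto
  also have "\<dots> \<le> card {length y - 4..length y}" by (rule card_image_le) simp
  also have "\<dots> \<le> 5" by simp
  finally show ?thesis .
qed

lemma entropy_le_block_entropies:
  fixes \<beta> :: real
  assumes adm: "admissible k \<Delta> \<beta>" and f: "\<forall>\<sigma>\<in>colorings \<Delta> k n. 0 \<le> f \<sigma>"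
  shows "xent (colorings \<Delta> k n) f - xent (colorings \<Delta> k n) (resample \<Delta> k n (tree_verts \<Delta> n) f)
    \<le> 4 * (\<Sum>x\<in>tree_verts \<Delta> n. block_entropy \<Delta> k n 3 f x)"
proof -
  let ?T = "tree_verts \<Delta> n" and ?V = "site_entropy \<Delta> k n f"
  define V where "V = (\<Sum>x\<in>?T. ?V x)"
  have fin: "finite ?T" by (rule finite_tree_verts)
  have self: "resample \<Delta> k n {} f \<sigma> = f \<sigma>" if "\<sigma> \<in> colorings \<Delta> k n" for \<sigma>
    unfolding resample_def
  proof (rule cexp_eq_self[OF finite_colorings that])
    fix \<tau> assume "\<tau> \<in> colorings \<Delta> k n" "agree_off \<Delta> n {} \<tau> = agree_off \<Delta> n {} \<sigma>"
    then have "\<tau> = \<sigma>" using that by (intro coloring_eqI) (auto simp: agree_off_iff)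
    then show "f \<tau> = f \<sigma>" by simp
  qed
  have "xent (colorings \<Delta> k n) (resample \<Delta> k n {} f) - xent (colorings \<Delta> k n) (resample \<Delta> k n ?T f)
      \<le> (\<Sum>x\<in>?T-{}. ?V x)"
    by (rule entropy_telescope[OF f]) (auto simp: down_closed_def)
  then have 1: "xent (colorings \<Delta> k n) f - xent (colorings \<Delta> k n) (resample \<Delta> k n ?T f) \<le> V"
    using xent_cong[of "colorings \<Delta> k n" "resample \<Delta> k n {} f" f] self by (simp add: V_def)
  have "V \<le> (\<Sum>x\<in>?T. 2 * block_entropy \<Delta> k n 3 f x + (\<Sum>y\<in>{y\<in>below \<Delta> n x. length y \<le> length x + 4}. ?V y) / 10)"
    unfolding V_def by (intro sum_mono site_entropy_le[OF adm _ f])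
  also have "\<dots> = 2 * (\<Sum>x\<in>?T. block_entropy \<Delta> k n 3 f x)
      + (\<Sum>x\<in>?T. \<Sum>y\<in>{y\<in>below \<Delta> n x. length y \<le> length x + 4}. ?V y) / 10"
    by (simp add: sum.distrib sum_distrib_left sum_divide_distrib)
  also have "(\<Sum>x\<in>?T. \<Sum>y\<in>{y\<in>below \<Delta> n x. length y \<le> length x + 4}. ?V y) =
      (\<Sum>x\<in>?T. \<Sum>y\<in>{y\<in>?T. y \<in> below \<Delta> n x \<and> length y \<le> length x + 4}. ?V y)"
    by (intro sum.cong) (auto simp: below_def)
  also have "\<dots> = (\<Sum>y\<in>?T. \<Sum>x\<in>{x\<in>?T. y \<in> below \<Delta> n x \<and> length y \<le> length x + 4}. ?V y)"
    using fin by (rule sum.swap_restrict) (rule fin)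
  also have "\<dots> \<le> (\<Sum>y\<in>?T. 5 * ?V y)"
  proof (rule sum_mono)
    fix y
    have "real (card {x\<in>?T. y \<in> below \<Delta> n x \<and> length y \<le> length x + 4}) * ?V y \<le> 5 * ?V y"
      using card_close_ancestors[of \<Delta> n y] site_entropy_nonneg[OF f] by (intro mult_right_mono) auto
    then show "(\<Sum>x\<in>{x\<in>?T. y \<in> below \<Delta> n x \<and> length y \<le> length x + 4}. ?V y) \<le> 5 * ?V y" by simp
  qed
  also have "\<dots> = 5 * V" by (simp add: V_def sum_distrib_left)
  \<comment> \<open>Five occurrences with weight 1/10 give half of V back, so the constant is 2/(1 -
    1/2) = 4.\<close>
  finally have "V \<le> 4 * (\<Sum>x\<in>?T. block_entropy \<Delta> k n 3 f x)" by simp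
  then show ?thesis using 1 by linarith
qed

section \<open>The entropy constant\<close>

lemma Ent_eq: "finite S \<Longrightarrow> S \<noteq> {} \<Longrightarrow> Ent S f = avg S (\<lambda>s. f s * ln (f s)) - avg S f * ln (avg S f)"
  by (simp add: Ent_def avg_def integral_pmf_of_set)

lemma Ent_eq_rent:
  assumes S: "finite S" "S \<noteq> {}" and f: "\<forall>s\<in>S. 0 \<le> f s"
  shows "Ent S f = rent S f (\<lambda>_. avg S f) / card S"
proof -
  define m where "m = avg S f"
  have c: "card S > 0" using S by (simp add: card_gt_0_iff)
  have "f s * ln (f s / m) = f s * ln (f s) - f s * ln m" if s: "s \<in> S" for s
  proof (cases "f s = 0")
    case False
    then have "0 < f s" using f s by force
    moreover have "0 < m"
    proof -
      have "f s \<le> (\<Sum>s\<in>S. f s)" using S s f by (intro member_le_sum) auto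
      then show ?thesis unfolding m_def avg_def using c \<open>0 < f s\<close> by (intro divide_pos_pos) auto
    qed
    ultimately show ?thesis by (simp add: ln_div right_diff_distrib)
  qed simp
  then have "rent S f (\<lambda>_. m) = (\<Sum>s\<in>S. f s * ln (f s)) - (\<Sum>s\<in>S. f s) * ln m"
    by (simp add: rent_def sum_subtractf sum_distrib_right)
  then show ?thesis unfolding Ent_eq[OF S] m_def[symmetric]
    by (simp add: diff_divide_distrib) (simp add: avg_def m_def)
qed

text \<open>The tangent-line inequality is strict at a point where \<open>f\<close> differs from its
  mean. Positivity is needed because the entropy constant divides by \<open>Ent S f\<close>.\<close>

lemma Ent_pos:
  assumes S: "finite S" "S \<noteq> {}" and f: "\<forall>s\<in>S. 0 \<le> f s" and nc: "\<not> f constant_on S"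
  shows "0 < Ent S f"
proof -
  define m where "m = avg S f"
  have c: "card S > 0" using S by (simp add: card_gt_0_iff)
  have m0: "0 \<le> m" unfolding m_def using f by (rule avg_nonneg)
  have sm: "(\<Sum>s\<in>S. f s) = card S * m" using c by (simp add: m_def avg_def)
  have m: "0 < m"
  proof (rule ccontr)
    assume "\<not> 0 < m"
    then have "(\<Sum>s\<in>S. f s) = 0" using m0 sm by simp
    then have "\<forall>s\<in>S. f s = 0" using S f by (subst (asm) sum_nonneg_eq_0_iff) auto
    then show False using nc by (auto simp: constant_on_def)
  qed
  obtain s where s: "s \<in> S" "f s \<noteq> m" using nc by (auto simp: constant_on_def)
  have "(\<Sum>s\<in>S. f s - m) < (\<Sum>s\<in>S. f s * ln (f s / m))"
  proof (rule sum_strict_mono_ex1[OF S(1)])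
    show "\<forall>t\<in>S. f t - m \<le> f t * ln (f t / m)" using f m by (intro ballI diff_le_mult_ln) auto
    have "f s - m < f s * ln (f s / m)" using s f m by (intro diff_less_mult_ln) auto
    then show "\<exists>t\<in>S. f t - m < f t * ln (f t / m)" using s by blast
  qed
  then have "0 < rent S f (\<lambda>_. m)" using sm by (simp add: rent_def sum_subtractf)
  then show ?thesis unfolding Ent_eq_rent[OF S f] m_def[symmetric] using c by simp
qed

lemma Ent_nonneg:
  assumes S: "finite S" "S \<noteq> {}" and f: "\<forall>s\<in>S. 0 \<le> f s"
  shows "0 \<le> Ent S f"
proof -
  have "0 \<le> rent S f (\<lambda>_. avg S f)"
  proof (rule rent_nonneg[OF S(1) f])
    show "\<forall>s\<in>S. 0 \<le> avg S f" using avg_nonneg[OF f] by simp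
    show "\<forall>s\<in>S. avg S f = 0 \<longrightarrow> f s = 0"
      using S f by (auto simp: avg_def sum_nonneg_eq_0_iff)
    show "(\<Sum>s\<in>S. avg S f) \<le> (\<Sum>s\<in>S. f s)" using S by (simp add: avg_def)
  qed
  then show ?thesis unfolding Ent_eq_rent[OF S f] by simp
qed

section \<open>One step of the block dynamics\<close>

lemma tree_verts_nonempty: "tree_verts \<Delta> n \<noteq> {}"
  by (auto simp: tree_verts_def intro: exI[of _ "[]"])

text \<open>For a fixed vertex the kernel is uniform on the fibre of \<open>\<sigma>\<close>, so its
  action on functions is a conditional expectation, and the transition matrix is the average of
  these projections.\<close>

lemma transition_block_dynamics:
  assumes \<sigma>: "\<sigma> \<in> colorings \<Delta> k n"
  shows "transition_op (colorings \<Delta> k n) (block_dynamics \<Delta> k n l) f \<sigma> =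
    avg (tree_verts \<Delta> n) (\<lambda>v. resample \<Delta> k n (block \<Delta> n l v) f \<sigma>)"
proof -
  define fib where "fib v = {\<tau> \<in> colorings \<Delta> k n. \<forall>w \<in> tree_verts \<Delta> n - block \<Delta> n l v. \<tau> w = \<sigma> w}" for v
  have fib: "finite (fib v)" "fib v \<noteq> {}" for v using \<sigma> finite_colorings by (auto simp: fib_def)
  have "transition_op (colorings \<Delta> k n) (block_dynamics \<Delta> k n l) f \<sigma> =
      (\<Sum>\<tau>\<in>colorings \<Delta> k n. (\<Sum>v\<in>tree_verts \<Delta> n. pmf (pmf_of_set (fib v)) \<tau>) / card (tree_verts \<Delta> n) * f \<tau>)"
    unfolding transition_op_def block_dynamics_def fib_def
    by (simp add: pmf_bind_pmf_of_set[OF tree_verts_nonempty finite_tree_verts])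
  also have "\<dots> = (\<Sum>\<tau>\<in>colorings \<Delta> k n. \<Sum>v\<in>tree_verts \<Delta> n. pmf (pmf_of_set (fib v)) \<tau> * f \<tau>) / card (tree_verts \<Delta> n)"
    by (simp add: sum_distrib_right sum_divide_distrib)
  also have "(\<Sum>\<tau>\<in>colorings \<Delta> k n. \<Sum>v\<in>tree_verts \<Delta> n. pmf (pmf_of_set (fib v)) \<tau> * f \<tau>) =
      (\<Sum>v\<in>tree_verts \<Delta> n. \<Sum>\<tau>\<in>colorings \<Delta> k n. pmf (pmf_of_set (fib v)) \<tau> * f \<tau>)"
    by (rule sum.swap)
  also have "\<dots> = (\<Sum>v\<in>tree_verts \<Delta> n. avg (fib v) f)"
  proof (rule sum.cong[OF refl])
    fix v
    have "(\<Sum>\<tau>\<in>colorings \<Delta> k n. pmf (pmf_of_set (fib v)) \<tau> * f \<tau>) = (\<Sum>\<tau>\<in>fib v. pmf (pmf_of_set (fib v)) \<tau> * f \<tau>)"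
      using fib finite_colorings by (intro sum.mono_neutral_right) (auto simp: fib_def pmf_of_set)
    also have "\<dots> = (\<Sum>\<tau>\<in>fib v. f \<tau> / card (fib v))" using fib by (intro sum.cong) (auto simp: pmf_of_set)
    finally show "(\<Sum>\<tau>\<in>colorings \<Delta> k n. pmf (pmf_of_set (fib v)) \<tau> * f \<tau>) = avg (fib v) f"
      by (simp add: avg_def sum_divide_distrib)
  qed
  finally show ?thesis by (simp add: avg_def[of "tree_verts \<Delta> n"] resample_def cexp_def agree_off_iff fib_def)
qed

text \<open>Jensen's inequality for x ln x, read off from the nonnegativity of the entropy of
  \<open>a\<close> on the index set \<open>A\<close>.\<close>

lemma xlnx_avg_le:
  assumes A: "finite A" "A \<noteq> {}" and a: "\<forall>v\<in>A. 0 \<le> a v"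
  shows "avg A a * ln (avg A a) \<le> avg A (\<lambda>v. a v * ln (a v))"
  using Ent_nonneg[OF assms] by (simp add: Ent_eq[OF A])

text \<open>By convexity, the entropy after a step is at most the mean over \<open>v\<close> of the
  entropy after resampling the block of \<open>v\<close>. Each such update loses its block entropy,
  and these losses add up to at least a quarter of the whole entropy.\<close>

lemma Ent_transition_le:
  fixes \<beta> :: real
  assumes adm: "admissible k \<Delta> \<beta>" and f: "\<forall>\<sigma>\<in>colorings \<Delta> k n. 0 \<le> f \<sigma>"
  shows "Ent (colorings \<Delta> k n) (transition_op (colorings \<Delta> k n) (block_dynamics \<Delta> k n 3) f)
    \<le> (1 - 1 / (4 * real (card (tree_verts \<Delta> n)))) * Ent (colorings \<Delta> k n) f"
proof -
  let ?\<Omega> = "colorings \<Delta> k n" and ?T = "tree_verts \<Delta> n"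
  let ?P = "transition_op ?\<Omega> (block_dynamics \<Delta> k n 3) f"
  let ?E = "\<lambda>v. resample \<Delta> k n (block \<Delta> n 3 v) f"
  have k: "4 \<le> k" using adm by (simp add: admissible_def Let_def)
  have \<Omega>: "finite ?\<Omega>" "?\<Omega> \<noteq> {}" using finite_colorings colorings_root_uniform[OF k] by auto
  have c: "real (card ?\<Omega>) > 0" using \<Omega> by (simp add: card_gt_0_iff)
  have T: "finite ?T" "?T \<noteq> {}" by (rule finite_tree_verts tree_verts_nonempty)+
  have N: "real (card ?T) > 0" using T by (simp add: card_gt_0_iff)
  have E0: "0 \<le> ?E v \<sigma>" for v \<sigma> using resample_nonneg[OF f] .
  have swap: "avg ?\<Omega> (\<lambda>\<sigma>. avg ?T (\<lambda>v. h v \<sigma>)) = avg ?T (\<lambda>v. avg ?\<Omega> (h v))" for h :: "vertex \<Rightarrow> coloring \<Rightarrow> real"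
    unfolding avg_def sum_divide_distrib[symmetric] by (subst sum.swap) (simp add: sum_divide_distrib[symmetric])
  have mean: "avg ?\<Omega> ?P = avg ?\<Omega> f"
  proof -
    have "avg ?\<Omega> ?P = avg ?\<Omega> (\<lambda>\<sigma>. avg ?T (\<lambda>v. ?E v \<sigma>))"
      by (rule avg_cong) (rule transition_block_dynamics)
    also have "\<dots> = avg ?T (\<lambda>v. avg ?\<Omega> (?E v))" by (rule swap)
    also have "\<dots> = avg ?T (\<lambda>v. avg ?\<Omega> f)"
      unfolding resample_def by (intro avg_cong avg_cexp \<Omega>(1))
    also have "\<dots> = avg ?\<Omega> f" by (rule avg_const[OF T])
    finally show ?thesis .
  qed
  have "avg ?\<Omega> (\<lambda>\<sigma>. ?P \<sigma> * ln (?P \<sigma>)) \<le> avg ?\<Omega> (\<lambda>\<sigma>. avg ?T (\<lambda>v. ?E v \<sigma> * ln (?E v \<sigma>)))"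
  proof (rule avg_mono)
    fix \<sigma> assume "\<sigma> \<in> ?\<Omega>"
    then show "?P \<sigma> * ln (?P \<sigma>) \<le> avg ?T (\<lambda>v. ?E v \<sigma> * ln (?E v \<sigma>))"
      using xlnx_avg_le[OF T, of "\<lambda>v. ?E v \<sigma>"] E0 by (simp add: transition_block_dynamics)
  qed
  also have "\<dots> = avg ?T (\<lambda>v. avg ?\<Omega> (\<lambda>\<sigma>. ?E v \<sigma> * ln (?E v \<sigma>)))" by (rule swap)
  also have "\<dots> = avg ?T (\<lambda>v. (xent ?\<Omega> f - block_entropy \<Delta> k n 3 f v) / card ?\<Omega>)"
    by (intro avg_cong) (simp add: block_entropy_def avg_def xent_def)
  also have "\<dots> = (xent ?\<Omega> f - (\<Sum>v\<in>?T. block_entropy \<Delta> k n 3 f v) / card ?T) / card ?\<Omega>"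
    using N c by (simp add: avg_def sum_divide_distrib[symmetric] sum_subtractf field_simps)
  finally have 1: "avg ?\<Omega> (\<lambda>\<sigma>. ?P \<sigma> * ln (?P \<sigma>)) \<le> \<dots>" .
  have full: "resample \<Delta> k n ?T f \<sigma> = avg ?\<Omega> f" for \<sigma>
    by (simp add: resample_def cexp_def agree_off_iff)
  have EntX: "Ent ?\<Omega> f * card ?\<Omega> = xent ?\<Omega> f - xent ?\<Omega> (resample \<Delta> k n ?T f)"
    using c by (simp add: Ent_eq[OF \<Omega>] full xent_def avg_def left_diff_distrib)
  have "Ent ?\<Omega> f * card ?\<Omega> \<le> 4 * (\<Sum>x\<in>?T. block_entropy \<Delta> k n 3 f x)"
    unfolding EntX by (rule entropy_le_block_entropies[OF adm f])
  then have 2: "Ent ?\<Omega> f / (4 * real (card ?T)) \<le> (\<Sum>v\<in>?T. block_entropy \<Delta> k n 3 f v) / card ?T / card ?\<Omega>"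
    using N c by (simp add: field_simps)
  have "Ent ?\<Omega> ?P = avg ?\<Omega> (\<lambda>\<sigma>. ?P \<sigma> * ln (?P \<sigma>)) - avg ?\<Omega> f * ln (avg ?\<Omega> f)"
    by (simp add: Ent_eq[OF \<Omega>] mean)
  also have "\<dots> \<le> (xent ?\<Omega> f - (\<Sum>v\<in>?T. block_entropy \<Delta> k n 3 f v) / card ?T) / card ?\<Omega> - avg ?\<Omega> f * ln (avg ?\<Omega> f)"
    using 1 by simp
  also have "\<dots> = Ent ?\<Omega> f - (\<Sum>v\<in>?T. block_entropy \<Delta> k n 3 f v) / card ?T / card ?\<Omega>"
    by (simp add: Ent_eq[OF \<Omega>] avg_def[of _ "\<lambda>\<sigma>. f \<sigma> * ln (f \<sigma>)"] xent_def diff_divide_distrib)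
  also have "\<dots> \<le> Ent ?\<Omega> f - Ent ?\<Omega> f / (4 * real (card ?T))" using 2 by simp
  also have "\<dots> = (1 - 1 / (4 * real (card ?T))) * Ent ?\<Omega> f" by (simp add: left_diff_distrib)
  finally show ?thesis .
qed

lemma card_colorings_ge_2: "4 \<le> k \<Longrightarrow> 2 \<le> card (colorings \<Delta> k n)"
proof -
  assume k: "4 \<le> k"
  have "colorings \<Delta> k n \<noteq> {}" and u: "k * card {\<tau>\<in>colorings \<Delta> k n. \<tau> [] = 1} = card (colorings \<Delta> k n)"
    using colorings_root_uniform[OF k, of \<Delta> n] k by auto
  then have "0 < card (colorings \<Delta> k n)" using finite_colorings by (simp add: card_gt_0_iff)
  then have "1 \<le> card {\<tau>\<in>colorings \<Delta> k n. \<tau> [] = 1}" using u by (cases "card {\<tau>\<in>colorings \<Delta> k n. \<tau> [] = 1}") auto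
  then have "k * 1 \<le> card (colorings \<Delta> k n)" unfolding u[symmetric] by (rule mult_le_mono2)
  then show ?thesis using k by simp
qed

lemma entropy_constant_ge:
  fixes \<beta> :: real
  assumes adm: "admissible k \<Delta> \<beta>"
  shows "1 / (4 * real (card (tree_verts \<Delta> n))) \<le> entropy_constant (colorings \<Delta> k n) (block_dynamics \<Delta> k n 3)"
  unfolding entropy_constant_def
proof (rule cInf_greatest)
  let ?\<Omega> = "colorings \<Delta> k n"
  have k: "4 \<le> k" using adm by (simp add: admissible_def Let_def)
  have \<Omega>: "finite ?\<Omega>" "?\<Omega> \<noteq> {}" using finite_colorings colorings_root_uniform[OF k] by auto
  \<comment> \<open>The infimum is taken over a nonempty set: with two colorings available, the
    indicator of one of them is not constant.\<close>
  obtain \<sigma> \<tau> where st: "\<sigma> \<in> ?\<Omega>" "\<tau> \<in> ?\<Omega>" "\<sigma> \<noteq> \<tau>"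
    using card_colorings_ge_2[OF k, of \<Delta> n] card_le_Suc0_iff_eq[OF \<Omega>(1)] by fastforce
  have "\<not> (\<lambda>x. of_bool (x = \<sigma>) :: real) constant_on ?\<Omega>"
  proof
    assume "(\<lambda>x. of_bool (x = \<sigma>) :: real) constant_on ?\<Omega>"
    then obtain z where "\<forall>x\<in>?\<Omega>. of_bool (x = \<sigma>) = (z::real)" by (auto simp: constant_on_def)
    then have "of_bool (\<sigma> = \<sigma>) = (of_bool (\<tau> = \<sigma>) :: real)" using st by metis
    then show False using st by simp
  qed
  moreover have "\<forall>s\<in>?\<Omega>. (0::real) \<le> of_bool (s = \<sigma>)" by simp
  ultimately have "\<exists>f :: coloring \<Rightarrow> real. (\<forall>s\<in>?\<Omega>. 0 \<le> f s) \<and> \<not> f constant_on ?\<Omega>"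
    by (intro exI[of _ "\<lambda>x. of_bool (x = \<sigma>)"] conjI)
  then show "{(Ent ?\<Omega> f - Ent ?\<Omega> (transition_op ?\<Omega> (block_dynamics \<Delta> k n 3) f)) / Ent ?\<Omega> f |f.
      (\<forall>s\<in>?\<Omega>. 0 \<le> f s) \<and> \<not> f constant_on ?\<Omega>} \<noteq> {}" by simp
  fix z assume "z \<in> {(Ent ?\<Omega> f - Ent ?\<Omega> (transition_op ?\<Omega> (block_dynamics \<Delta> k n 3) f)) / Ent ?\<Omega> f |f.
      (\<forall>s\<in>?\<Omega>. 0 \<le> f s) \<and> \<not> f constant_on ?\<Omega>}"
  then obtain f where z: "z = (Ent ?\<Omega> f - Ent ?\<Omega> (transition_op ?\<Omega> (block_dynamics \<Delta> k n 3) f)) / Ent ?\<Omega> f"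
    and f: "\<forall>s\<in>?\<Omega>. 0 \<le> f s" "\<not> f constant_on ?\<Omega>" by blast
  have "0 < Ent ?\<Omega> f" by (rule Ent_pos[OF \<Omega> f])
  moreover have "1 / (4 * real (card (tree_verts \<Delta> n))) * Ent ?\<Omega> f \<le> Ent ?\<Omega> f - Ent ?\<Omega> (transition_op ?\<Omega> (block_dynamics \<Delta> k n 3) f)"
    using Ent_transition_le[OF adm f(1)] by (simp add: left_diff_distrib)
  ultimately show "1 / (4 * real (card (tree_verts \<Delta> n))) \<le> z" unfolding z by (simp only: pos_le_divide_eq)
qed

section \<open>The mixing time\<close>

text \<open>A weak form of Pinsker's inequality: the squared Hellinger distance is at most the entropy.\<close>

lemma tv_le_sqrt_Ent:
  assumes S: "finite S" "S \<noteq> {}" and f: "\<forall>s\<in>S. 0 \<le> f s" and mean: "avg S f = 1"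
  shows "avg S (\<lambda>s. \<bar>f s - 1\<bar>) / 2 \<le> sqrt (Ent S f)"
proof -
  have "2 * f s - 2 * sqrt (f s) \<le> f s * ln (f s)" if s: "s \<in> S" for s
  proof (cases "f s = 0")
    case False
    then have p: "0 < f s" using f s by force
    have "sqrt (f s) * sqrt (f s) = f s" using p by simp
    \<comment> \<open>The tangent-line inequality for the square root against 1, then multiplied by
      twice the root. On average it bounds the entropy below by 2 minus twice the mean root, the
      mean square of \<open>sqrt (f s) - 1\<close>.\<close>
    have "sqrt (f s) - 1 \<le> sqrt (f s) * ln (sqrt (f s) / 1)" using p by (intro diff_le_mult_ln) auto
    then have "2 * sqrt (f s) * (sqrt (f s) - 1) \<le> 2 * sqrt (f s) * (sqrt (f s) * ln (sqrt (f s)))"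
      using p by (intro mult_left_mono) auto
    also have "\<dots> = 2 * (sqrt (f s) * sqrt (f s)) * ln (sqrt (f s))" by simp
    also have "\<dots> = f s * ln (f s)" using p by (simp add: ln_sqrt)
    finally show ?thesis using \<open>sqrt (f s) * sqrt (f s) = f s\<close> by (simp add: right_diff_distrib mult.assoc)
  qed simp
  then have "avg S (\<lambda>s. 2 * f s - 2 * sqrt (f s)) \<le> avg S (\<lambda>s. f s * ln (f s))" by (rule avg_mono)
  then have ent: "2 - 2 * avg S (\<lambda>s. sqrt (f s)) \<le> Ent S f"
    unfolding avg_diff avg_cmult using mean by (simp add: Ent_eq[OF S])
  let ?q = "avg S (\<lambda>s. sqrt (f s))"
  have q: "0 \<le> ?q" using f by (intro avg_nonneg) auto
  have c: "real (card S) > 0" using S by (simp add: card_gt_0_iff)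
  have sq: "avg S (\<lambda>s. (sqrt (f s) - 1)\<^sup>2) = 2 - 2 * ?q" "avg S (\<lambda>s. (sqrt (f s) + 1)\<^sup>2) = 2 + 2 * ?q"
  proof -
    have "avg S (\<lambda>s. (sqrt (f s) - 1)\<^sup>2) = avg S (\<lambda>s. f s + 1 - 2 * sqrt (f s))"
      using f by (intro avg_cong) (auto simp: power2_diff)
    also have "\<dots> = 2 - 2 * ?q" unfolding avg_add avg_diff avg_cmult using mean avg_const[OF S] by simp
    finally show "avg S (\<lambda>s. (sqrt (f s) - 1)\<^sup>2) = 2 - 2 * ?q" .
    have "avg S (\<lambda>s. (sqrt (f s) + 1)\<^sup>2) = avg S (\<lambda>s. f s + 1 + 2 * sqrt (f s))"
      using f by (intro avg_cong) (auto simp: power2_sum)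
    also have "\<dots> = 2 + 2 * ?q" unfolding avg_add avg_cmult using mean avg_const[OF S] by simp
    finally show "avg S (\<lambda>s. (sqrt (f s) + 1)\<^sup>2) = 2 + 2 * ?q" .
  qed
  have "0 \<le> avg S (\<lambda>s. (sqrt (f s) - 1)\<^sup>2)" by (rule avg_nonneg) simp
  then have q1: "?q \<le> 1" using sq by simp
  \<comment> \<open>Cauchy-Schwarz for the factorisation of f - 1 into sqrt f - 1 and sqrt f + 1;
    the second factor has mean square at most 4.\<close>
  have "(\<Sum>s\<in>S. \<bar>f s - 1\<bar>)\<^sup>2 = (\<Sum>s\<in>S. \<bar>sqrt (f s) - 1\<bar> * \<bar>sqrt (f s) + 1\<bar>)\<^sup>2"
  proof -
    have "\<bar>f s - 1\<bar> = \<bar>sqrt (f s) - 1\<bar> * \<bar>sqrt (f s) + 1\<bar>" if "s \<in> S" for s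
    proof -
      have "f s - 1 = (sqrt (f s) - 1) * (sqrt (f s) + 1)" using f that by (simp add: algebra_simps)
      then show ?thesis by (metis abs_mult)
    qed
    then show ?thesis by simp
  qed
  also have "\<dots> \<le> (\<Sum>s\<in>S. \<bar>sqrt (f s) - 1\<bar>\<^sup>2) * (\<Sum>s\<in>S. \<bar>sqrt (f s) + 1\<bar>\<^sup>2)"
    by (rule Cauchy_Schwarz_ineq_sum)
  also have "\<dots> = (card S * avg S (\<lambda>s. (sqrt (f s) - 1)\<^sup>2)) * (card S * avg S (\<lambda>s. (sqrt (f s) + 1)\<^sup>2))"
    using c by (simp add: avg_def)
  also have "\<dots> = (card S)\<^sup>2 * ((2 - 2 * ?q) * (2 + 2 * ?q))" unfolding sq by (simp add: power2_eq_square)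
  also have "\<dots> \<le> (card S)\<^sup>2 * (Ent S f * 4)"
    using q q1 ent by (intro mult_left_mono mult_mono) auto
  also have "\<dots> = (2 * card S)\<^sup>2 * Ent S f" by (simp add: power2_eq_square)
  finally have "\<bar>\<Sum>s\<in>S. \<bar>f s - 1\<bar>\<bar> \<le> sqrt ((2 * card S)\<^sup>2 * Ent S f)"
    by (subst real_sqrt_abs[symmetric]) (rule real_sqrt_le_mono)
  then have "(\<Sum>s\<in>S. \<bar>f s - 1\<bar>) \<le> 2 * card S * sqrt (Ent S f)"
    by (simp add: real_sqrt_mult abs_of_nonneg sum_nonneg)
  then show ?thesis using c by (simp add: avg_def field_simps)
qed

section \<open>Reversibility and the evolution of densities\<close>

lemma block_dynamics_pmf:
  assumes \<sigma>: "\<sigma> \<in> colorings \<Delta> k n"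
  shows "pmf (block_dynamics \<Delta> k n l \<sigma>) \<tau> = (\<Sum>v\<in>tree_verts \<Delta> n.
    of_bool (\<tau> \<in> colorings \<Delta> k n \<and> agree_off \<Delta> n (block \<Delta> n l v) \<tau> = agree_off \<Delta> n (block \<Delta> n l v) \<sigma>)
    / card {\<rho>\<in>colorings \<Delta> k n. agree_off \<Delta> n (block \<Delta> n l v) \<rho> = agree_off \<Delta> n (block \<Delta> n l v) \<sigma>}) / card (tree_verts \<Delta> n)"
proof -
  let ?fib = "\<lambda>v. {\<rho>\<in>colorings \<Delta> k n. agree_off \<Delta> n (block \<Delta> n l v) \<rho> = agree_off \<Delta> n (block \<Delta> n l v) \<sigma>}"
  have fib: "finite (?fib v)" "?fib v \<noteq> {}" for v using \<sigma> finite_colorings by auto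
  have 1: "pmf (block_dynamics \<Delta> k n l \<sigma>) \<tau> =
      (\<Sum>v\<in>tree_verts \<Delta> n. pmf (pmf_of_set (?fib v)) \<tau>) / card (tree_verts \<Delta> n)"
    unfolding block_dynamics_def agree_off_iff
    by (simp add: pmf_bind_pmf_of_set[OF tree_verts_nonempty finite_tree_verts])
  have 2: "pmf (pmf_of_set (?fib v)) \<tau> = of_bool (\<tau> \<in> ?fib v) / card (?fib v)" for v
    using fib by (simp add: pmf_of_set indicator_def of_bool_def)
  show ?thesis unfolding 1 2 by (simp only: mem_Collect_eq)
qed

text \<open>Agreement off a block is an equivalence relation, and equivalent colorings have the same
  fibre. Symmetry means reversibility for the uniform law, so the density of the chain evolves under
  the same operator that acts on functions.\<close>

lemma block_dynamics_sym:
  assumes "\<sigma> \<in> colorings \<Delta> k n" "\<tau> \<in> colorings \<Delta> k n"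
  shows "pmf (block_dynamics \<Delta> k n l \<sigma>) \<tau> = pmf (block_dynamics \<Delta> k n l \<tau>) \<sigma>"
  unfolding block_dynamics_pmf[OF assms(1)] block_dynamics_pmf[OF assms(2)]
proof (rule arg_cong2[where f = "(/)", OF _ refl], rule sum.cong[OF refl])
  fix v
  let ?a = "agree_off \<Delta> n (block \<Delta> n l v)"
  show "of_bool (\<tau> \<in> colorings \<Delta> k n \<and> ?a \<tau> = ?a \<sigma>) / real (card {\<rho>\<in>colorings \<Delta> k n. ?a \<rho> = ?a \<sigma>}) =
      of_bool (\<sigma> \<in> colorings \<Delta> k n \<and> ?a \<sigma> = ?a \<tau>) / real (card {\<rho>\<in>colorings \<Delta> k n. ?a \<rho> = ?a \<tau>})"
    using assms by (cases "?a \<tau> = ?a \<sigma>") auto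
qed

lemma set_block_dynamics:
  assumes \<sigma>: "\<sigma> \<in> colorings \<Delta> k n"
  shows "set_pmf (block_dynamics \<Delta> k n l \<sigma>) \<subseteq> colorings \<Delta> k n"
proof
  fix \<tau> assume "\<tau> \<in> set_pmf (block_dynamics \<Delta> k n l \<sigma>)"
  then have "pmf (block_dynamics \<Delta> k n l \<sigma>) \<tau> \<noteq> 0" by (simp add: set_pmf_iff)
  then show "\<tau> \<in> colorings \<Delta> k n"
    unfolding block_dynamics_pmf[OF \<sigma>] by (rule contrapos_np) (simp add: sum.neutral)
qed

lemma chain_dist_Suc: "chain_dist K (Suc t) s = bind_pmf (chain_dist K t s) K"
  by (simp add: chain_dist_def)

lemma chain_density:
  assumes s: "s \<in> colorings \<Delta> k n"
  shows "set_pmf (chain_dist (block_dynamics \<Delta> k n l) t s) \<subseteq> colorings \<Delta> k n"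
    and "\<tau> \<in> colorings \<Delta> k n \<Longrightarrow> pmf (chain_dist (block_dynamics \<Delta> k n l) (Suc t) s) \<tau> =
      transition_op (colorings \<Delta> k n) (block_dynamics \<Delta> k n l) (pmf (chain_dist (block_dynamics \<Delta> k n l) t s)) \<tau>"
proof -
  let ?K = "block_dynamics \<Delta> k n l" and ?\<Omega> = "colorings \<Delta> k n"
  show sub: "set_pmf (chain_dist ?K t s) \<subseteq> ?\<Omega>"
  proof (induction t)
    case 0
    then show ?case using s by (simp add: chain_dist_def)
  next
    case (Suc t)
    then show ?case unfolding chain_dist_Suc set_bind_pmf using set_block_dynamics by blast
  qed
  assume \<tau>: "\<tau> \<in> ?\<Omega>"
  have "pmf (chain_dist ?K (Suc t) s) \<tau> = (\<Sum>\<sigma>\<in>?\<Omega>. pmf (?K \<sigma>) \<tau> * pmf (chain_dist ?K t s) \<sigma>)"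
    unfolding chain_dist_Suc pmf_bind using sub
    by (subst integral_measure_pmf[OF finite_colorings[of \<Delta> k n]]) (auto simp: mult.commute)
  also have "\<dots> = (\<Sum>\<sigma>\<in>?\<Omega>. pmf (?K \<tau>) \<sigma> * pmf (chain_dist ?K t s) \<sigma>)"
    using \<tau> by (intro sum.cong) (auto simp: block_dynamics_sym)
  finally show "pmf (chain_dist ?K (Suc t) s) \<tau> = transition_op ?\<Omega> ?K (pmf (chain_dist ?K t s)) \<tau>"
    by (simp add: transition_op_def)
qed

lemma Ent_cong: "finite S \<Longrightarrow> S \<noteq> {} \<Longrightarrow> (\<And>s. s \<in> S \<Longrightarrow> f s = g s) \<Longrightarrow> Ent S f = Ent S g"
  by (simp add: Ent_eq cong: avg_cong)

text \<open>The density of the chain relative to the uniform law starts with entropy ln of the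
  number of colorings, at most N ln k, and each step multiplies it by at most 1 - 1/(4N).\<close>

lemma mixing_time_le:
  fixes \<beta> :: real
  assumes adm: "admissible k \<Delta> \<beta>"
    and t: "4 * real (card (tree_verts \<Delta> n)) * ln (4 * (exp 1)\<^sup>2 * (card (tree_verts \<Delta> n) * ln k) + 1) \<le> t"
  shows "mixing_time (colorings \<Delta> k n) (block_dynamics \<Delta> k n 3) \<le> enat t"
  unfolding mixing_time_def
proof (rule SUP_least)
  let ?\<Omega> = "colorings \<Delta> k n" and ?T = "tree_verts \<Delta> n" and ?K = "block_dynamics \<Delta> k n 3"
  fix s assume s: "s \<in> ?\<Omega>"
  define N where "N = real (card ?T)"
  have k: "4 \<le> k" using adm by (simp add: admissible_def Let_def)
  have \<Omega>: "finite ?\<Omega>" "?\<Omega> \<noteq> {}" using finite_colorings s by auto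
  have c: "real (card ?\<Omega>) > 0" using \<Omega> by (simp add: card_gt_0_iff)
  have N: "1 \<le> N" using finite_tree_verts[of \<Delta> n] tree_verts_nonempty[of \<Delta> n]
    by (simp add: N_def Suc_le_eq card_gt_0_iff)
  define F where "F t \<sigma> = card ?\<Omega> * pmf (chain_dist ?K t s) \<sigma>" for t \<sigma>
  have F0: "\<forall>\<sigma>\<in>?\<Omega>. 0 \<le> F t \<sigma>" for t by (simp add: F_def)
  have Fm: "avg ?\<Omega> (F t) = 1" for t
    using sum_pmf_eq_1[OF \<Omega>(1) chain_density(1)[OF s]] c by (simp add: F_def avg_def flip: sum_distrib_left)
  have step: "Ent ?\<Omega> (F (Suc t)) \<le> (1 - 1 / (4 * N)) * Ent ?\<Omega> (F t)" for t
  proof -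
    have "F (Suc t) \<sigma> = transition_op ?\<Omega> ?K (F t) \<sigma>" if "\<sigma> \<in> ?\<Omega>" for \<sigma>
      using chain_density(2)[OF s that] by (simp add: F_def transition_op_def sum_distrib_left mult.left_commute)
    then have "Ent ?\<Omega> (F (Suc t)) = Ent ?\<Omega> (transition_op ?\<Omega> ?K (F t))" by (rule Ent_cong[OF \<Omega>])
    also have "\<dots> \<le> (1 - 1 / (4 * N)) * Ent ?\<Omega> (F t)"
      unfolding N_def by (rule Ent_transition_le[OF adm F0])
    finally show ?thesis .
  qed
  have r: "0 \<le> 1 - 1 / (4 * N)" using N by (simp add: field_simps)
  have iter: "Ent ?\<Omega> (F t) \<le> (1 - 1 / (4 * N)) ^ t * Ent ?\<Omega> (F 0)" for t
  proof (induction t)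
    case (Suc t)
    have "(1 - 1 / (4 * N)) * Ent ?\<Omega> (F t) \<le> (1 - 1 / (4 * N)) * ((1 - 1 / (4 * N)) ^ t * Ent ?\<Omega> (F 0))"
      by (rule mult_left_mono[OF Suc r])
    then show ?case using step[of t] by simp
  qed simp
  have "Ent ?\<Omega> (F 0) = ln (card ?\<Omega>)"
  proof -
    have "F 0 \<sigma> = card ?\<Omega> * of_bool (\<sigma> = s)" for \<sigma> by (simp add: F_def chain_dist_def indicator_def)
    then have "(\<Sum>\<sigma>\<in>?\<Omega>. F 0 \<sigma> * ln (F 0 \<sigma>)) = (\<Sum>\<sigma>\<in>?\<Omega>. if \<sigma> = s then card ?\<Omega> * ln (card ?\<Omega>) else 0)"
      by (intro sum.cong) auto
    also have "\<dots> = card ?\<Omega> * ln (card ?\<Omega>)" using \<Omega> s by (simp add: sum.delta)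
    finally have "avg ?\<Omega> (\<lambda>\<sigma>. F 0 \<sigma> * ln (F 0 \<sigma>)) = ln (card ?\<Omega>)" using c by (simp add: avg_def)
    then show ?thesis by (simp add: Ent_eq[OF \<Omega>] Fm)
  qed
  also have "\<dots> \<le> N * ln k"
  proof -
    have "card ?\<Omega> \<le> card (?T \<rightarrow>\<^sub>E {1..k})"
      using finite_tree_verts by (intro card_mono finite_PiE) (auto simp: colorings_def)
    also have "\<dots> = k ^ card ?T" using finite_tree_verts by (simp add: card_PiE)
    finally have "real (card ?\<Omega>) \<le> real k ^ card ?T" by (metis of_nat_le_iff of_nat_power)
    then have "ln (card ?\<Omega>) \<le> ln (real k ^ card ?T)"
      using c k by (subst ln_le_cancel_iff) simp_all
    then show ?thesis using k by (simp add: ln_realpow N_def)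
  qed
  finally have E0: "Ent ?\<Omega> (F 0) \<le> N * ln k" .
  \<comment> \<open>The factor 4 e^2 brings N ln k / Q below the square of 1/(2e), the threshold in
    the definition of the mixing time; the summand 1 gives Q \<ge> 1 at once.\<close>
  define Q where "Q = 4 * (exp 1)\<^sup>2 * (N * ln k) + 1"
  have lk: "0 \<le> N * ln k" using N k by simp
  have Q: "1 \<le> Q" using lk by (simp add: Q_def)
  have "(1 - 1 / (4 * N)) ^ t \<le> exp (- 1 / (4 * N)) ^ t"
    using r exp_ge_add_one_self[of "- 1 / (4 * N)"] by (intro power_mono) auto
  also have "\<dots> = exp (- t / (4 * N))" by (simp add: exp_of_nat_mult[symmetric])
  also have "\<dots> \<le> exp (- ln Q)"
  proof -
    have "4 * N * ln Q \<le> t" using t by (simp add: N_def Q_def)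
    then have "ln Q \<le> t / (4 * N)" using N by (simp add: field_simps)
    then show ?thesis by simp
  qed
  also have "\<dots> = 1 / Q" using Q by (simp add: exp_minus field_simps)
  finally have "(1 - 1 / (4 * N)) ^ t * Ent ?\<Omega> (F 0) \<le> 1 / Q * (N * ln k)"
    using E0 Q r Ent_nonneg[OF \<Omega> F0] by (intro mult_mono) auto
  also have "\<dots> \<le> (1 / (2 * exp 1))\<^sup>2"
  proof -
    have "N * ln k * (4 * (exp 1)\<^sup>2) \<le> Q" by (simp add: Q_def)
    then show ?thesis using Q by (simp add: power_divide power_mult_distrib field_simps)
  qed
  finally have "Ent ?\<Omega> (F t) \<le> (1 / (2 * exp 1))\<^sup>2" using iter[of t] by linarith
  then have "sqrt (Ent ?\<Omega> (F t)) \<le> sqrt ((1 / (2 * exp 1))\<^sup>2)" by (rule real_sqrt_le_mono)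
  then have sE: "sqrt (Ent ?\<Omega> (F t)) \<le> 1 / (2 * exp 1)" by simp
  have "tv_dist ?\<Omega> (chain_dist ?K t s) (pmf_of_set ?\<Omega>) = avg ?\<Omega> (\<lambda>\<sigma>. \<bar>F t \<sigma> - 1\<bar>) / 2"
  proof -
    have "\<bar>pmf (chain_dist ?K t s) \<sigma> - pmf (pmf_of_set ?\<Omega>) \<sigma>\<bar> = \<bar>F t \<sigma> - 1\<bar> / card ?\<Omega>" if "\<sigma> \<in> ?\<Omega>" for \<sigma>
    proof -
      have "pmf (chain_dist ?K t s) \<sigma> - pmf (pmf_of_set ?\<Omega>) \<sigma> = (F t \<sigma> - 1) / card ?\<Omega>"
        using that \<Omega> c by (simp add: F_def pmf_of_set diff_divide_distrib)
      then show ?thesis using c by (simp add: abs_divide)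
    qed
    then show ?thesis by (simp add: tv_dist_def avg_def sum_divide_distrib)
  qed
  also have "\<dots> \<le> 1 / (2 * exp 1)" using tv_le_sqrt_Ent[OF \<Omega> F0 Fm, of t] sE by linarith
  finally show "Inf {enat t |t. tv_dist ?\<Omega> (chain_dist ?K t s) (pmf_of_set ?\<Omega>) \<le> 1 / (2 * exp 1)} \<le> enat t"
    by (intro Inf_lower) blast
qed

section \<open>Growth of the mixing time with the size of the tree\<close>

lemma card_tree_verts_ge:
  assumes "1 \<le> \<Delta>"
  shows "n < card (tree_verts \<Delta> n)"
proof -
  have "(\<lambda>j. replicate j (0::nat)) ` {..n} \<subseteq> tree_verts \<Delta> n" using assms by (auto simp: tree_verts_def)
  then have "card ((\<lambda>j. replicate j (0::nat)) ` {..n}) \<le> card (tree_verts \<Delta> n)"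
    by (intro card_mono finite_tree_verts)
  moreover have "inj_on (\<lambda>j. replicate j (0::nat)) {..n}" by (intro inj_onI) (metis length_replicate)
  ultimately show ?thesis by (simp add: card_image)
qed

text \<open>The asymptotics are for growing depth with \<Delta> and \<open>k\<close> fixed, so ln k
  is part of the constant \<open>c\<close>. The bound depends on \<open>n\<close> only through the
  number of vertices, which tends to infinity because \<open>1 \<le> \<Delta>\<close>.\<close>

lemma mixing_time_bound:
  fixes \<beta> :: real
  assumes adm: "admissible k \<Delta> \<beta>" and \<Delta>: "1 \<le> \<Delta>"
  shows "mixing_time (colorings \<Delta> k n) (block_dynamics \<Delta> k n 3) < \<infinity>"
    and "(\<lambda>n. real (the_enat (mixing_time (colorings \<Delta> k n) (block_dynamics \<Delta> k n 3))))
      \<in> O(\<lambda>n. real (card (tree_verts \<Delta> n)) * ln (real (card (tree_verts \<Delta> n))))"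
proof -
  have k: "4 \<le> k" using adm by (simp add: admissible_def Let_def)
  define c where "c = 4 * (exp 1)\<^sup>2 * ln (real k)"
  have c0: "0 < c" using k by (simp add: c_def)
  define N where "N n = real (card (tree_verts \<Delta> n))" for n
  \<comment> \<open>The final 1 covers rounding the time up to an integer.\<close>
  define B where "B x = 4 * x * ln (c * x + 1) + 1" for x :: real
  have N: "1 \<le> N n" for n using card_tree_verts_ge[OF \<Delta>, of n] by (simp add: N_def)
  have ex: "\<exists>t. mixing_time (colorings \<Delta> k n) (block_dynamics \<Delta> k n 3) \<le> enat t \<and> real t \<le> B (N n)" for n
  proof -
    let ?r = "4 * N n * ln (4 * (exp 1)\<^sup>2 * (N n * ln k) + 1)"
    have eq: "?r + 1 = B (N n)" by (simp add: B_def c_def mult.assoc mult.commute mult.left_commute)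
    have "0 \<le> ?r" using N[of n] k by (intro mult_nonneg_nonneg ln_ge_zero) auto
    then have "?r \<le> nat \<lceil>?r\<rceil>" "real (nat \<lceil>?r\<rceil>) \<le> ?r + 1" by linarith+
    then show ?thesis using mixing_time_le[OF adm, of n "nat \<lceil>?r\<rceil>"] eq by (auto simp: N_def)
  qed
  show "mixing_time (colorings \<Delta> k n) (block_dynamics \<Delta> k n 3) < \<infinity>"
  proof -
    obtain t where "mixing_time (colorings \<Delta> k n) (block_dynamics \<Delta> k n 3) \<le> enat t" using ex[of n] by blast
    also have "enat t < \<infinity>" by simp
    finally show ?thesis .
  qed
  have le: "real (the_enat (mixing_time (colorings \<Delta> k n) (block_dynamics \<Delta> k n 3))) \<le> B (N n)" for n
  proof -
    obtain t where t: "mixing_time (colorings \<Delta> k n) (block_dynamics \<Delta> k n 3) \<le> enat t" "real t \<le> B (N n)"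
      using ex by blast
    obtain j where j: "mixing_time (colorings \<Delta> k n) (block_dynamics \<Delta> k n 3) = enat j"
      using t(1) by (cases "mixing_time (colorings \<Delta> k n) (block_dynamics \<Delta> k n 3)") auto
    then show ?thesis using t by simp
  qed
  have "filterlim N at_top sequentially"
    unfolding N_def
    by (rule filterlim_at_top_mono[OF filterlim_real_sequentially])
       (use card_tree_verts_ge[OF \<Delta>] in \<open>auto intro!: always_eventually less_imp_le\<close>)
  moreover have "B \<in> O[at_top](\<lambda>x. x * ln x)" unfolding B_def[abs_def] using c0 by real_asymp
  ultimately have "(\<lambda>n. B (N n)) \<in> O(\<lambda>n. N n * ln (N n))"
    by (rule landau_o.big.compose[rotated])
  moreover have "(\<lambda>n. real (the_enat (mixing_time (colorings \<Delta> k n) (block_dynamics \<Delta> k n 3)))) \<in> O(\<lambda>n. B (N n))"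
    using le by (intro landau_o.big_mono always_eventually allI) (simp add: order_trans[OF _ abs_ge_self])
  ultimately show "(\<lambda>n. real (the_enat (mixing_time (colorings \<Delta> k n) (block_dynamics \<Delta> k n 3))))
      \<in> O(\<lambda>n. real (card (tree_verts \<Delta> n)) * ln (real (card (tree_verts \<Delta> n))))"
    unfolding N_def[symmetric] using landau_o.big_trans by blast
qed

theorem theorem1p5:
  "\<exists>(\<Delta>\<^sub>0 :: real \<Rightarrow> nat) (l :: real \<Rightarrow> nat). \<forall>C::real. C > 1 \<longrightarrow>
     (let \<epsilon> = min (C - 1) (1/3) in
        \<forall>(\<Delta>::nat) (k::nat). \<Delta> > \<Delta>\<^sub>0 \<epsilon> \<longrightarrow> real k > C * real \<Delta> / ln (real \<Delta>) \<longrightarrow>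
          (let \<Omega> = (\<lambda>n. colorings \<Delta> k n);
               M = (\<lambda>n. block_dynamics \<Delta> k n (l \<epsilon>));
               N = (\<lambda>n. real (card (tree_verts \<Delta> n)))
           in (\<forall>n. entropy_constant (\<Omega> n) (M n) \<ge> 1 / (4 * N n)) \<and>
              (\<forall>n. mixing_time (\<Omega> n) (M n) < \<infinity>) \<and>
              (\<lambda>n. real (the_enat (mixing_time (\<Omega> n) (M n)))) \<in> O(\<lambda>n. N n * ln (N n))))"
proof -
  have "\<exists>\<Delta>0. 0 < \<epsilon> \<and> \<epsilon> \<le> 1 / 3 \<longrightarrow> (\<forall>(\<Delta>::nat) (k::nat). \<Delta> > \<Delta>0 \<longrightarrow>
      real k > (1 + \<epsilon>) * real \<Delta> / ln (real \<Delta>) \<longrightarrow> 1 \<le> \<Delta> \<and> (\<exists>\<beta>. admissible k \<Delta> \<beta>))" for \<epsilon> :: real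
  proof (cases "0 < \<epsilon> \<and> \<epsilon> \<le> 1 / 3")
    case True
    \<comment> \<open>This makes 1 - 8a equal to 1/(1 + \<epsilon>), so that the assumed lower bound
      on \<open>k\<close> becomes the one in the asymptotic statement; \<epsilon> \<le> 1/3
      corresponds to a \<le> 1/32.\<close>
    define a where "a = \<epsilon> / (8 * (1 + \<epsilon>))"
    have "\<epsilon> * 32 \<le> 8 * (1 + \<epsilon>)" using True by simp
    then have a: "0 < a" "a \<le> 1 / 32" using True by (simp_all add: a_def field_simps)
    have a8: "1 - 8 * a = 1 / (1 + \<epsilon>)" using True by (simp add: a_def field_simps)
    obtain \<Delta>1 where \<Delta>1: "\<And>\<Delta> k::nat. \<Delta> \<ge> \<Delta>1 \<Longrightarrow> real \<Delta> / ln \<Delta> \<le> (1 - 8 * a) * k \<Longrightarrow> admissible k \<Delta> (\<Delta> powr (- a))"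
      using admissible_of_large_degree[OF a] unfolding eventually_sequentially by blast
    show ?thesis
    proof (intro exI[of _ "max \<Delta>1 1"] impI allI conjI)
      fix \<Delta> k :: nat assume D: "\<Delta> > max \<Delta>1 1" and k: "real k > (1 + \<epsilon>) * real \<Delta> / ln (real \<Delta>)"
      show "1 \<le> \<Delta>" using D by simp
      have "(1 + \<epsilon>) * (real \<Delta> / ln (real \<Delta>)) \<le> k" using k by simp
      then have "real \<Delta> / ln \<Delta> \<le> (1 - 8 * a) * k"
        unfolding a8 using True by (simp add: pos_le_divide_eq mult.commute)
      then show "\<exists>\<beta>. admissible k \<Delta> \<beta>" using \<Delta>1[of \<Delta> k] D by auto
    qed
  qed auto
  then obtain \<Delta>0 where \<Delta>0: "\<And>\<epsilon> (\<Delta>::nat) (k::nat). 0 < \<epsilon> \<Longrightarrow> \<epsilon> \<le> 1 / 3 \<Longrightarrow> \<Delta> > \<Delta>0 \<epsilon> \<Longrightarrow>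
      real k > (1 + \<epsilon>) * real \<Delta> / ln (real \<Delta>) \<Longrightarrow> 1 \<le> \<Delta> \<and> (\<exists>\<beta>. admissible k \<Delta> \<beta>)"
    by metis
  show ?thesis
    unfolding Let_def
  \<comment> \<open>The block depth is 3 for every \<epsilon>; only the degree threshold varies with
    \<epsilon>.\<close>
  proof (rule exI[of _ \<Delta>0], rule exI[of _ "\<lambda>_. 3"], intro allI impI)
    fix C :: real and \<Delta> k :: nat
    assume C: "C > 1" and D: "\<Delta> > \<Delta>0 (min (C - 1) (1/3))" and k: "real k > C * real \<Delta> / ln (real \<Delta>)"
    let ?\<epsilon> = "min (C - 1) (1/3)"
    \<comment> \<open>The constant \<open>C\<close> may exceed 1 + \<epsilon>. Only the weaker bound
      with 1 + \<epsilon> is kept, so the threshold depends on \<epsilon> alone.\<close>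
    have "(1 + ?\<epsilon>) * (real \<Delta> / ln (real \<Delta>)) \<le> C * (real \<Delta> / ln (real \<Delta>))"
    proof (rule mult_right_mono)
      show "0 \<le> real \<Delta> / ln (real \<Delta>)" by (cases "\<Delta> = 0") auto
    qed auto
    then have "(1 + ?\<epsilon>) * real \<Delta> / ln (real \<Delta>) < k" using k by simp
    moreover have "0 < ?\<epsilon>" "?\<epsilon> \<le> 1 / 3" using C by (auto simp: min_def)
    ultimately have "1 \<le> \<Delta> \<and> (\<exists>\<beta>. admissible k \<Delta> \<beta>)" using D by (intro \<Delta>0[of ?\<epsilon>])
    then obtain \<beta> where "1 \<le> \<Delta>" "admissible k \<Delta> \<beta>" by blast
    then show "(\<forall>n. 1 / (4 * real (card (tree_verts \<Delta> n))) \<le> entropy_constant (colorings \<Delta> k n) (block_dynamics \<Delta> k n 3)) \<and>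
      (\<forall>n. mixing_time (colorings \<Delta> k n) (block_dynamics \<Delta> k n 3) < \<infinity>) \<and>
      (\<lambda>n. real (the_enat (mixing_time (colorings \<Delta> k n) (block_dynamics \<Delta> k n 3))))
        \<in> O(\<lambda>n. real (card (tree_verts \<Delta> n)) * ln (real (card (tree_verts \<Delta> n))))"
      using entropy_constant_ge mixing_time_bound by blast
  qed
qed

end
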